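(* Let $\mathsf{M}$ be a $d\times d$ integer invertible matrix. Let $\Phi=\{\phi^1,\ldots,\phi^r\}$ and $\Psi=\{\psi^1,\ldots,\psi^s\}$ be subsets of $L_2(\mathbb{R}^d)$ with $r,s\in\mathbb{N}\cup\{0\}$. Suppose that the nonhomogeneous $\mathsf{M}$-wavelet system $\mathsf{WS}_J(\Phi;\Psi)$ is an orthonormal basis of $L_2(\mathbb{R}^d)$ for some integer $J$. Then $s=r(|\det\mathsf{M}|-1)$ and there exist an $r\times r$ matrix $\mathbf{a}$ and an $s\times r$ matrix $\mathbf{b}$ of $2\pi\mathbb{Z}^d$-periodic measurable functions in $L_2(\mathbb{T}^d)$ such that $$\hat\phi(\mathsf{M}^T\xi)=\mathbf{a}(\xi)\hat\phi(\xi)\quad\text{and}\quad \hat\psi(\mathsf{M}^T\xi)=\mathbf{b}(\xi)\hat\phi(\xi),\qquad \text{a.e. } \xi\in\mathbb{R}^d,$$ where $\phi:=[\phi^1,\ldots,\phi^r]^T$ and $\psi:=[\psi^1,\ldots,\psi^s]^T$. If in addition $\mathsf{M}$ is an expansive matrix, then the homogeneous $\mathsf{M}$-wavelet system $\mathsf{WS}(\Psi)$ is an orthonormal basis of $L_2(\mathbb{R}^d)$.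
   Context: For $f:\mathbb{R}^d\to\mathbb{C}$, a $d\times d$ real invertible matrix $U$ and $k\in\mathbb{R}^d$, put $f_{U;k}(x):=|\det U|^{1/2}f(Ux-k)$. For subsets $\Phi,\Psi$ of $L_2(\mathbb{R}^d)$ and $J\in\mathbb{Z}$, the nonhomogeneous $\mathsf{M}$-wavelet system is $$\mathsf{WS}_J(\Phi;\Psi):=\{\phi_{\mathsf{M}^J;k}: k\in\mathbb{Z}^d,\phi\in\Phi\}\cup\{\psi_{\mathsf{M}^j;k}: j\ge J,\ k\in\mathbb{Z}^d,\psi\in\Psi\},$$ and the homogeneous $\mathsf{M}$-wavelet system is $\mathsf{WS}(\Psi):=\{\psi_{\mathsf{M}^j;k}: j\in\mathbb{Z},k\in\mathbb{Z}^d,\psi\in\Psi\}$. Generators in a set are not necessarily distinct and are counted with multiplicity (systems are regarded as indexed families). A matrix is expansive if all its eigenvalues have modulus greater than one. The Fourier transform is $\hat f(\xi)=\int_{\mathbb{R}^d}f(x)e^{-ix\cdot\xi}\,dx$ for $f\in L_1(\mathbb{R}^d)$, extended to $L_2(\mathbb{R}^d)$, and is applied entrywise to vectors of functions. $L_2(\mathbb{T}^d)$ denotes $2\pi\mathbb{Z}^d$-periodic measurable functions that are square integrable on $[-\pi,\pi)^d$. *)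

theory Defs
  imports "HOL-Analysis.Analysis"
begin

definition L1 :: "(real ^ 'd \<Rightarrow> complex) set" where
  "L1 = {f. integrable lebesgue f}"

definition L2 :: "(real ^ 'd \<Rightarrow> complex) set" where
  "L2 = {f \<in> borel_measurable lebesgue. integrable lebesgue (\<lambda>x. (cmod (f x))\<^sup>2)}"

definition L2_inner :: "(real ^ 'd \<Rightarrow> complex) \<Rightarrow> (real ^ 'd \<Rightarrow> complex) \<Rightarrow> complex" where
  "L2_inner f g = (\<integral>x. f x * cnj (g x) \<partial>lebesgue)"

(* Squared L2 norm. It is extended-valued, so that it is infinite rather than 0
   for measurable functions outside L2. *)
definition L2_normsq :: "(real ^ 'd \<Rightarrow> complex) \<Rightarrow> ennreal" where
  "L2_normsq f = (\<integral>\<^sup>+ x. ennreal ((cmod (f x))\<^sup>2) \<partial>lebesgue)"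

definition L2_tendsto :: "(nat \<Rightarrow> real ^ 'd \<Rightarrow> complex) \<Rightarrow> (real ^ 'd \<Rightarrow> complex) \<Rightarrow> bool" where
  "L2_tendsto F f \<longleftrightarrow> (\<lambda>n. L2_normsq (\<lambda>x. F n x - f x)) \<longlonglongrightarrow> 0"

(* Functions are not identified modulo null sets; uniqueness of limits and of
   expansions is therefore only almost everywhere. Members of a family are
   distinguished by their index, so repeated functions count with multiplicity. *)
definition orthonormal_basis_L2 :: "'i set \<Rightarrow> ('i \<Rightarrow> real ^ 'd \<Rightarrow> complex) \<Rightarrow> bool" where
  "orthonormal_basis_L2 I e \<longleftrightarrow>
     (\<forall>i\<in>I. e i \<in> L2) \<and>
     (\<forall>i\<in>I. \<forall>j\<in>I. L2_inner (e i) (e j) = (if i = j then 1 else 0)) \<and>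
     (\<forall>f\<in>L2. \<forall>\<epsilon>>0. \<exists>F c. finite F \<and> F \<subseteq> I \<and>
        L2_normsq (\<lambda>x. f x - (\<Sum>i\<in>F. c i * e i x)) < ennreal \<epsilon>)"

definition fourier_L1 :: "(real ^ 'd \<Rightarrow> complex) \<Rightarrow> real ^ 'd \<Rightarrow> complex" where
  "fourier_L1 f \<xi> = (\<integral>x. f x * exp (- \<i> * complex_of_real (x \<bullet> \<xi>)) \<partial>lebesgue)"

(* The extension by continuity of the transform on L1 \<inter> L2: such a g exists by
   Plancherel's theorem and, L1 \<inter> L2 being dense, is unique up to null sets. *)
definition is_fourier_L2 :: "(real ^ 'd \<Rightarrow> complex) \<Rightarrow> (real ^ 'd \<Rightarrow> complex) \<Rightarrow> bool" where
  "is_fourier_L2 f g \<longleftrightarrow> g \<in> L2 \<and>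
     (\<forall>F. (\<forall>n. F n \<in> L1 \<inter> L2) \<and> L2_tendsto F f \<longrightarrow> L2_tendsto (\<lambda>n. fourier_L1 (F n)) g)"

definition fourier_L2 :: "(real ^ 'd \<Rightarrow> complex) \<Rightarrow> real ^ 'd \<Rightarrow> complex" where
  "fourier_L2 f = (SOME g. is_fourier_L2 f g)"

definition int_vecs :: "(real ^ 'd) set" where
  "int_vecs = {k. \<forall>i. k $ i \<in> \<int>}"

definition L2_torus :: "(real ^ 'd \<Rightarrow> complex) set" where
  "L2_torus = {f \<in> borel_measurable lebesgue.
     (\<forall>\<xi>. \<forall>k\<in>int_vecs. f (\<xi> + (2 * pi) *\<^sub>R k) = f \<xi>) \<and>
     set_integrable lebesgue {\<xi>. \<forall>i. - pi \<le> \<xi> $ i \<and> \<xi> $ i < pi} (\<lambda>\<xi>. (cmod (f \<xi>))\<^sup>2)}"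

(* The power M^j for an invertible matrix M and an integer exponent j. *)
definition matrix_powi :: "real ^ 'd ^ 'd \<Rightarrow> int \<Rightarrow> real ^ 'd ^ 'd" where
  "matrix_powi M j =
     (if 0 \<le> j then (((**) M) ^^ nat j) (mat 1)
      else (((**) (matrix_inv M)) ^^ nat (- j)) (mat 1))"

definition integer_matrix :: "real ^ 'd ^ 'd \<Rightarrow> bool" where
  "integer_matrix M \<longleftrightarrow> (\<forall>i j. M $ i $ j \<in> \<int>)"

(* The eigenvalues are those over the complex numbers. *)
definition expansive :: "real ^ 'd ^ 'd \<Rightarrow> bool" where
  "expansive M \<longleftrightarrow>
     (\<forall>(c::complex) (v::complex ^ 'd). v \<noteq> 0 \<and>
        (\<chi> i j. complex_of_real (M $ i $ j)) *v v = c *s v \<longrightarrow> cmod c > 1)"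

definition dilate_shift ::
  "real ^ 'd ^ 'd \<Rightarrow> real ^ 'd \<Rightarrow> (real ^ 'd \<Rightarrow> complex) \<Rightarrow> real ^ 'd \<Rightarrow> complex" where
  "dilate_shift U k f x = complex_of_real (sqrt \<bar>det U\<bar>) * f (U *v x - k)"

(* Generators are enumerated as \<phi> 0, ..., \<phi> (r - 1) and \<psi> 0, ..., \<psi> (s - 1);
   the values of \<phi> and \<psi> at other indices are irrelevant. *)
definition WS_nonhom_index ::
  "nat \<Rightarrow> nat \<Rightarrow> int \<Rightarrow> ((nat \<times> (real ^ 'd)) + (int \<times> nat \<times> (real ^ 'd))) set" where
  "WS_nonhom_index r s J = ({..<r} \<times> int_vecs) <+> ({J..} \<times> {..<s} \<times> int_vecs)"

fun WS_nonhom ::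
  "real ^ 'd ^ 'd \<Rightarrow> int \<Rightarrow> (nat \<Rightarrow> real ^ 'd \<Rightarrow> complex) \<Rightarrow> (nat \<Rightarrow> real ^ 'd \<Rightarrow> complex)
     \<Rightarrow> (nat \<times> (real ^ 'd)) + (int \<times> nat \<times> (real ^ 'd)) \<Rightarrow> real ^ 'd \<Rightarrow> complex" where
  "WS_nonhom M J \<phi> \<psi> (Inl (l, k)) = dilate_shift (matrix_powi M J) k (\<phi> l)"
| "WS_nonhom M J \<phi> \<psi> (Inr (j, l, k)) = dilate_shift (matrix_powi M j) k (\<psi> l)"

definition WS_hom_index :: "nat \<Rightarrow> (int \<times> nat \<times> (real ^ 'd)) set" where
  "WS_hom_index s = UNIV \<times> {..<s} \<times> int_vecs"

fun WS_hom ::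
  "real ^ 'd ^ 'd \<Rightarrow> (nat \<Rightarrow> real ^ 'd \<Rightarrow> complex)
     \<Rightarrow> int \<times> nat \<times> (real ^ 'd) \<Rightarrow> real ^ 'd \<Rightarrow> complex" where
  "WS_hom M \<psi> (j, l, k) = dilate_shift (matrix_powi M j) k (\<psi> l)"

end

theory Submission
  imports Defs "HOL-Probability.Probability" "HOL-Computational_Algebra.Fundamental_Theorem_Algebra"
begin

text \<open>Dilation by a power of \<open>M\<close> is unitary and carries the system at one level to the system at
another, so the nonhomogeneous system is an orthonormal basis at every level
(\<open>WS_nonhom_change_level\<close>). Levels 0 and 1 have the functions \<open>\<psi>\<close> of scales
\<open>j \<ge> 1\<close> in common. Removing these from both, what is left of level 1, the functions
\<open>dilate_shift M k (\<phi> l)\<close>, and what is left of level 0, the integer translates of all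
\<open>\<phi> l\<close> and \<open>\<psi> l\<close>, are two orthonormal bases of one closed subspace \<open>V\<close>. The first two claims
compare these bases.

Masks. Each generator lies in \<open>V\<close> and is an \<open>\<ell>\<^sup>2\<close>-combination of the functions
\<open>dilate_shift M k (\<phi> l)\<close>. On the Fourier side a shift by \<open>k\<close> is the factor
\<open>exp (- \<i> k \<bullet> \<xi>)\<close>, so the expansion becomes a sum of trigonometric series times the
transforms of the \<open>\<phi> l\<close>. The coefficients are square summable, so the trigonometric series
converge in \<open>L\<^sup>2\<close> of the torus, and their limits are the masks. If the partial sums are chosen
with tails at most \<open>(1/8)\<^sup>n\<close>, then both the trigonometric sums and the transformed partial sums
converge almost everywhere, and the refinement equation follows by comparing pointwise limits
(\<open>refinement_mask\<close>).

Number of generators. \<open>V\<close> is invariant under integer translations, which permute both bases. The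
level 0 basis has \<open>r + s\<close> orbits. The level 1 basis has \<open>r\<close> orbits for each coset of the
lattice \<open>M \<int>\<^sup>d\<close> in \<open>\<int>\<^sup>d\<close>, and there are \<open>\<bar>det M\<bar>\<close> cosets because \<open>M\<close> times the
unit cube tiles space (\<open>card_coset_reps\<close>). Summing the squared inner products of representatives
of the first kind with all basis elements of the second kind, in either order, gives both numbers
of orbits by Parseval (\<open>double_parseval_card\<close>), so \<open>r + s = r * \<bar>det M\<bar>\<close>.

Homogeneous system. Any two of its elements occur in a common nonhomogeneous system, so it is
orthonormal. For completeness, expand a compactly supported \<open>g\<close> at a very negative level \<open>J\<close>. The
map \<open>matrix_powi M J\<close> shrinks the support of \<open>g\<close> into a tiny ball, because the powers of the inverse
of an expansive matrix tend to 0. After the change of variables, the coefficients of \<open>g\<close> against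
the \<open>\<phi>\<close>-part only see the mass of \<open>\<phi>\<close> near lattice points. This mass tends to 0, so the
\<open>\<psi>\<close>-part alone approximates \<open>g\<close> (\<open>homogeneous_basis\<close>).

The function \<open>fourier_L2\<close> is given by a choice operator, so it has the expected properties only
once a limit transform is known to exist. All that is needed is that the transform is bounded from
\<open>L1 \<inter> L2\<close> to \<open>L2\<close>, with any constant. This inequality, rather than Plancherel's identity, is
proved by inserting a Gaussian weight and letting it tend to 1 (\<open>fourier_L1_bound\<close>).\<close>

section \<open>Linear changes of variables in Lebesgue integrals\<close>

lemma Basis_cart: "(Basis :: (real ^ 'd) set) = range (\<lambda>i. axis i 1)"
  by (auto simp: Basis_vec_def)

lemma inj_axis_1: "inj (\<lambda>i. axis i (1::real) :: real ^ 'd)"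
  by (auto simp: inj_on_def axis_eq_axis)

lemma nn_integral_lborel_shift:
  fixes g :: "'a::euclidean_space \<Rightarrow> ennreal"
  assumes [measurable]: "g \<in> borel_measurable borel"
  shows "(\<integral>\<^sup>+x. g (x + c) \<partial>lborel) = (\<integral>\<^sup>+x. g x \<partial>lborel)"
proof -
  have "(\<integral>\<^sup>+x. g x \<partial>lborel) = (\<integral>\<^sup>+x. g x \<partial>distr lborel borel ((+) c))"
    by (simp add: lborel_distr_plus)
  also have "\<dots> = (\<integral>\<^sup>+x. g (x + c) \<partial>lborel)"
    by (subst nn_integral_distr) (auto simp: add.commute)
  finally show ?thesis ..
qed

text \<open>A shear translates every line in direction \<open>e\<close> rigidly, so it preserves volume. To see this without
coordinates, spread each point along its line: insert the factor \<open>\<integral> I (t + x \<bullet> e) dt = 1\<close>,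
exchange the integrals, and translate \<open>x\<close> by \<open>- t e\<close>. The integral over \<open>t\<close> then runs over
the whole line, where the amount \<open>v x\<close> of the shear no longer matters.\<close>

lemma nn_integral_lborel_shear:
  fixes g :: "'a::euclidean_space \<Rightarrow> ennreal" and v :: "'a \<Rightarrow> real"
  assumes e: "e \<in> Basis"
    and [measurable]: "g \<in> borel_measurable borel" "v \<in> borel_measurable borel"
    and v: "\<And>x t. v (x + t *\<^sub>R e) = v x"
  shows "(\<integral>\<^sup>+x. g (x + v x *\<^sub>R e) \<partial>lborel) = (\<integral>\<^sup>+x. g x \<partial>lborel)"
proof -
  define I :: "real \<Rightarrow> ennreal" where "I = indicator {0..1}"
  have I[measurable]: "I \<in> borel_measurable borel" and I1: "(\<integral>\<^sup>+t. I t \<partial>lborel) = 1"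
    by (auto simp: I_def)
  \<comment> \<open>The right-hand side does not involve \<open>w\<close>. The instances \<open>w = v\<close> and \<open>w = 0\<close> give the claim.\<close>
  have key: "(\<integral>\<^sup>+x. g (x + w x *\<^sub>R e) \<partial>lborel) = (\<integral>\<^sup>+x. I (x \<bullet> e) * (\<integral>\<^sup>+t. g (x - t *\<^sub>R e) \<partial>lborel) \<partial>lborel)"
    if w: "\<And>x t. w (x + t *\<^sub>R e) = w x" and [measurable]: "w \<in> borel_measurable borel" for w :: "'a \<Rightarrow> real"
  proof -
    have "(\<integral>\<^sup>+x. g (x + w x *\<^sub>R e) \<partial>lborel) = (\<integral>\<^sup>+x. (\<integral>\<^sup>+t. I (t + x \<bullet> e) \<partial>lborel) * g (x + w x *\<^sub>R e) \<partial>lborel)"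
      using I1 by (simp add: nn_integral_lborel_shift)
    also have "\<dots> = (\<integral>\<^sup>+x. (\<integral>\<^sup>+t. I (t + x \<bullet> e) * g (x + w x *\<^sub>R e) \<partial>lborel) \<partial>lborel)"
      by (intro nn_integral_cong nn_integral_multc[symmetric]) measurable
    also have "\<dots> = (\<integral>\<^sup>+t. (\<integral>\<^sup>+x. I (t + x \<bullet> e) * g (x + w x *\<^sub>R e) \<partial>lborel) \<partial>lborel)"
      by (intro lborel_pair.Fubini'[symmetric]) measurable
    also have "\<dots> = (\<integral>\<^sup>+t. (\<integral>\<^sup>+x. I (x \<bullet> e) * g (x - t *\<^sub>R e + w x *\<^sub>R e) \<partial>lborel) \<partial>lborel)"
    proof (rule nn_integral_cong)
      fix t
      have *: "w (x + - t *\<^sub>R e) = w x" for x by (rule w)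
      show "(\<integral>\<^sup>+x. I (t + x \<bullet> e) * g (x + w x *\<^sub>R e) \<partial>lborel) = (\<integral>\<^sup>+x. I (x \<bullet> e) * g (x - t *\<^sub>R e + w x *\<^sub>R e) \<partial>lborel)"
        using * e by (subst nn_integral_lborel_shift[where c="- t *\<^sub>R e", symmetric])
          (simp_all add: inner_diff_left algebra_simps)
    qed
    also have "\<dots> = (\<integral>\<^sup>+x. (\<integral>\<^sup>+t. I (x \<bullet> e) * g (x - t *\<^sub>R e + w x *\<^sub>R e) \<partial>lborel) \<partial>lborel)"
      by (intro lborel_pair.Fubini') measurable
    also have "\<dots> = (\<integral>\<^sup>+x. I (x \<bullet> e) * (\<integral>\<^sup>+t. g (x - t *\<^sub>R e + w x *\<^sub>R e) \<partial>lborel) \<partial>lborel)"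
      by (intro nn_integral_cong nn_integral_cmult) measurable
    also have "\<dots> = (\<integral>\<^sup>+x. I (x \<bullet> e) * (\<integral>\<^sup>+t. g (x - t *\<^sub>R e) \<partial>lborel) \<partial>lborel)"
    proof (rule nn_integral_cong)
      fix x
      have "(\<integral>\<^sup>+t. g (x - t *\<^sub>R e + w x *\<^sub>R e) \<partial>lborel) = (\<integral>\<^sup>+t. g (x - t *\<^sub>R e) \<partial>lborel)"
        by (subst nn_integral_lborel_shift[where c="w x", symmetric]) (auto simp: algebra_simps)
      then show "I (x \<bullet> e) * (\<integral>\<^sup>+t. g (x - t *\<^sub>R e + w x *\<^sub>R e) \<partial>lborel) = I (x \<bullet> e) * (\<integral>\<^sup>+t. g (x - t *\<^sub>R e) \<partial>lborel)"
        by simp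
    qed
    finally show ?thesis .
  qed
  show ?thesis
    using key[of v, OF v] key[of "\<lambda>_. 0"] by simp
qed

lemma distr_density_const:
  assumes [measurable]: "g \<in> borel \<rightarrow>\<^sub>M borel" "f \<in> borel \<rightarrow>\<^sub>M borel"
  shows "distr (density (distr lborel borel g) (\<lambda>_. c)) borel f = density (distr lborel borel (f \<circ> g)) (\<lambda>_. c)"
proof (rule measure_eqI)
  fix A assume "A \<in> sets (distr (density (distr lborel borel g) (\<lambda>_. c)) borel f)"
  then have [measurable]: "A \<in> sets borel" by simp
  have [measurable]: "f -` A \<in> sets borel" "g -` f -` A \<in> sets lborel"
    using measurable_sets_borel[of f borel A] measurable_sets_borel[of g borel "f -` A"] by simp_all
  show "emeasure (distr (density (distr lborel borel g) (\<lambda>_. c)) borel f) A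
      = emeasure (density (distr lborel borel (f \<circ> g)) (\<lambda>_. c)) A"
    by (simp add: emeasure_distr emeasure_density nn_integral_cmult vimage_comp)
qed simp

text \<open>Induction over a factorization into elementary maps. Coordinate scalings are affine maps of
product form, coordinate swaps permute the sides of a box, shears are covered by
\<open>nn_integral_lborel_shear\<close>, and determinants multiply under composition. Maps with a vanishing
coordinate are singular, which the hypothesis on the determinant excludes.\<close>

lemma lborel_linear_density:
  fixes f :: "real ^ 'n \<Rightarrow> real ^ 'n"
  assumes "linear f" "det (matrix f) \<noteq> 0"
  shows "lborel = density (distr lborel borel f) (\<lambda>_. ennreal \<bar>det (matrix f)\<bar>)"
proof -
  have "linear f \<longrightarrow> det (matrix f) \<noteq> 0 \<longrightarrow>
      lborel = density (distr lborel borel f) (\<lambda>_. ennreal \<bar>det (matrix f)\<bar>)"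
  proof (rule induct_linear_elementary[OF assms(1)], goal_cases)
    case (1 f g)
    have [measurable]: "f \<in> borel \<rightarrow>\<^sub>M borel" "g \<in> borel \<rightarrow>\<^sub>M borel"
      using 1 by (auto intro!: borel_measurable_continuous_onI linear_continuous_on simp: linear_conv_bounded_linear)
    show ?case
    proof (intro impI)
      assume "det (matrix (f \<circ> g)) \<noteq> 0"
      moreover have d: "det (matrix (f \<circ> g)) = det (matrix f) * det (matrix g)"
        using 1 by (simp add: matrix_compose det_mul)
      ultimately have F: "lborel = density (distr lborel borel f) (\<lambda>_. ennreal \<bar>det (matrix f)\<bar>)"
        and G: "lborel = density (distr lborel borel g) (\<lambda>_. ennreal \<bar>det (matrix g)\<bar>)"
        using 1 by auto
      have "distr lborel borel f = distr (density (distr lborel borel g) (\<lambda>_. ennreal \<bar>det (matrix g)\<bar>)) borel f"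
        by (simp flip: G)
      also have "\<dots> = density (distr lborel borel (f \<circ> g)) (\<lambda>_. ennreal \<bar>det (matrix g)\<bar>)"
        by (rule distr_density_const) measurable
      finally have "density (distr lborel borel f) (\<lambda>_. ennreal \<bar>det (matrix f)\<bar>)
         = density (density (distr lborel borel (f \<circ> g)) (\<lambda>_. ennreal \<bar>det (matrix g)\<bar>)) (\<lambda>_. ennreal \<bar>det (matrix f)\<bar>)"
        by simp
      also have "\<dots> = density (distr lborel borel (f \<circ> g)) (\<lambda>_. ennreal \<bar>det (matrix (f \<circ> g))\<bar>)"
        by (simp add: density_density_eq d abs_mult ennreal_mult mult.commute)
      finally show "lborel = \<dots>" using F by simp
    qed
  next
    case (2 f i)
    have "det (matrix f) = 0"
      using 2 by (intro det_zero_row(2)[of i]) (simp add: row_def matrix_def vec_eq_iff)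
    then show ?case by simp
  next
    case (3 c)
    define m where "m = (\<lambda>b::real^'n. \<Sum>i\<in>UNIV. c i * b $ i)"
    have m: "m (axis i 1) = c i" for i by (simp add: m_def axis_def if_distrib cong: if_cong)
    have d: "det (matrix (\<lambda>x. \<chi> i. c i * x $ i)) = (\<Prod>i\<in>UNIV. c i)"
      by (subst det_diagonal) (auto simp: matrix_def axis_def)
    note B = Basis_cart
    note inj = inj_axis_1
    have T: "(0 + (\<Sum>j\<in>Basis. (m j * (x \<bullet> j)) *\<^sub>R j)) = (\<chi> i. c i * x $ i)" for x
    proof -
      have "(\<Sum>j\<in>Basis. (m j * (x \<bullet> j)) *\<^sub>R j) = (\<Sum>i\<in>UNIV. (c i * x $ i) *\<^sub>R axis i 1)"
        by (simp add: B sum.reindex[OF inj] m inner_axis)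
      then show ?thesis by (simp add: vec_eq_iff axis_def if_distrib cong: if_cong)
    qed
    show ?case
    proof (intro impI)
      assume "det (matrix (\<lambda>x. \<chi> i. c i * x $ i)) \<noteq> 0"
      then have c: "\<And>i. c i \<noteq> 0" by (simp add: d)
      have "lborel = density (distr lborel borel (\<lambda>x. 0 + (\<Sum>j\<in>Basis. (m j * (x \<bullet> j)) *\<^sub>R j))) (\<lambda>_. (\<Prod>j\<in>Basis. \<bar>m j\<bar>))"
        by (rule lborel_affine_euclidean) (auto simp: B m c)
      then show "lborel = density (distr lborel borel (\<lambda>x. \<chi> i. c i * x $ i)) (\<lambda>_. ennreal \<bar>det (matrix (\<lambda>x. \<chi> i. c i * x $ i))\<bar>)"
        unfolding T d abs_prod by (simp add: B prod.reindex[OF inj] m)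
    qed
  next
    case (4 p q)
    let ?h = "\<lambda>v::real^'n. \<chi> i. v $ Transposition.transpose p q i"
    have "matrix ?h = transpose (\<chi> i j. mat 1 $ i $ Transposition.transpose p q j)"
      by (auto simp: transpose_def axis_def mat_def matrix_def vec_eq_iff)
    then have d: "\<bar>det (matrix ?h)\<bar> = 1"
      by (simp add: det_permute_columns permutes_swap_id sign_swap_id abs_mult)
    have [measurable]: "?h \<in> borel \<rightarrow>\<^sub>M borel"
      by (intro borel_measurable_continuous_onI continuous_intros)
    have "lborel = distr lborel borel ?h"
    proof (rule lborel_eqI)
      fix l u :: "real^'n" assume lu: "\<And>b. b \<in> Basis \<Longrightarrow> l \<bullet> b \<le> u \<bullet> b"
      have pre: "?h -` box l u = box (?h l) (?h u)"
        by (auto simp: mem_box_cart) (metis transpose_involutory)+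
      note B = Basis_cart
      note inj = inj_axis_1
      have lu': "l $ i \<le> u $ i" for i using lu[of "axis i 1"] by (simp add: B inner_axis)
      have "emeasure (distr lborel borel ?h) (box l u) = emeasure lborel (box (?h l) (?h u))"
        by (subst emeasure_distr) (auto simp: pre)
      also have "\<dots> = (\<Prod>b\<in>Basis. (?h u - ?h l) \<bullet> b)"
        by (rule emeasure_lborel_box) (auto simp: B inner_axis lu')
      also have "(\<Prod>b\<in>Basis. (?h u - ?h l) \<bullet> b) = (\<Prod>i\<in>UNIV. (u - l) $ Transposition.transpose p q i)"
        by (simp add: B prod.reindex[OF inj] inner_axis inner_diff_left)
      also have "\<dots> = (\<Prod>i\<in>UNIV. (u - l) $ i)"
        by (rule prod.permute[OF permutes_swap_id, unfolded comp_def, symmetric]) auto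
      also have "\<dots> = (\<Prod>b\<in>Basis. (u - l) \<bullet> b)"
        by (simp add: B prod.reindex[OF inj] inner_axis inner_diff_left)
      finally show "emeasure (distr lborel borel ?h) (box l u) = (\<Prod>b\<in>Basis. (u - l) \<bullet> b)" .
    qed simp
    then show ?case by (simp add: d density_1)
  next
    case (5 p q)
    let ?h = "\<lambda>v::real^'n. \<chi> i. if i = p then v $ p + v $ q else v $ i"
    have "matrix ?h = (\<chi> k. if k = p then row p (mat 1) + 1 *s row q (mat 1) else row k (mat 1))"
      by (auto simp: vec_eq_iff matrix_def row_def mat_def axis_def)
    then have d: "det (matrix ?h) = 1"
      using det_row_operation[OF \<open>p \<noteq> q\<close>, of "mat 1 :: real^'n^'n" 1] by simp
    have h: "?h x = x + (x $ q) *\<^sub>R axis p 1" for x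
      by (auto simp: vec_eq_iff axis_def)
    have [measurable]: "?h \<in> borel \<rightarrow>\<^sub>M borel"
      unfolding h by (intro borel_measurable_continuous_onI continuous_intros)
    have "lborel = distr lborel borel ?h"
    proof (rule measure_eqI)
      fix A :: "(real^'n) set" assume "A \<in> sets lborel"
      then have [measurable]: "A \<in> sets borel" by simp
      have [measurable]: "(\<lambda>x::real^'n. x $ q) \<in> borel_measurable borel"
        by (intro borel_measurable_continuous_onI continuous_intros)
      have "emeasure (distr lborel borel ?h) A = (\<integral>\<^sup>+x. indicator A (?h x) \<partial>lborel)"
        by (simp add: nn_integral_distr flip: nn_integral_indicator)
      also have "\<dots> = (\<integral>\<^sup>+x. indicator A (x + (x $ q) *\<^sub>R axis p 1) \<partial>lborel)"
        unfolding h ..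
      also have "\<dots> = (\<integral>\<^sup>+x. indicator A x \<partial>lborel)"
        using \<open>p \<noteq> q\<close> by (intro nn_integral_lborel_shear) (auto simp: Basis_vec_def axis_def)
      finally show "emeasure lborel A = emeasure (distr lborel borel ?h) A" by simp
    qed simp
    then show ?case by (simp add: d density_1)
  qed
  with assms show ?thesis by blast
qed

text \<open>The Borel statement passes to the completion because the map neither creates nor destroys Borel
null sets.\<close>

lemma
  fixes U :: "real ^ 'n ^ 'n"
  assumes "invertible U"
  shows lebesgue_matrix_affine: "lebesgue = density (distr lebesgue lebesgue (\<lambda>x. U *v x - k)) (\<lambda>_. ennreal \<bar>det U\<bar>)"
    and measurable_matrix_affine: "(\<lambda>x. U *v x - k) \<in> lebesgue \<rightarrow>\<^sub>M lebesgue"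
proof -
  let ?T = "\<lambda>x. U *v x - k" and ?c = "ennreal \<bar>det U\<bar>"
  have c: "?c \<noteq> 0" using assms by (simp add: invertible_det_nz)
  have lin: "linear ((*v) U)" by simp
  have mU[measurable]: "(*v) U \<in> borel \<rightarrow>\<^sub>M borel"
    by (intro borel_measurable_continuous_onI) (intro continuous_intros)
  have [measurable]: "?T \<in> borel \<rightarrow>\<^sub>M borel" by measurable
  have 1: "lborel = density (distr lborel borel ((*v) U)) (\<lambda>_. ?c)"
    using lborel_linear_density[OF lin] assms by (simp add: invertible_det_nz matrix_of_matrix_vector_mul)
  have "lborel = distr lborel borel ((+) (- k))" by (simp add: lborel_distr_plus)
  also have "\<dots> = distr (density (distr lborel borel ((*v) U)) (\<lambda>_. ?c)) borel ((+) (- k))"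
    by (simp flip: 1)
  also have "\<dots> = density (distr lborel borel ((+) (- k) \<circ> (*v) U)) (\<lambda>_. ?c)"
    by (rule distr_density_const) measurable
  also have "(+) (- k) \<circ> (*v) U = ?T"
    by (simp add: fun_eq_iff)
  finally have B: "lborel = density (distr lborel borel ?T) (\<lambda>_. ?c)" .
  { fix A :: "(real^'n) set" assume A: "A \<in> sets borel"
    then have "emeasure lborel A = 0 \<longleftrightarrow> emeasure (density (distr lborel borel ?T) (\<lambda>_. ?c)) A = 0"
      by (subst B) auto
    also have "\<dots> \<longleftrightarrow> emeasure (distr lebesgue lborel ?T) A = 0"
      using A c by (simp add: distr_completion emeasure_density nn_integral_cmult cong: distr_cong)
    finally have "emeasure lborel A = 0 \<longleftrightarrow> emeasure (distr lebesgue lborel ?T) A = 0" . }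
  then have eq: "null_sets lborel = null_sets (distr lebesgue lborel ?T)"
    by (auto simp: null_sets_def)
  show "?T \<in> lebesgue \<rightarrow>\<^sub>M lebesgue"
    by (simp add: completion.measurable_completion2 eq measurable_completion)
  have "lebesgue = completion (density (distr lborel borel ?T) (\<lambda>_. ?c))"
    by (subst B) simp
  also have "\<dots> = density (completion (distr lebesgue lborel ?T)) (\<lambda>_. ?c)"
    using c by (auto intro!: always_eventually completion_density_eq simp: distr_completion zero_less_iff_neq_zero cong: distr_cong)
  also have "\<dots> = density (distr lebesgue lebesgue ?T) (\<lambda>_. ?c)"
    by (subst completion.completion_distr_eq) (auto simp: eq measurable_completion)
  finally show "lebesgue = density (distr lebesgue lebesgue ?T) (\<lambda>_. ?c)" .
qed

lemma nn_integral_matrix_affine: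
  fixes U :: "real ^ 'n ^ 'n" and g :: "real ^ 'n \<Rightarrow> ennreal"
  assumes "invertible U" and g: "g \<in> borel_measurable lebesgue"
  shows "(\<integral>\<^sup>+x. g x \<partial>lebesgue) = ennreal \<bar>det U\<bar> * (\<integral>\<^sup>+x. g (U *v x - k) \<partial>lebesgue)"
proof -
  note [measurable] = measurable_matrix_affine[OF assms(1), of k] g
  show ?thesis
    by (subst lebesgue_matrix_affine[OF assms(1), of k])
      (simp add: nn_integral_density nn_integral_distr nn_integral_cmult)
qed

lemma integral_matrix_affine:
  fixes U :: "real ^ 'n ^ 'n" and g :: "real ^ 'n \<Rightarrow> 'b::{banach, second_countable_topology}"
  assumes "invertible U" and g: "g \<in> borel_measurable lebesgue"
  shows "(\<integral>x. g x \<partial>lebesgue) = \<bar>det U\<bar> *\<^sub>R (\<integral>x. g (U *v x - k) \<partial>lebesgue)"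
proof -
  note [measurable] = measurable_matrix_affine[OF assms(1), of k] g
  show ?thesis
    by (subst lebesgue_matrix_affine[OF assms(1), of k])
      (simp add: integral_density integral_distr)
qed

lemma integrable_matrix_affine:
  fixes U :: "real ^ 'n ^ 'n" and f :: "real ^ 'n \<Rightarrow> 'b::{banach, second_countable_topology}"
  assumes U: "invertible U" and f: "integrable lebesgue f"
  shows "integrable lebesgue (\<lambda>x. f (U *v x - k))"
  unfolding integrable_iff_bounded
proof
  note [measurable] = measurable_matrix_affine[OF U, of k] borel_measurable_integrable[OF f]
  show "(\<lambda>x. f (U *v x - k)) \<in> borel_measurable lebesgue" by measurable
  have c: "ennreal \<bar>det U\<bar> \<noteq> 0" using U by (simp add: invertible_det_nz)
  have "ennreal \<bar>det U\<bar> * (\<integral>\<^sup>+x. ennreal (norm (f (U *v x - k))) \<partial>lebesgue) < \<infinity>"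
    using f nn_integral_matrix_affine[OF U, of "\<lambda>x. ennreal (norm (f x))" k] by (auto simp: integrable_iff_bounded)
  then show "(\<integral>\<^sup>+x. ennreal (norm (f (U *v x - k))) \<partial>lebesgue) < \<infinity>"
    using c by (auto simp: ennreal_mult_less_top)
qed

lemma AE_matrix_affine:
  fixes U :: "real ^ 'n ^ 'n"
  assumes U: "invertible U" and "AE x in lebesgue. P x"
  shows "AE x in lebesgue. P (U *v x - k)"
proof -
  have c: "ennreal \<bar>det U\<bar> \<noteq> 0" using U by (simp add: invertible_det_nz)
  have "AE x in density (distr lebesgue lebesgue (\<lambda>x. U *v x - k)) (\<lambda>_. ennreal \<bar>det U\<bar>). P x"
    by (subst lebesgue_matrix_affine[OF U, of k, symmetric]) (rule assms(2))
  then have "AE x in distr lebesgue lebesgue (\<lambda>x. U *v x - k). P x"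
    using c by (subst (asm) AE_density) (auto simp: zero_less_iff_neq_zero)
  then show ?thesis
    using AE_distrD[OF measurable_matrix_affine[OF U]] by blast
qed

lemma invertible_mat_1: "invertible (mat 1 :: 'a::semiring_1 ^ 'n ^ 'n)"
  unfolding invertible_def by (metis matrix_mul_lid)

lemma
  fixes c :: "real ^ 'd"
  assumes S: "S \<in> sets lebesgue"
  shows lebesgue_sets_translate: "{y. y - c \<in> S} \<in> sets lebesgue"
    and emeasure_lebesgue_translate: "emeasure lebesgue {y. y - c \<in> S} = emeasure lebesgue S"
proof -
  have m: "(\<lambda>y. y - c) \<in> lebesgue \<rightarrow>\<^sub>M lebesgue"
    using measurable_matrix_affine[OF invertible_mat_1, of c] by simp
  have "(\<lambda>y. y - c) -` S \<inter> space lebesgue \<in> sets lebesgue" by (rule measurable_sets[OF m S])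
  then show meas: "{y. y - c \<in> S} \<in> sets lebesgue" by (simp add: vimage_def)
  have "emeasure lebesgue S = (\<integral>\<^sup>+y. indicator S (y - c) \<partial>lebesgue)"
    using nn_integral_matrix_affine[OF invertible_mat_1, of "indicator S" c] S by simp
  also have "\<dots> = (\<integral>\<^sup>+y. indicator {y. y - c \<in> S} y \<partial>lebesgue)"
    by (intro nn_integral_cong) (auto simp: indicator_def)
  also have "\<dots> = emeasure lebesgue {y. y - c \<in> S}" using meas by simp
  finally show "emeasure lebesgue {y. y - c \<in> S} = emeasure lebesgue S" ..
qed

section \<open>Square-integrable functions\<close>

lemma L2_iff: "f \<in> L2 \<longleftrightarrow> f \<in> borel_measurable lebesgue \<and> L2_normsq f < \<infinity>"
  unfolding L2_def L2_normsq_def by (auto simp: integrable_iff_bounded)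

lemma L2_measurable: "f \<in> L2 \<Longrightarrow> f \<in> borel_measurable lebesgue"
  by (simp add: L2_iff)

text \<open>This crude form of the triangle inequality, from \<open>(a + b)\<^sup>2 \<le> 2 a\<^sup>2 + 2 b\<^sup>2\<close>, avoids square roots
of extended reals. Only qualitative convergence is drawn from it, so the factor 2 is harmless.\<close>

lemma L2_normsq_add_le:
  assumes [measurable]: "f \<in> borel_measurable lebesgue" "g \<in> borel_measurable lebesgue"
  shows "L2_normsq (\<lambda>x. f x + g x) \<le> 2 * L2_normsq f + 2 * L2_normsq g"
proof -
  have p: "(cmod (u + v))\<^sup>2 \<le> 2 * (cmod u)\<^sup>2 + 2 * (cmod v)\<^sup>2" for u v
  proof -
    have "(cmod (u + v))\<^sup>2 \<le> (cmod u + cmod v)\<^sup>2"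
      by (intro power_mono norm_triangle_ineq) auto
    moreover have "0 \<le> (cmod u - cmod v)\<^sup>2" by simp
    ultimately show ?thesis by (simp add: power2_eq_square algebra_simps)
  qed
  have "L2_normsq (\<lambda>x. f x + g x) \<le> (\<integral>\<^sup>+x. 2 * ennreal ((cmod (f x))\<^sup>2) + 2 * ennreal ((cmod (g x))\<^sup>2) \<partial>lebesgue)"
    unfolding L2_normsq_def
  proof (rule nn_integral_mono)
    fix x
    have "ennreal ((cmod (f x + g x))\<^sup>2) \<le> ennreal (2 * (cmod (f x))\<^sup>2 + 2 * (cmod (g x))\<^sup>2)"
      by (rule ennreal_leI[OF p])
    also have "\<dots> = 2 * ennreal ((cmod (f x))\<^sup>2) + 2 * ennreal ((cmod (g x))\<^sup>2)"
      by (simp add: ennreal_mult)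
    finally show "ennreal ((cmod (f x + g x))\<^sup>2) \<le> \<dots>" .
  qed
  also have "\<dots> = 2 * L2_normsq f + 2 * L2_normsq g"
    unfolding L2_normsq_def by (simp add: nn_integral_add nn_integral_cmult)
  finally show ?thesis .
qed

lemma L2_normsq_scale:
  assumes [measurable]: "f \<in> borel_measurable lebesgue"
  shows "L2_normsq (\<lambda>x. c * f x) = ennreal ((cmod c)\<^sup>2) * L2_normsq f"
  unfolding L2_normsq_def
  by (simp add: nn_integral_cmult norm_mult power_mult_distrib ennreal_mult)

lemma L2_normsq_minus_commute: "L2_normsq (\<lambda>x. f x - g x) = L2_normsq (\<lambda>x. g x - f x)"
  by (simp add: L2_normsq_def norm_minus_commute)

lemma L2_normsq_diff_triangle:
  assumes "f \<in> borel_measurable lebesgue" "g \<in> borel_measurable lebesgue" "h \<in> borel_measurable lebesgue"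
  shows "L2_normsq (\<lambda>x. f x - h x) \<le> 2 * L2_normsq (\<lambda>x. f x - g x) + 2 * L2_normsq (\<lambda>x. g x - h x)"
  using L2_normsq_add_le[of "\<lambda>x. f x - g x" "\<lambda>x. g x - h x"] assms by simp

lemma L2_add: "f \<in> L2 \<Longrightarrow> g \<in> L2 \<Longrightarrow> (\<lambda>x. f x + g x) \<in> L2"
  unfolding L2_iff
proof (intro conjI)
  assume "f \<in> borel_measurable lebesgue \<and> L2_normsq f < \<infinity>" "g \<in> borel_measurable lebesgue \<and> L2_normsq g < \<infinity>"
  then show "L2_normsq (\<lambda>x. f x + g x) < \<infinity>"
    by (intro le_less_trans[OF L2_normsq_add_le]) (auto simp: ennreal_mult_less_top ennreal_add_less_top)
qed auto

lemma L2_scale: "f \<in> L2 \<Longrightarrow> (\<lambda>x. c * f x) \<in> L2"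
  by (auto simp: L2_iff L2_normsq_scale ennreal_mult_less_top)

lemma L2_zero: "(\<lambda>x. 0) \<in> L2"
  by (simp add: L2_iff L2_normsq_def)

lemma L2_diff: "f \<in> L2 \<Longrightarrow> g \<in> L2 \<Longrightarrow> (\<lambda>x. f x - g x) \<in> L2"
  using L2_add[of f "\<lambda>x. -1 * g x"] L2_scale[of g "-1"] by simp

lemma L2_sum: "(\<And>i. i \<in> F \<Longrightarrow> f i \<in> L2) \<Longrightarrow> (\<lambda>x. \<Sum>i\<in>F. f i x) \<in> L2"
  by (induction F rule: infinite_finite_induct) (auto simp: L2_zero intro!: L2_add)

lemma L2_cutoff:
  assumes f: "f \<in> L2" and [measurable]: "A \<in> sets lebesgue"
  shows "(\<lambda>x. indicator A x * f x) \<in> L2"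
proof -
  note [measurable] = L2_measurable[OF f]
  have "L2_normsq (\<lambda>x. indicator A x * f x) \<le> L2_normsq f"
    unfolding L2_normsq_def by (intro nn_integral_mono) (auto simp: indicator_def)
  with f show ?thesis by (auto simp: L2_iff)
qed

lemma L2_inner_integrable:
  assumes f: "f \<in> L2" and g: "g \<in> L2"
  shows "integrable lebesgue (\<lambda>x. f x * cnj (g x))"
proof (rule Bochner_Integration.integrable_bound)
  show "integrable lebesgue (\<lambda>x. (cmod (f x))\<^sup>2 + (cmod (g x))\<^sup>2)"
    using f g by (auto simp: L2_def)
  show "(\<lambda>x. f x * cnj (g x)) \<in> borel_measurable lebesgue"
    using f g[THEN L2_measurable] L2_measurable
    by (intro borel_measurable_times borel_measurable_continuous_on[where f=cnj]) (auto intro: continuous_intros)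
  have "cmod u * cmod v \<le> (cmod u)\<^sup>2 + (cmod v)\<^sup>2" for u v
    using sum_squares_bound[of "cmod u" "cmod v"] mult_nonneg_nonneg[OF norm_ge_zero[of u] norm_ge_zero[of v]] by linarith
  then show "AE x in lebesgue. norm (f x * cnj (g x)) \<le> norm ((cmod (f x))\<^sup>2 + (cmod (g x))\<^sup>2)"
    by (simp add: norm_mult)
qed

text \<open>The real-valued counterpart of \<open>L2_normsq\<close>, used where squared norms have to be subtracted. It is
meaningful on \<open>L2\<close> only; elsewhere the integral has the default value 0.\<close>

definition L2_sqnorm :: "(real ^ 'd \<Rightarrow> complex) \<Rightarrow> real" where
  "L2_sqnorm f = (\<integral>x. (cmod (f x))\<^sup>2 \<partial>lebesgue)"

lemma L2_sqnorm_nonneg: "0 \<le> L2_sqnorm f"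
  by (simp add: L2_sqnorm_def)

lemma L2_normsq_eq: "f \<in> L2 \<Longrightarrow> L2_normsq f = ennreal (L2_sqnorm f)"
  unfolding L2_normsq_def L2_sqnorm_def by (rule nn_integral_eq_integral) (auto simp: L2_def)

lemma L2_inner_self: "L2_inner f f = of_real (L2_sqnorm f)"
  unfolding L2_inner_def L2_sqnorm_def complex_norm_square[symmetric] by (rule integral_complex_of_real)

lemma L2_inner_add_left: "f \<in> L2 \<Longrightarrow> g \<in> L2 \<Longrightarrow> h \<in> L2 \<Longrightarrow> L2_inner (\<lambda>x. f x + g x) h = L2_inner f h + L2_inner g h"
  unfolding L2_inner_def distrib_right by (intro Bochner_Integration.integral_add L2_inner_integrable)

lemma L2_inner_diff_left: "f \<in> L2 \<Longrightarrow> g \<in> L2 \<Longrightarrow> h \<in> L2 \<Longrightarrow> L2_inner (\<lambda>x. f x - g x) h = L2_inner f h - L2_inner g h"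
  unfolding L2_inner_def left_diff_distrib by (intro Bochner_Integration.integral_diff L2_inner_integrable)

lemma L2_inner_scale_left: "L2_inner (\<lambda>x. c * f x) h = c * L2_inner f h"
  unfolding L2_inner_def mult.assoc by simp

lemma L2_inner_cnj: "cnj (L2_inner f g) = L2_inner g f"
  unfolding L2_inner_def by (subst Bochner_Integration.integral_cnj[symmetric]) (simp add: mult.commute)

lemma L2_inner_diff_right: "f \<in> L2 \<Longrightarrow> g \<in> L2 \<Longrightarrow> h \<in> L2 \<Longrightarrow> L2_inner h (\<lambda>x. f x - g x) = L2_inner h f - L2_inner h g"
  using arg_cong[OF L2_inner_diff_left[of f g h], of cnj] by (simp add: L2_inner_cnj)

lemma L2_inner_scale_right: "L2_inner h (\<lambda>x. c * f x) = cnj c * L2_inner h f"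
  using arg_cong[OF L2_inner_scale_left[of c f h], of cnj] by (simp add: L2_inner_cnj)

lemma L2_inner_sum_left:
  assumes "\<And>i. i \<in> F \<Longrightarrow> f i \<in> L2" "h \<in> L2"
  shows "L2_inner (\<lambda>x. \<Sum>i\<in>F. f i x) h = (\<Sum>i\<in>F. L2_inner (f i) h)"
  using assms
proof (induction F rule: infinite_finite_induct)
  case (insert i F)
  then show ?case using L2_inner_add_left[of "f i" "\<lambda>x. \<Sum>i\<in>F. f i x" h] by (simp add: L2_sum)
qed (auto simp: L2_inner_def)

section \<open>Orthonormal families and Parseval's identity\<close>

definition orthonormal_L2 :: "'i set \<Rightarrow> ('i \<Rightarrow> real ^ 'd \<Rightarrow> complex) \<Rightarrow> bool" where
  "orthonormal_L2 I e \<longleftrightarrow> (\<forall>i\<in>I. e i \<in> L2) \<and>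
     (\<forall>i\<in>I. \<forall>j\<in>I. L2_inner (e i) (e j) = (if i = j then 1 else 0))"

lemma L2_sqnorm_expand:
  assumes f: "f \<in> L2" and e: "e \<in> L2" and e1: "L2_inner e e = 1"
  shows "L2_sqnorm (\<lambda>x. f x - c * e x) = L2_sqnorm f - (cmod (L2_inner f e))\<^sup>2 + (cmod (c - L2_inner f e))\<^sup>2"
proof -
  let ?g = "\<lambda>x. f x - c * e x"
  have ce: "(\<lambda>x. c * e x) \<in> L2" by (intro L2_scale e)
  have g: "?g \<in> L2" by (intro L2_diff f ce)
  have "complex_of_real (L2_sqnorm ?g) = L2_inner ?g ?g" by (simp add: L2_inner_self)
  also have "\<dots> = L2_inner f f - cnj c * L2_inner f e - (c * cnj (L2_inner f e) - c * cnj c)"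
    by (simp add: L2_inner_diff_left[OF f ce g] L2_inner_diff_right[OF f ce f] L2_inner_diff_right[OF f ce ce]
        L2_inner_scale_left L2_inner_scale_right e1 L2_inner_cnj algebra_simps)
  also have "\<dots> = complex_of_real (L2_sqnorm f) - L2_inner f e * cnj (L2_inner f e)
      + (c - L2_inner f e) * cnj (c - L2_inner f e)"
    by (simp add: L2_inner_self algebra_simps)
  also have "\<dots> = complex_of_real (L2_sqnorm f - (cmod (L2_inner f e))\<^sup>2 + (cmod (c - L2_inner f e))\<^sup>2)"
    by (simp only: complex_norm_square of_real_add of_real_diff)
  finally show ?thesis by (simp only: of_real_eq_iff)
qed

text \<open>Completing the square: one identity that gives Bessel's inequality, the optimality of the Fourier
coefficients and, for \<open>f = 0\<close>, Pythagoras' theorem.\<close>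

lemma L2_sqnorm_diff_sum:
  assumes "orthonormal_L2 F e" "finite F" and f: "f \<in> L2"
  shows "L2_sqnorm (\<lambda>x. f x - (\<Sum>i\<in>F. c i * e i x))
     = L2_sqnorm f - (\<Sum>i\<in>F. (cmod (L2_inner f (e i)))\<^sup>2) + (\<Sum>i\<in>F. (cmod (c i - L2_inner f (e i)))\<^sup>2)"
  using assms(2,1)
proof (induction F)
  case (insert j F)
  have L2: "e i \<in> L2" if "i \<in> insert j F" for i using insert.prems that by (auto simp: orthonormal_L2_def)
  have S: "(\<lambda>x. \<Sum>i\<in>F. c i * e i x) \<in> L2" by (intro L2_sum L2_scale L2) auto
  let ?g = "\<lambda>x. f x - (\<Sum>i\<in>F. c i * e i x)"
  have g: "?g \<in> L2" by (intro L2_diff f S)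
  have "L2_inner (\<lambda>x. \<Sum>i\<in>F. c i * e i x) (e j) = (\<Sum>i\<in>F. c i * L2_inner (e i) (e j))"
    by (subst L2_inner_sum_left) (auto intro!: L2_scale L2 simp: L2_inner_scale_left)
  also have "\<dots> = 0"
    using insert by (intro sum.neutral) (auto simp: orthonormal_L2_def)
  \<comment> \<open>The terms already subtracted are orthogonal to \<open>e j\<close>, so the coefficient is that of \<open>f\<close>.\<close>
  finally have ip: "L2_inner ?g (e j) = L2_inner f (e j)"
    by (subst L2_inner_diff_left) (auto intro!: f S L2)
  have "(\<lambda>x. f x - (\<Sum>i\<in>insert j F. c i * e i x)) = (\<lambda>x. ?g x - c j * e j x)"
    using insert by (auto simp: algebra_simps)
  then have "L2_sqnorm (\<lambda>x. f x - (\<Sum>i\<in>insert j F. c i * e i x))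
     = L2_sqnorm ?g - (cmod (L2_inner f (e j)))\<^sup>2 + (cmod (c j - L2_inner f (e j)))\<^sup>2"
    using L2_sqnorm_expand[OF g L2[of j], of "c j"] insert.prems by (simp add: ip orthonormal_L2_def)
  moreover have "orthonormal_L2 F e" using insert.prems by (auto simp: orthonormal_L2_def)
  ultimately show ?case using insert by simp
qed simp

lemma orthonormal_L2_subset: "orthonormal_L2 I e \<Longrightarrow> F \<subseteq> I \<Longrightarrow> orthonormal_L2 F e"
  unfolding orthonormal_L2_def by blast

lemma orthonormal_basis_L2_inner:
  "orthonormal_basis_L2 I e \<Longrightarrow> i \<in> I \<Longrightarrow> j \<in> I \<Longrightarrow> L2_inner (e i) (e j) = (if i = j then 1 else 0)"
  by (simp add: orthonormal_basis_L2_def)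

lemma orthonormal_basis_L2_in_L2: "orthonormal_basis_L2 I e \<Longrightarrow> i \<in> I \<Longrightarrow> e i \<in> L2"
  by (simp add: orthonormal_basis_L2_def)

lemma bessel_L2:
  assumes "orthonormal_L2 F e" "finite F" "f \<in> L2"
  shows "(\<Sum>i\<in>F. (cmod (L2_inner f (e i)))\<^sup>2) \<le> L2_sqnorm f"
  using L2_sqnorm_diff_sum[OF assms, of "\<lambda>i. L2_inner f (e i)"] L2_sqnorm_nonneg[of "\<lambda>x. f x - (\<Sum>i\<in>F. L2_inner f (e i) * e i x)"]
  by simp

lemma orthonormal_basis_L2_imp: "orthonormal_basis_L2 I e \<Longrightarrow> orthonormal_L2 I e"
  by (simp add: orthonormal_basis_L2_def orthonormal_L2_def)

text \<open>Coefficients of an arbitrary good approximation bound the error of the orthogonal expansion from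
above, and adding further indices only decreases that error.\<close>

lemma parseval_L2:
  assumes B: "orthonormal_basis_L2 I e" and f: "f \<in> L2"
  shows "((\<lambda>i. (cmod (L2_inner f (e i)))\<^sup>2) has_sum L2_sqnorm f) I"
  unfolding has_sum_def tendsto_iff eventually_finite_subsets_at_top
proof (intro allI impI)
  fix \<epsilon> :: real assume \<epsilon>: "\<epsilon> > 0"
  note ON = orthonormal_basis_L2_imp[OF B]
  from B f \<epsilon> obtain F c where F: "finite F" "F \<subseteq> I"
    and lt: "L2_normsq (\<lambda>x. f x - (\<Sum>i\<in>F. c i * e i x)) < ennreal \<epsilon>"
    unfolding orthonormal_basis_L2_def by blast
  have ONF: "orthonormal_L2 F e" using ON F orthonormal_L2_subset by blast
  have S: "(\<lambda>x. \<Sum>i\<in>F. c i * e i x) \<in> L2"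
    using ONF by (intro L2_sum L2_scale) (auto simp: orthonormal_L2_def)
  have "L2_sqnorm (\<lambda>x. f x - (\<Sum>i\<in>F. c i * e i x)) < \<epsilon>"
    using lt L2_diff[OF f S] \<epsilon> by (simp add: L2_normsq_eq ennreal_less_iff L2_sqnorm_nonneg)
  then have "L2_sqnorm f - (\<Sum>i\<in>F. (cmod (L2_inner f (e i)))\<^sup>2) + (\<Sum>i\<in>F. (cmod (c i - L2_inner f (e i)))\<^sup>2) < \<epsilon>"
    using L2_sqnorm_diff_sum[OF ONF F(1) f, of c] by simp
  moreover have "0 \<le> (\<Sum>i\<in>F. (cmod (c i - L2_inner f (e i)))\<^sup>2)" by (intro sum_nonneg) auto
  ultimately have close: "L2_sqnorm f - (\<Sum>i\<in>F. (cmod (L2_inner f (e i)))\<^sup>2) < \<epsilon>" by linarith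
  show "\<exists>X. finite X \<and> X \<subseteq> I \<and> (\<forall>Y. finite Y \<and> X \<subseteq> Y \<and> Y \<subseteq> I \<longrightarrow>
      dist (\<Sum>i\<in>Y. (cmod (L2_inner f (e i)))\<^sup>2) (L2_sqnorm f) < \<epsilon>)"
  proof (intro exI[of _ F] conjI F allI impI)
    fix Y assume Y: "finite Y \<and> F \<subseteq> Y \<and> Y \<subseteq> I"
    then have "(\<Sum>i\<in>F. (cmod (L2_inner f (e i)))\<^sup>2) \<le> (\<Sum>i\<in>Y. (cmod (L2_inner f (e i)))\<^sup>2)"
      by (intro sum_mono2) auto
    moreover have "(\<Sum>i\<in>Y. (cmod (L2_inner f (e i)))\<^sup>2) \<le> L2_sqnorm f"
      using Y ON f by (intro bessel_L2) (auto intro: orthonormal_L2_subset)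
    ultimately show "dist (\<Sum>i\<in>Y. (cmod (L2_inner f (e i)))\<^sup>2) (L2_sqnorm f) < \<epsilon>"
      using close by (simp add: dist_real_def)
  qed
qed

text \<open>Completeness need only be tested on a dense set, and there it amounts to almost equality in
Bessel's inequality.\<close>

lemma orthonormal_basis_L2_dense:
  assumes ON: "orthonormal_L2 I e"
    and dense: "\<And>f \<epsilon>. f \<in> L2 \<Longrightarrow> \<epsilon> > 0 \<Longrightarrow> \<exists>g\<in>L2. L2_sqnorm (\<lambda>x. f x - g x) < \<epsilon> \<and>
       (\<exists>F. finite F \<and> F \<subseteq> I \<and> L2_sqnorm g - (\<Sum>i\<in>F. (cmod (L2_inner g (e i)))\<^sup>2) < \<epsilon>)"
  shows "orthonormal_basis_L2 I e"
  unfolding orthonormal_basis_L2_def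
proof (intro conjI ballI allI impI)
  fix f :: "real ^ 'b \<Rightarrow> complex" and \<epsilon> :: real assume f: "f \<in> L2" and "\<epsilon> > 0"
  then obtain g F where g: "g \<in> L2" and fg: "L2_sqnorm (\<lambda>x. f x - g x) < \<epsilon> / 4"
    and F: "finite F" "F \<subseteq> I" and gF: "L2_sqnorm g - (\<Sum>i\<in>F. (cmod (L2_inner g (e i)))\<^sup>2) < \<epsilon> / 4"
    using dense[OF f, of "\<epsilon> / 4"] by auto
  have ONF: "orthonormal_L2 F e" using ON F orthonormal_L2_subset by blast
  define S where "S = (\<lambda>x. \<Sum>i\<in>F. L2_inner g (e i) * e i x)"
  have S: "S \<in> L2"
    unfolding S_def using ONF by (intro L2_sum L2_scale) (auto simp: orthonormal_L2_def)
  have "L2_sqnorm (\<lambda>x. g x - S x) < \<epsilon> / 4"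
    using gF L2_sqnorm_diff_sum[OF ONF F(1) g, of "\<lambda>i. L2_inner g (e i)"] by (simp add: S_def)
  then have lt: "2 * L2_sqnorm (\<lambda>x. f x - g x) + 2 * L2_sqnorm (\<lambda>x. g x - S x) < \<epsilon>"
    using fg \<open>\<epsilon> > 0\<close> by linarith
  have "L2_normsq (\<lambda>x. f x - S x) \<le> 2 * ennreal (L2_sqnorm (\<lambda>x. f x - g x)) + 2 * ennreal (L2_sqnorm (\<lambda>x. g x - S x))"
    using L2_normsq_diff_triangle[of f g S] f g S by (simp add: L2_measurable L2_diff L2_normsq_eq)
  also have "\<dots> = ennreal (2 * L2_sqnorm (\<lambda>x. f x - g x) + 2 * L2_sqnorm (\<lambda>x. g x - S x))"
    by (simp add: L2_sqnorm_nonneg ennreal_mult)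
  also have "\<dots> < ennreal \<epsilon>"
    by (rule ennreal_lessI[OF \<open>\<epsilon> > 0\<close> lt])
  finally have "L2_normsq (\<lambda>x. f x - S x) < ennreal \<epsilon>" .
  with F show "\<exists>F c. finite F \<and> F \<subseteq> I \<and> L2_normsq (\<lambda>x. f x - (\<Sum>i\<in>F. c i * e i x)) < ennreal \<epsilon>"
    by (intro exI[of _ F] exI[of _ "\<lambda>i. L2_inner g (e i)"]) (simp add: S_def)
qed (use ON in \<open>auto simp: orthonormal_L2_def\<close>)

text \<open>Bessel's inequality for the single normalized function \<open>g\<close>.\<close>

lemma L2_cauchy_schwarz:
  assumes f: "f \<in> L2" and g: "g \<in> L2"
  shows "(cmod (L2_inner f g))\<^sup>2 \<le> L2_sqnorm f * L2_sqnorm g"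
proof (cases "L2_sqnorm g = 0")
  case True
  have ae: "AE x in lebesgue. (cmod (g x))\<^sup>2 = 0"
    using True g unfolding L2_sqnorm_def L2_def by (subst (asm) integral_nonneg_eq_0_iff_AE) auto
  have "L2_inner f g = (\<integral>x. 0 \<partial>(lebesgue :: (real ^ 'a) measure))"
    unfolding L2_inner_def
    by (rule Bochner_Integration.integral_cong_AE[OF borel_measurable_integrable[OF L2_inner_integrable[OF f g]]])
      (use ae in \<open>auto elim: eventually_mono\<close>)
  then show ?thesis by (simp add: True)
next
  case False
  then have pos: "L2_sqnorm g > 0" using L2_sqnorm_nonneg[of g] by linarith
  \<comment> \<open>The factor that normalizes \<open>g\<close>.\<close>
  define c where "c = complex_of_real (1 / sqrt (L2_sqnorm g))"
  define e where "e = (\<lambda>x. c * g x)"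
  have e: "e \<in> L2" unfolding e_def by (intro L2_scale g)
  have "L2_inner e e = complex_of_real (1 / sqrt (L2_sqnorm g) * (1 / sqrt (L2_sqnorm g) * L2_sqnorm g))"
    unfolding e_def L2_inner_scale_left L2_inner_scale_right L2_inner_self c_def
    by (simp only: of_real_mult complex_cnj_complex_of_real)
  also have "1 / sqrt (L2_sqnorm g) * (1 / sqrt (L2_sqnorm g) * L2_sqnorm g) = (1::real)"
    using pos by (simp add: field_simps)
  finally have "L2_inner e e = 1" by simp
  then have "0 \<le> L2_sqnorm f - (cmod (L2_inner f e))\<^sup>2"
    using L2_sqnorm_expand[OF f e, of "L2_inner f e"] L2_sqnorm_nonneg[of "\<lambda>x. f x - L2_inner f e * e x"] by simp
  also have "cmod (L2_inner f e) ^ 2 = (cmod (L2_inner f g))\<^sup>2 / L2_sqnorm g"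
    unfolding e_def L2_inner_scale_right c_def using pos
    by (simp add: norm_mult power_mult_distrib power_divide norm_divide)
  finally show ?thesis using pos by (simp add: field_simps)
qed

section \<open>Dilations and translations as unitary operators\<close>

lemma
  fixes U :: "'a::field ^ 'n ^ 'n"
  assumes "invertible U"
  shows matrix_inv_right: "U ** matrix_inv U = mat 1"
    and matrix_inv_left: "matrix_inv U ** U = mat 1"
    and invertible_matrix_inv: "invertible (matrix_inv U)"
proof -
  have "\<exists>V. U ** V = mat 1 \<and> V ** U = mat 1" using assms by (simp add: invertible_def)
  then have "U ** matrix_inv U = mat 1 \<and> matrix_inv U ** U = mat 1"
    unfolding matrix_inv_def by (rule someI_ex)
  then show "U ** matrix_inv U = mat 1" "matrix_inv U ** U = mat 1" "invertible (matrix_inv U)"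
    unfolding invertible_def by blast+
qed

lemma dilate_shift_measurable:
  assumes "invertible U" "f \<in> borel_measurable lebesgue"
  shows "dilate_shift U k f \<in> borel_measurable lebesgue"
  unfolding dilate_shift_def
  by (intro borel_measurable_times borel_measurable_const measurable_compose[OF measurable_matrix_affine[OF assms(1)] assms(2)])

text \<open>The factor \<open>sqrt \<bar>det U\<bar>\<close> in \<open>dilate_shift\<close> is the one that compensates the Jacobian.\<close>

lemma L2_normsq_dilate_shift:
  assumes "invertible U" "f \<in> borel_measurable lebesgue"
  shows "L2_normsq (dilate_shift U k f) = L2_normsq f"
proof -
  have [measurable]: "(\<lambda>x. f (U *v x - k)) \<in> borel_measurable lebesgue"
    by (rule measurable_compose[OF measurable_matrix_affine[OF assms(1)] assms(2)])
  note [measurable] = assms(2)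
  have "L2_normsq f = ennreal \<bar>det U\<bar> * (\<integral>\<^sup>+x. ennreal ((cmod (f (U *v x - k)))\<^sup>2) \<partial>lebesgue)"
    unfolding L2_normsq_def by (rule nn_integral_matrix_affine[OF assms(1)]) measurable
  also have "\<dots> = L2_normsq (dilate_shift U k f)"
    unfolding L2_normsq_def dilate_shift_def
    by (simp add: norm_mult power_mult_distrib ennreal_mult nn_integral_cmult)
  finally show ?thesis ..
qed

lemma L2_dilate_shift: "invertible U \<Longrightarrow> f \<in> L2 \<Longrightarrow> dilate_shift U k f \<in> L2"
  by (simp add: L2_iff dilate_shift_measurable L2_normsq_dilate_shift)

lemma L2_inner_dilate_shift:
  assumes U: "invertible U" and [measurable]: "f \<in> borel_measurable lebesgue" "g \<in> borel_measurable lebesgue"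
  shows "L2_inner (dilate_shift U k f) (dilate_shift U k g) = L2_inner f g"
proof -
  have [measurable]: "cnj \<in> borel_measurable borel"
    by (intro borel_measurable_continuous_onI continuous_intros)
  have "L2_inner f g = \<bar>det U\<bar> *\<^sub>R (\<integral>x. f (U *v x - k) * cnj (g (U *v x - k)) \<partial>lebesgue)"
    unfolding L2_inner_def by (rule integral_matrix_affine[OF U]) measurable
  also have "\<dots> = (\<integral>x. complex_of_real \<bar>det U\<bar> * (f (U *v x - k) * cnj (g (U *v x - k))) \<partial>lebesgue)"
    by (simp add: scaleR_conv_of_real)
  also have "\<dots> = L2_inner (dilate_shift U k f) (dilate_shift U k g)"
    unfolding L2_inner_def dilate_shift_def
  proof (intro Bochner_Integration.integral_cong refl)
    fix x
    have "complex_of_real \<bar>det U\<bar> = complex_of_real (sqrt \<bar>det U\<bar>) * complex_of_real (sqrt \<bar>det U\<bar>)"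
      by (metis abs_ge_zero of_real_mult real_sqrt_mult_self abs_abs)
    then show "complex_of_real \<bar>det U\<bar> * (f (U *v x - k) * cnj (g (U *v x - k))) =
      complex_of_real (sqrt \<bar>det U\<bar>) * f (U *v x - k) * cnj (complex_of_real (sqrt \<bar>det U\<bar>) * g (U *v x - k))"
      by simp
  qed
  finally show ?thesis ..
qed

lemma dilate_shift_dilate_shift:
  "dilate_shift A 0 (dilate_shift B k f) = dilate_shift (B ** A) k f"
  by (rule ext) (simp add: dilate_shift_def det_mul abs_mult real_sqrt_mult matrix_vector_mul_assoc mult_ac)

text \<open>Translating by \<open>n\<close> after dilating by \<open>B\<close> moves the shift by \<open>B *v n\<close>. This is how integer
translations act on the functions of level one.\<close>

lemma dilate_shift_translate:
  "dilate_shift (mat 1) n (dilate_shift B k f) = dilate_shift B (k + B *v n) f"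
  by (rule ext) (simp add: dilate_shift_def matrix_vector_mult_diff_distrib algebra_simps)

lemma dilate_shift_id: "dilate_shift (mat 1) 0 f = f"
  by (rule ext) (simp add: dilate_shift_def)

lemma dilate_shift_sum: "dilate_shift U k (\<lambda>x. f x - (\<Sum>i\<in>F. c i * e i x)) = (\<lambda>x. dilate_shift U k f x - (\<Sum>i\<in>F. c i * dilate_shift U k (e i) x))"
  by (rule ext) (simp add: dilate_shift_def algebra_simps sum_distrib_left)

lemma orthonormal_basis_L2_dilate:
  assumes B: "orthonormal_basis_L2 I e" and U: "invertible U"
  shows "orthonormal_basis_L2 I (\<lambda>i. dilate_shift U 0 (e i))"
  unfolding orthonormal_basis_L2_def
proof (intro conjI ballI allI impI)
  from B have e: "e i \<in> L2" if "i \<in> I" for i using that by (simp add: orthonormal_basis_L2_def)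
  then show "dilate_shift U 0 (e i) \<in> L2" if "i \<in> I" for i using that U by (simp add: L2_dilate_shift)
  show "L2_inner (dilate_shift U 0 (e i)) (dilate_shift U 0 (e j)) = (if i = j then 1 else 0)"
    if "i \<in> I" "j \<in> I" for i j
    using B that U by (simp add: L2_inner_dilate_shift L2_measurable e orthonormal_basis_L2_def)
  fix f :: "real ^ 'b \<Rightarrow> complex" and \<epsilon> :: real assume f: "f \<in> L2" and "\<epsilon> > 0"
  define g where "g = dilate_shift (matrix_inv U) 0 f"
  have g: "g \<in> L2" unfolding g_def using U f by (simp add: L2_dilate_shift invertible_matrix_inv)
  have f_eq: "f = dilate_shift U 0 g"
    unfolding g_def dilate_shift_dilate_shift using U by (simp add: matrix_inv_left dilate_shift_id)
  from B g \<open>\<epsilon> > 0\<close> obtain F c where F: "finite F" "F \<subseteq> I"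
    and lt: "L2_normsq (\<lambda>x. g x - (\<Sum>i\<in>F. c i * e i x)) < ennreal \<epsilon>"
    unfolding orthonormal_basis_L2_def by blast
  have "(\<lambda>x. g x - (\<Sum>i\<in>F. c i * e i x)) \<in> L2"
    using F by (intro L2_diff g L2_sum L2_scale e) auto
  then have "L2_normsq (\<lambda>x. f x - (\<Sum>i\<in>F. c i * dilate_shift U 0 (e i) x)) < ennreal \<epsilon>"
    using lt L2_normsq_dilate_shift[OF U, of "\<lambda>x. g x - (\<Sum>i\<in>F. c i * e i x)" 0]
    by (simp add: L2_measurable dilate_shift_sum f_eq)
  with F show "\<exists>F c. finite F \<and> F \<subseteq> I \<and> L2_normsq (\<lambda>x. f x - (\<Sum>i\<in>F. c i * dilate_shift U 0 (e i) x)) < ennreal \<epsilon>"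
    by (intro exI[of _ F] exI[of _ c]) simp
qed

lemma orthonormal_basis_L2_reindex:
  assumes B: "orthonormal_basis_L2 I e" and h: "bij_betw h I' I"
  shows "orthonormal_basis_L2 I' (\<lambda>i. e (h i))"
  unfolding orthonormal_basis_L2_def
proof (intro conjI ballI allI impI)
  have I: "h i \<in> I" if "i \<in> I'" for i using h that by (auto simp: bij_betw_def)
  show "e (h i) \<in> L2" if "i \<in> I'" for i using B I[OF that] by (simp add: orthonormal_basis_L2_def)
  show "L2_inner (e (h i)) (e (h j)) = (if i = j then 1 else 0)" if "i \<in> I'" "j \<in> I'" for i j
    using B I that h unfolding orthonormal_basis_L2_def bij_betw_def inj_on_def by auto
  fix f :: "real ^ 'b \<Rightarrow> complex" and \<epsilon> :: real assume "f \<in> L2" and "\<epsilon> > 0"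
  with B obtain F c where F: "finite F" "F \<subseteq> I"
    and lt: "L2_normsq (\<lambda>x. f x - (\<Sum>i\<in>F. c i * e i x)) < ennreal \<epsilon>"
    unfolding orthonormal_basis_L2_def by blast
  define F' where "F' = {i \<in> I'. h i \<in> F}"
  have bij: "bij_betw h F' F"
    using h F unfolding F'_def bij_betw_def inj_on_def by blast
  have "finite F'" using bij F bij_betw_finite by blast
  moreover have "(\<Sum>i\<in>F. c i * e i x) = (\<Sum>i\<in>F'. c (h i) * e (h i) x)" for x
    by (rule sum.reindex_bij_betw[OF bij, symmetric])
  ultimately show "\<exists>F c. finite F \<and> F \<subseteq> I' \<and> L2_normsq (\<lambda>x. f x - (\<Sum>i\<in>F. c i * e (h i) x)) < ennreal \<epsilon>"
    using lt by (intro exI[of _ F'] exI[of _ "c \<circ> h"]) (auto simp: F'_def)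
qed

section \<open>A Plancherel inequality\<close>

abbreviation phase :: "real \<Rightarrow> complex" where
  "phase t \<equiv> exp (- \<i> * complex_of_real t)"

lemma
  fixes f :: "'a::euclidean_space \<Rightarrow> real \<Rightarrow> complex"
  assumes f: "\<And>b. b \<in> Basis \<Longrightarrow> integrable lborel (f b)"
  shows integrable_lborel_prod: "integrable lborel (\<lambda>x::'a. \<Prod>b\<in>Basis. f b (x \<bullet> b))"
    and integral_lborel_prod: "(\<integral>x. (\<Prod>b\<in>Basis. f b ((x::'a) \<bullet> b)) \<partial>lborel) = (\<Prod>b\<in>Basis. (\<integral>t. f b t \<partial>lborel))"
proof -
  interpret product_sigma_finite "\<lambda>_::'a. lborel :: real measure" ..
  let ?T = "\<lambda>g::'a \<Rightarrow> real. \<Sum>b\<in>Basis. g b *\<^sub>R b"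
  have m: "f b \<in> borel_measurable borel" if "b \<in> Basis" for b
    using borel_measurable_integrable[OF f[OF that]] by simp
  have T: "?T \<in> measurable (\<Pi>\<^sub>M b\<in>Basis. lborel) borel"
    by measurable
  have F: "(\<lambda>x::'a. \<Prod>b\<in>Basis. f b (x \<bullet> b)) \<in> borel_measurable borel"
    by (intro borel_measurable_prod measurable_compose[OF _ m]) measurable
  have eq: "(\<Prod>b\<in>Basis. f b (?T g \<bullet> b)) = (\<Prod>b\<in>Basis. f b (g b))" for g
    by (intro prod.cong) auto
  show "integrable lborel (\<lambda>x::'a. \<Prod>b\<in>Basis. f b (x \<bullet> b))"
    by (subst lborel_eq, subst integrable_distr_eq[OF T F]) (simp add: eq product_integrable_prod f)
  show "(\<integral>x. (\<Prod>b\<in>Basis. f b ((x::'a) \<bullet> b)) \<partial>lborel) = (\<Prod>b\<in>Basis. (\<integral>t. f b t \<partial>lborel))"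
    by (subst lborel_eq, subst integral_distr[OF T F]) (simp add: eq product_integral_prod f)
qed

text \<open>The characteristic function of the standard normal distribution, rescaled by \<open>sqrt \<epsilon>\<close>.\<close>

lemma
  assumes e: "\<epsilon> > 0"
  shows integrable_gaussian_phase: "integrable lborel (\<lambda>t::real. complex_of_real (exp (- \<epsilon> * t\<^sup>2 / 2)) * phase (x * t))"
    and integral_gaussian_phase: "(\<integral>t. complex_of_real (exp (- \<epsilon> * t\<^sup>2 / 2)) * phase (x * t) \<partial>lborel)
      = complex_of_real (2 * pi * normal_density 0 (sqrt \<epsilon>) x)"
proof -
  let ?g = "\<lambda>t::real. complex_of_real (exp (- \<epsilon> * t\<^sup>2 / 2)) * phase (x * t)"
  let ?s = "sqrt \<epsilon>" and ?u = "- x / sqrt \<epsilon>"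
  have s: "?s > 0" using e by simp
  have "integrable std_normal_distribution (\<lambda>t. iexp (?u * t))"
    by (intro prob_space.integrable_iexp prob_space_normal_density) auto
  then have I: "integrable lborel (\<lambda>t. std_normal_density t *\<^sub>R iexp (?u * t))"
    by (subst (asm) integrable_density) auto
  have "char std_normal_distribution ?u = (\<integral>t. std_normal_density t *\<^sub>R iexp (?u * t) \<partial>lborel)"
    unfolding char_def by (subst integral_density) auto
  then have V: "(\<integral>t. std_normal_density t *\<^sub>R iexp (?u * t) \<partial>lborel) = complex_of_real (exp (- (x\<^sup>2 / \<epsilon>) / 2))"
    using e by (simp add: char_std_normal_distribution power_divide)
  have eq: "std_normal_density (0 + ?s * t) *\<^sub>R iexp (?u * (0 + ?s * t)) = (1 / sqrt (2 * pi)) *\<^sub>R ?g t" for t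
    using e s by (simp add: std_normal_density_def power_mult_distrib scaleR_conv_of_real field_simps)
  have "integrable lborel (\<lambda>t. std_normal_density (0 + ?s * t) *\<^sub>R iexp (?u * (0 + ?s * t)))"
    using I s by (intro lborel_integrable_real_affine) auto
  from integrable_scaleR_right[OF this[unfolded eq], of "sqrt (2 * pi)"] show "integrable lborel ?g"
    by simp
  have "complex_of_real (exp (- (x\<^sup>2 / \<epsilon>) / 2)) = \<bar>?s\<bar> *\<^sub>R (\<integral>t. std_normal_density (0 + ?s * t) *\<^sub>R iexp (?u * (0 + ?s * t)) \<partial>lborel)"
    unfolding V[symmetric] using s by (intro lborel_integral_real_affine) simp
  also have "\<dots> = complex_of_real (?s / sqrt (2 * pi)) * (\<integral>t. ?g t \<partial>lborel)"
    unfolding eq using s by (simp add: scaleR_conv_of_real)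
  finally have "(\<integral>t. ?g t \<partial>lborel) = complex_of_real (exp (- (x\<^sup>2 / \<epsilon>) / 2)) / complex_of_real (?s / sqrt (2 * pi))"
    using s by (simp add: field_simps)
  also have "\<dots> = complex_of_real (exp (- (x\<^sup>2 / \<epsilon>) / 2) / (?s / sqrt (2 * pi)))"
    by (rule of_real_divide[symmetric])
  also have "exp (- (x\<^sup>2 / \<epsilon>) / 2) / (?s / sqrt (2 * pi)) = 2 * pi * normal_density 0 ?s x"
  proof -
    have "2 * pi / sqrt (2 * pi) = sqrt (2 * pi)" by (rule real_div_sqrt) simp
    then show ?thesis
      using e unfolding normal_density_def by (simp add: real_sqrt_mult divide_divide_eq_left) (simp add: field_simps)
  qed
  finally show "(\<integral>t. ?g t \<partial>lborel) = complex_of_real (2 * pi * normal_density 0 ?s x)" .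
qed

definition gauss :: "real \<Rightarrow> 'a::euclidean_space \<Rightarrow> real" where
  "gauss \<epsilon> \<xi> = exp (- \<epsilon> * (norm \<xi>)\<^sup>2 / 2)"

text \<open>The Fourier transform of \<open>gauss \<epsilon>\<close>. Being a product of normal densities up to the factor
\<open>2 * pi\<close> in each coordinate, it is nonnegative and its integral does not depend on \<open>\<epsilon>\<close>.\<close>

definition gauss_kernel :: "real \<Rightarrow> 'a::euclidean_space \<Rightarrow> real" where
  "gauss_kernel \<epsilon> x = (\<Prod>b\<in>Basis. 2 * pi * normal_density 0 (sqrt \<epsilon>) (x \<bullet> b))"

lemma gauss_measurable[measurable]: "gauss \<epsilon> \<in> borel_measurable borel"
  unfolding gauss_def by measurable

lemma gauss_kernel_measurable[measurable]: "gauss_kernel \<epsilon> \<in> borel_measurable borel"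
  unfolding gauss_kernel_def by measurable

lemma gauss_phase_prod:
  "complex_of_real (gauss \<epsilon> \<xi>) * phase (x \<bullet> \<xi>)
    = (\<Prod>b\<in>Basis. complex_of_real (exp (- \<epsilon> * (\<xi> \<bullet> b)\<^sup>2 / 2)) * phase ((x \<bullet> b) * (\<xi> \<bullet> b)))"
  unfolding prod.distrib gauss_def
  by (simp add: exp_sum[symmetric] sum_distrib_left sum_negf euclidean_inner[of x \<xi>]
      flip: of_real_prod sum_divide_distrib)
    (simp add: sum_distrib_left[symmetric] euclidean_inner[of \<xi> \<xi>, symmetric] dot_square_norm power2_eq_square)

lemma
  assumes e: "\<epsilon> > 0"
  shows integrable_gauss: "integrable lborel (\<lambda>\<xi>. complex_of_real (gauss \<epsilon> \<xi>) * phase (x \<bullet> \<xi>))"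
    and integral_gauss: "(\<integral>\<xi>. complex_of_real (gauss \<epsilon> \<xi>) * phase (x \<bullet> \<xi>) \<partial>lborel) = complex_of_real (gauss_kernel \<epsilon> x)"
  unfolding gauss_phase_prod gauss_kernel_def of_real_prod
  by (rule integrable_lborel_prod, rule integrable_gaussian_phase[OF e])
    (simp only: integral_gaussian_phase[OF e, symmetric]
      integral_lborel_prod[where f="\<lambda>b t. complex_of_real (exp (- \<epsilon> * t\<^sup>2 / 2)) * phase ((x \<bullet> b) * t)", OF integrable_gaussian_phase[OF e]])

lemma gauss_kernel_nonneg: "gauss_kernel \<epsilon> x \<ge> 0"
  unfolding gauss_kernel_def by (intro prod_nonneg) simp

lemma gauss_kernel_minus: "gauss_kernel \<epsilon> (x - y) = gauss_kernel \<epsilon> (y - x)"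
proof -
  have "((x - y) \<bullet> b)\<^sup>2 = ((y - x) \<bullet> b)\<^sup>2" for b by (simp add: inner_diff_left power2_commute)
  then show ?thesis unfolding gauss_kernel_def normal_density_def by simp
qed

lemma nn_integral_gauss_kernel:
  assumes e: "\<epsilon> > 0"
  shows "(\<integral>\<^sup>+x. ennreal (gauss_kernel \<epsilon> (x :: 'a::euclidean_space)) \<partial>lborel) = ennreal ((2 * pi) ^ DIM('a))"
proof -
  have "(\<integral>\<^sup>+x. ennreal (gauss_kernel \<epsilon> (x :: 'a)) \<partial>lborel)
     = (\<integral>\<^sup>+x. (\<Prod>b\<in>Basis. ennreal (2 * pi * normal_density 0 (sqrt \<epsilon>) ((x::'a) \<bullet> b))) \<partial>lborel)"
    unfolding gauss_kernel_def by (simp add: prod_ennreal)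
  also have "\<dots> = (\<Prod>b\<in>(Basis::'a set). (\<integral>\<^sup>+t. ennreal (2 * pi * normal_density 0 (sqrt \<epsilon>) t) \<partial>lborel))"
    by (rule nn_integral_lborel_prod) auto
  also have "(\<integral>\<^sup>+t. ennreal (2 * pi * normal_density 0 (sqrt \<epsilon>) t) \<partial>lborel) = ennreal (2 * pi)"
  proof -
    have "(\<integral>\<^sup>+t. ennreal (normal_density 0 (sqrt \<epsilon>) t) \<partial>lborel) = 1"
      using integral_normal_density[of "sqrt \<epsilon>" 0] integrable_normal_density[of "sqrt \<epsilon>" 0] e
      by (subst nn_integral_eq_integral) auto
    then show ?thesis by (simp add: ennreal_mult' nn_integral_cmult)
  qed
  finally show ?thesis by (simp add: ennreal_power)
qed

lemma norm_phase: "cmod (phase t) = 1"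
  using norm_exp_i_times[of "- t"] by simp

lemma integrable_pair_phase:
  fixes f g :: "'a::euclidean_space \<Rightarrow> complex"
  assumes f: "integrable lborel f" and g: "integrable lborel g"
    and [measurable]: "case_prod p \<in> borel_measurable (borel \<Otimes>\<^sub>M borel)" and p: "\<And>x y. cmod (p x y) \<le> 1"
  shows "integrable (lborel \<Otimes>\<^sub>M lborel) (\<lambda>(x, y). f x * g y * p x y)"
proof -
  have [measurable]: "f \<in> borel_measurable borel" "g \<in> borel_measurable borel"
    using f g by (auto dest: borel_measurable_integrable)
  show ?thesis
    unfolding integrable_iff_bounded
  proof
    have "(\<integral>\<^sup>+z. ennreal (norm (case z of (x, y) \<Rightarrow> f x * g y * p x y)) \<partial>(lborel \<Otimes>\<^sub>M lborel))
       = (\<integral>\<^sup>+x. \<integral>\<^sup>+y. ennreal (norm (f x * g y * p x y)) \<partial>lborel \<partial>lborel)"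
      by (subst lborel.nn_integral_fst[symmetric]) auto
    also have "\<dots> \<le> (\<integral>\<^sup>+x. \<integral>\<^sup>+y. ennreal (norm (f x)) * ennreal (norm (g y)) \<partial>lborel \<partial>lborel)"
      by (intro nn_integral_mono) (auto simp: norm_mult p mult_left_le simp flip: ennreal_mult')
    also have "\<dots> = (\<integral>\<^sup>+x. ennreal (norm (f x)) \<partial>lborel) * (\<integral>\<^sup>+y. ennreal (norm (g y)) \<partial>lborel)"
      by (simp add: nn_integral_cmult nn_integral_multc)
    also have "\<dots> < \<infinity>"
      using f g by (auto simp: integrable_iff_bounded ennreal_mult_less_top)
    finally show "(\<integral>\<^sup>+z. ennreal (norm (case z of (x, y) \<Rightarrow> f x * g y * p x y)) \<partial>(lborel \<Otimes>\<^sub>M lborel)) < \<infinity>" .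
  qed measurable
qed

lemma norm_integral_le_nn_integral:
  fixes f :: "'a \<Rightarrow> complex"
  shows "ennreal (norm (integral\<^sup>L M f)) \<le> (\<integral>\<^sup>+x. ennreal (norm (f x)) \<partial>M)"
  by (cases "integrable M f") (auto simp: integral_norm_bound_ennreal not_integrable_integral_eq)

text \<open>By Fubini's theorem the weighted integral of \<open>\<bar>F\<bar>\<^sup>2\<close> equals the double integral of
\<open>f x * cnj (f y) * gauss_kernel \<epsilon> (x - y)\<close>. With \<open>\<bar>f x\<bar> * \<bar>f y\<bar> \<le> \<bar>f x\<bar>\<^sup>2 + \<bar>f y\<bar>\<^sup>2\<close>
each of the two resulting terms is the squared norm of \<open>f\<close> times the integral of the kernel, so the
bound is uniform in \<open>\<epsilon>\<close>.\<close>

lemma gauss_weighted_fourier_bound: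
  fixes f :: "'a::euclidean_space \<Rightarrow> complex"
  assumes f: "integrable lborel f" and e: "\<epsilon> > 0"
  defines "F \<equiv> (\<lambda>\<xi>. \<integral>x. f x * phase (x \<bullet> \<xi>) \<partial>lborel)"
  shows "(\<integral>\<^sup>+\<xi>. ennreal ((cmod (F \<xi>))\<^sup>2 * gauss \<epsilon> \<xi>) \<partial>lborel)
     \<le> ennreal (2 * (2 * pi) ^ DIM('a)) * (\<integral>\<^sup>+x. ennreal ((cmod (f x))\<^sup>2) \<partial>lborel)"
proof -
  let ?g = "\<lambda>\<xi>. complex_of_real (gauss \<epsilon> \<xi>)" and ?K = "\<lambda>x. complex_of_real (gauss_kernel \<epsilon> x)"
  have [measurable]: "f \<in> borel_measurable borel" using f by (auto dest: borel_measurable_integrable)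
  have [measurable]: "cnj \<in> borel_measurable borel"
    by (intro borel_measurable_continuous_onI continuous_intros)
  have [measurable]: "F \<in> borel_measurable borel"
    unfolding F_def by measurable
  define L where "L = (\<integral>x. cmod (f x) \<partial>lborel)"
  have FL: "cmod (F \<xi>) \<le> L" for \<xi>
  proof -
    have "cmod (F \<xi>) \<le> (\<integral>x. cmod (f x * phase (x \<bullet> \<xi>)) \<partial>lborel)"
      unfolding F_def by (rule integral_norm_bound)
    then show ?thesis by (simp add: norm_mult norm_phase L_def)
  qed
  have L0: "L \<ge> 0" using FL[of 0] norm_ge_zero[of "F 0"] by linarith
  have G: "integrable lborel (\<lambda>\<xi>::'a. ?g \<xi>)"
    using integrable_gauss[OF e, of 0] by simp
  have FG: "integrable lborel (\<lambda>\<xi>. F \<xi> * ?g \<xi>)"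
  proof (rule Bochner_Integration.integrable_bound)
    show "integrable lborel (\<lambda>\<xi>::'a. complex_of_real L * ?g \<xi>)" using G by simp
    show "AE \<xi> in lborel. norm (F \<xi> * ?g \<xi>) \<le> norm (complex_of_real L * ?g \<xi>)"
      using FL L0 by (auto simp: norm_mult gauss_def intro!: mult_right_mono)
  qed measurable
  have cf: "integrable lborel (\<lambda>x. cnj (f x))" using f by simp
  \<comment> \<open>The inverse transform of the weighted \<open>F\<close> is the convolution of \<open>f\<close> with the kernel.\<close>
  have inner: "(\<integral>\<xi>. F \<xi> * ?g \<xi> * exp (\<i> * complex_of_real (y \<bullet> \<xi>)) \<partial>lborel)
     = (\<integral>x. f x * ?K (x - y) \<partial>lborel)" for y
  proof -
    have mp: "case_prod (\<lambda>x \<xi>::'a. phase ((x - y) \<bullet> \<xi>)) \<in> borel_measurable (borel \<Otimes>\<^sub>M borel)"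
      by measurable
    have np: "cmod (phase ((x - y) \<bullet> \<xi>)) \<le> 1" for x \<xi>
      by (simp only: norm_phase order_refl)
    have "(\<integral>\<xi>. F \<xi> * ?g \<xi> * exp (\<i> * complex_of_real (y \<bullet> \<xi>)) \<partial>lborel)
       = (\<integral>\<xi>. \<integral>x. f x * ?g \<xi> * phase ((x - y) \<bullet> \<xi>) \<partial>lborel \<partial>lborel)"
    proof (rule Bochner_Integration.integral_cong[OF refl])
      fix \<xi> :: 'a
      let ?c = "?g \<xi> * exp (\<i> * complex_of_real (y \<bullet> \<xi>))"
      have "f x * ?g \<xi> * phase ((x - y) \<bullet> \<xi>)
        = f x * phase (x \<bullet> \<xi>) * ?c" for x
        by (simp add: inner_diff_left algebra_simps exp_diff exp_minus field_simps)
      then have "(\<integral>x. f x * ?g \<xi> * phase ((x - y) \<bullet> \<xi>) \<partial>lborel)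
         = F \<xi> * ?c"
        unfolding F_def by (simp only: integral_mult_left_zero)
      then show "F \<xi> * ?g \<xi> * exp (\<i> * complex_of_real (y \<bullet> \<xi>)) =
        (\<integral>x. f x * ?g \<xi> * phase ((x - y) \<bullet> \<xi>) \<partial>lborel)"
        by (simp add: mult.assoc)
    qed
    also have "\<dots> = (\<integral>x. \<integral>\<xi>. f x * ?g \<xi> * phase ((x - y) \<bullet> \<xi>) \<partial>lborel \<partial>lborel)"
      by (rule lborel_pair.Fubini_integral[where f="\<lambda>x \<xi>. f x * ?g \<xi> * phase ((x - y) \<bullet> \<xi>)"])
        (rule integrable_pair_phase[OF f G mp np])
    also have "\<dots> = (\<integral>x. f x * ?K (x - y) \<partial>lborel)"
      by (simp only: mult.assoc integral_mult_right_zero integral_gauss[OF e])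
    finally show ?thesis .
  qed
  have main: "(\<integral>\<xi>. F \<xi> * ?g \<xi> * cnj (F \<xi>) \<partial>lborel)
     = (\<integral>y. cnj (f y) * (\<integral>x. f x * ?K (x - y) \<partial>lborel) \<partial>lborel)"
  proof -
    have mp: "case_prod (\<lambda>y \<xi>::'a. exp (\<i> * complex_of_real (y \<bullet> \<xi>))) \<in> borel_measurable (borel \<Otimes>\<^sub>M borel)"
      by measurable
    have np: "cmod (exp (\<i> * complex_of_real (y \<bullet> \<xi>))) \<le> 1" for y \<xi> :: 'a
      by simp
    have "(\<integral>\<xi>. F \<xi> * ?g \<xi> * cnj (F \<xi>) \<partial>lborel)
       = (\<integral>\<xi>. \<integral>y. cnj (f y) * (F \<xi> * ?g \<xi>) * exp (\<i> * complex_of_real (y \<bullet> \<xi>)) \<partial>lborel \<partial>lborel)"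
    proof (rule Bochner_Integration.integral_cong[OF refl])
      fix \<xi> :: 'a
      let ?c = "F \<xi> * ?g \<xi>"
      have "cnj (F \<xi>) = (\<integral>y. cnj (f y) * exp (\<i> * complex_of_real (y \<bullet> \<xi>)) \<partial>lborel)"
        unfolding F_def by (subst Bochner_Integration.integral_cnj[symmetric]) (simp add: exp_cnj)
      then have "?c * cnj (F \<xi>) = (\<integral>y. ?c * (cnj (f y) * exp (\<i> * complex_of_real (y \<bullet> \<xi>))) \<partial>lborel)"
        by (simp only: integral_mult_right_zero)
      also have "\<dots> = (\<integral>y. cnj (f y) * ?c * exp (\<i> * complex_of_real (y \<bullet> \<xi>)) \<partial>lborel)"
        by (simp only: mult_ac)
      finally show "?c * cnj (F \<xi>) = \<dots>" .
    qed
    also have "\<dots> = (\<integral>y. \<integral>\<xi>. cnj (f y) * (F \<xi> * ?g \<xi>) * exp (\<i> * complex_of_real (y \<bullet> \<xi>)) \<partial>lborel \<partial>lborel)"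
      by (rule lborel_pair.Fubini_integral[where f="\<lambda>y \<xi>. cnj (f y) * (F \<xi> * ?g \<xi>) * exp (\<i> * complex_of_real (y \<bullet> \<xi>))"])
        (rule integrable_pair_phase[OF cf FG mp np])
    also have "\<dots> = (\<integral>y. cnj (f y) * (\<integral>x. f x * ?K (x - y) \<partial>lborel) \<partial>lborel)"
      by (simp only: mult.assoc integral_mult_right_zero inner[unfolded mult.assoc])
    finally show ?thesis .
  qed
  have bd: "cmod u * (cmod v * k) \<le> ((cmod v)\<^sup>2 + (cmod u)\<^sup>2) * k" if "k \<ge> 0" for u v k
  proof -
    have "cmod u * cmod v \<le> (cmod v)\<^sup>2 + (cmod u)\<^sup>2"
      using sum_squares_bound[of "cmod u" "cmod v"] mult_nonneg_nonneg[OF norm_ge_zero[of u] norm_ge_zero[of v]] by linarith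
    from mult_right_mono[OF this that] show ?thesis by (simp add: mult_ac)
  qed
  let ?A = "\<integral>\<^sup>+x. ennreal ((cmod (f x))\<^sup>2) \<partial>lborel" and ?k = "\<lambda>x. ennreal (gauss_kernel \<epsilon> x)"
  have k1: "(\<integral>\<^sup>+x. ?k (x - y) \<partial>lborel) = ennreal ((2 * pi) ^ DIM('a))" for y :: 'a
    using nn_integral_lborel_shift[of ?k "-y"] by (simp add: nn_integral_gauss_kernel[OF e])
  have k2: "(\<integral>\<^sup>+y. ?k (x - y) \<partial>lborel) = ennreal ((2 * pi) ^ DIM('a))" for x :: 'a
    using k1[of x] by (simp add: gauss_kernel_minus)
  have FF: "F \<xi> * ?g \<xi> * cnj (F \<xi>) = complex_of_real ((cmod (F \<xi>))\<^sup>2 * gauss \<epsilon> \<xi>)" for \<xi>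
    unfolding of_real_mult complex_norm_square by (simp add: mult_ac)
  have intF: "integrable lborel (\<lambda>\<xi>. (cmod (F \<xi>))\<^sup>2 * gauss \<epsilon> \<xi>)"
  proof (rule Bochner_Integration.integrable_bound)
    show "integrable lborel (\<lambda>\<xi>::'a. complex_of_real (L\<^sup>2) * ?g \<xi>)" using G by simp
    show "AE \<xi> in lborel. norm ((cmod (F \<xi>))\<^sup>2 * gauss \<epsilon> \<xi>) \<le> norm (complex_of_real (L\<^sup>2) * ?g \<xi>)"
      using FL L0 by (auto simp: norm_mult norm_power gauss_def abs_mult intro!: mult_right_mono power_mono)
  qed measurable
  have "(\<integral>\<^sup>+\<xi>. ennreal ((cmod (F \<xi>))\<^sup>2 * gauss \<epsilon> \<xi>) \<partial>lborel) = ennreal (\<integral>\<xi>. (cmod (F \<xi>))\<^sup>2 * gauss \<epsilon> \<xi> \<partial>lborel)"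
    by (rule nn_integral_eq_integral[OF intF]) (simp add: gauss_def)
  also have "\<dots> = ennreal (cmod (\<integral>\<xi>. F \<xi> * ?g \<xi> * cnj (F \<xi>) \<partial>lborel))"
    unfolding FF integral_complex_of_real norm_of_real
    by (subst abs_of_nonneg) (auto simp: gauss_def)
  also have "\<dots> \<le> (\<integral>\<^sup>+y. ennreal (cmod (cnj (f y) * (\<integral>x. f x * ?K (x - y) \<partial>lborel))) \<partial>lborel)"
    unfolding main by (rule norm_integral_le_nn_integral)
  also have "\<dots> \<le> (\<integral>\<^sup>+y. (\<integral>\<^sup>+x. ennreal ((cmod (f x))\<^sup>2) * ?k (x - y) + ennreal ((cmod (f y))\<^sup>2) * ?k (x - y) \<partial>lborel) \<partial>lborel)"
  proof (rule nn_integral_mono)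
    fix y
    have "ennreal (cmod (cnj (f y) * (\<integral>x. f x * ?K (x - y) \<partial>lborel)))
       = ennreal (cmod (f y)) * ennreal (cmod (\<integral>x. f x * ?K (x - y) \<partial>lborel))"
      by (simp add: norm_mult ennreal_mult)
    also have "\<dots> \<le> ennreal (cmod (f y)) * (\<integral>\<^sup>+x. ennreal (cmod (f x * ?K (x - y))) \<partial>lborel)"
      by (intro mult_left_mono norm_integral_le_nn_integral) simp
    also have "\<dots> = (\<integral>\<^sup>+x. ennreal (cmod (f y)) * ennreal (cmod (f x * ?K (x - y))) \<partial>lborel)"
      by (rule nn_integral_cmult[symmetric]) measurable
    also have "\<dots> \<le> (\<integral>\<^sup>+x. ennreal ((cmod (f x))\<^sup>2) * ?k (x - y) + ennreal ((cmod (f y))\<^sup>2) * ?k (x - y) \<partial>lborel)"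
    proof (rule nn_integral_mono)
      fix x
      have "ennreal (cmod (f y)) * ennreal (cmod (f x * ?K (x - y)))
        = ennreal (cmod (f y) * (cmod (f x) * gauss_kernel \<epsilon> (x - y)))"
        by (simp add: norm_mult gauss_kernel_nonneg ennreal_mult)
      also have "\<dots> \<le> ennreal (((cmod (f x))\<^sup>2 + (cmod (f y))\<^sup>2) * gauss_kernel \<epsilon> (x - y))"
        by (intro ennreal_leI bd gauss_kernel_nonneg)
      also have "\<dots> = ennreal ((cmod (f x))\<^sup>2) * ?k (x - y) + ennreal ((cmod (f y))\<^sup>2) * ?k (x - y)"
        by (simp add: distrib_right ennreal_plus ennreal_mult gauss_kernel_nonneg)
      finally show "ennreal (cmod (f y)) * ennreal (cmod (f x * ?K (x - y))) \<le> \<dots>" .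
    qed
    finally show "ennreal (cmod (cnj (f y) * (\<integral>x. f x * ?K (x - y) \<partial>lborel))) \<le> \<dots>" .
  qed
  also have "\<dots> = (\<integral>\<^sup>+y. (\<integral>\<^sup>+x. ennreal ((cmod (f x))\<^sup>2) * ?k (x - y) \<partial>lborel) + (\<integral>\<^sup>+x. ennreal ((cmod (f y))\<^sup>2) * ?k (x - y) \<partial>lborel) \<partial>lborel)"
    by (intro nn_integral_cong nn_integral_add) measurable
  also have "\<dots> = (\<integral>\<^sup>+y. (\<integral>\<^sup>+x. ennreal ((cmod (f x))\<^sup>2) * ?k (x - y) \<partial>lborel) \<partial>lborel) + (\<integral>\<^sup>+y. (\<integral>\<^sup>+x. ennreal ((cmod (f y))\<^sup>2) * ?k (x - y) \<partial>lborel) \<partial>lborel)"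
    by (intro nn_integral_add) measurable
  also have "(\<integral>\<^sup>+y. (\<integral>\<^sup>+x. ennreal ((cmod (f x))\<^sup>2) * ?k (x - y) \<partial>lborel) \<partial>lborel) = (\<integral>\<^sup>+x. (\<integral>\<^sup>+y. ennreal ((cmod (f x))\<^sup>2) * ?k (x - y) \<partial>lborel) \<partial>lborel)"
    by (intro lborel_pair.Fubini') measurable
  also have "\<dots> = ennreal ((2 * pi) ^ DIM('a)) * ?A"
    by (simp add: nn_integral_cmult nn_integral_multc k2 mult.commute)
  also have "(\<integral>\<^sup>+y. (\<integral>\<^sup>+x. ennreal ((cmod (f y))\<^sup>2) * ?k (x - y) \<partial>lborel) \<partial>lborel) = ennreal ((2 * pi) ^ DIM('a)) * ?A"
    by (simp add: nn_integral_cmult nn_integral_multc k1 mult.commute)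
  also have "ennreal ((2 * pi) ^ DIM('a)) * ?A + ennreal ((2 * pi) ^ DIM('a)) * ?A = ennreal (2 * (2 * pi) ^ DIM('a)) * ?A"
    by (simp add: ennreal_mult mult.assoc flip: mult_2)
  finally show ?thesis .
qed

text \<open>As \<open>\<epsilon>\<close> tends to 0 the Gaussian weight tends to 1, and Fatou's lemma removes it.\<close>

lemma fourier_bound_lborel:
  fixes f :: "'a::euclidean_space \<Rightarrow> complex"
  assumes f: "integrable lborel f"
  defines "F \<equiv> (\<lambda>\<xi>. \<integral>x. f x * phase (x \<bullet> \<xi>) \<partial>lborel)"
  shows "F \<in> borel_measurable borel"
    and "(\<integral>\<^sup>+\<xi>. ennreal ((cmod (F \<xi>))\<^sup>2) \<partial>lborel)
     \<le> ennreal (2 * (2 * pi) ^ DIM('a)) * (\<integral>\<^sup>+x. ennreal ((cmod (f x))\<^sup>2) \<partial>lborel)"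
proof -
  have [measurable]: "f \<in> borel_measurable borel" using f by (auto dest: borel_measurable_integrable)
  show F[measurable]: "F \<in> borel_measurable borel"
    unfolding F_def by measurable
  let ?e = "\<lambda>n. 1 / real (Suc n)"
  have lim: "(\<lambda>n. ennreal ((cmod (F \<xi>))\<^sup>2 * gauss (?e n) \<xi>)) \<longlonglongrightarrow> ennreal ((cmod (F \<xi>))\<^sup>2)" for \<xi>
  proof -
    have "(\<lambda>n. (cmod (F \<xi>))\<^sup>2 * gauss (?e n) \<xi>) \<longlonglongrightarrow> (cmod (F \<xi>))\<^sup>2 * exp (- 0 * (norm \<xi>)\<^sup>2 / 2)"
      unfolding gauss_def by (intro tendsto_intros LIMSEQ_Suc[OF lim_1_over_n]) auto
    then show ?thesis by (intro tendsto_ennrealI) simp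
  qed
  have "(\<integral>\<^sup>+\<xi>. ennreal ((cmod (F \<xi>))\<^sup>2) \<partial>lborel) = (\<integral>\<^sup>+\<xi>. liminf (\<lambda>n. ennreal ((cmod (F \<xi>))\<^sup>2 * gauss (?e n) \<xi>)) \<partial>lborel)"
    using lim_imp_Liminf[OF sequentially_bot lim] by simp
  also have "\<dots> \<le> liminf (\<lambda>n. \<integral>\<^sup>+\<xi>. ennreal ((cmod (F \<xi>))\<^sup>2 * gauss (?e n) \<xi>) \<partial>lborel)"
    by (rule nn_integral_liminf) measurable
  also have "\<dots> \<le> liminf (\<lambda>n::nat. ennreal (2 * (2 * pi) ^ DIM('a)) * (\<integral>\<^sup>+x. ennreal ((cmod (f x))\<^sup>2) \<partial>lborel))"
    unfolding F_def by (intro Liminf_mono always_eventually allI gauss_weighted_fourier_bound f) simp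
  also have "\<dots> = ennreal (2 * (2 * pi) ^ DIM('a)) * (\<integral>\<^sup>+x. ennreal ((cmod (f x))\<^sup>2) \<partial>lborel)"
    by (rule Liminf_const) simp
  finally show "(\<integral>\<^sup>+\<xi>. ennreal ((cmod (F \<xi>))\<^sup>2) \<partial>lborel) \<le> \<dots>" .
qed

lemma lebesgue_ex_borel_complex:
  fixes f :: "'a::euclidean_space \<Rightarrow> complex"
  assumes [measurable]: "f \<in> borel_measurable lebesgue"
  obtains g where "g \<in> borel_measurable borel" "AE x in lebesgue. f x = g x"
proof -
  have "(\<lambda>x. Re (f x)) \<in> borel_measurable lebesgue" "(\<lambda>x. Im (f x)) \<in> borel_measurable lebesgue"
    by measurable
  then obtain u v where [measurable]: "u \<in> borel_measurable lborel" "v \<in> borel_measurable lborel"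
    and ae: "AE x in lborel. Re (f x) = u x" "AE x in lborel. Im (f x) = v x"
    using completion_ex_borel_measurable_real by metis
  have "(\<lambda>x. Complex (u x) (v x)) = (\<lambda>x. complex_of_real (u x) + \<i> * complex_of_real (v x))"
    by (simp add: Complex_eq)
  then have "(\<lambda>x. Complex (u x) (v x)) \<in> borel_measurable borel" by simp
  moreover have "AE x in lebesgue. f x = Complex (u x) (v x)"
    using AE_completion[OF ae(1)] AE_completion[OF ae(2)] by eventually_elim (simp add: complex_eq_iff)
  ultimately show ?thesis by (rule that)
qed

text \<open>Changing \<open>f\<close> on a null set makes it Borel measurable and alters neither its transform nor its
norm, which reduces the claim to \<open>fourier_bound_lborel\<close>.\<close>

lemma fourier_L1_bound:
  fixes f :: "real ^ 'd \<Rightarrow> complex"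
  assumes "f \<in> L1"
  shows fourier_L1_measurable: "fourier_L1 f \<in> borel_measurable lebesgue"
    and L2_normsq_fourier_L1_le: "L2_normsq (fourier_L1 f) \<le> ennreal (2 * (2 * pi) ^ CARD('d)) * L2_normsq f"
proof -
  have f: "integrable lebesgue f" using assms by (simp add: L1_def)
  then have fm: "f \<in> borel_measurable lebesgue" by auto
  obtain g where g[measurable]: "g \<in> borel_measurable borel" and ae: "AE x in lebesgue. f x = g x"
    using lebesgue_ex_borel_complex[OF fm] by auto
  have gm: "g \<in> borel_measurable lebesgue" using measurable_completion[of g lborel borel] by simp
  have "integrable lebesgue g"
    using f ae by (subst integrable_cong_AE[OF gm fm]) (auto elim: eventually_mono)
  then have ig: "integrable lborel g" by (simp add: integrable_completion)
  have phase_measurable[measurable]: "(\<lambda>x. phase (x \<bullet> \<xi>)) \<in> borel_measurable borel" for \<xi> :: "real^'d"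
    by measurable
  have mphase: "(\<lambda>x. phase (x \<bullet> \<xi>)) \<in> borel_measurable lebesgue" for \<xi> :: "real^'d"
    using phase_measurable by (intro measurable_completion) simp
  have F: "fourier_L1 f = (\<lambda>\<xi>. \<integral>x. g x * phase (x \<bullet> \<xi>) \<partial>lborel)"
  proof
    fix \<xi> :: "real^'d"
    have "fourier_L1 f \<xi> = (\<integral>x. g x * phase (x \<bullet> \<xi>) \<partial>lebesgue)"
      unfolding fourier_L1_def
      by (intro Bochner_Integration.integral_cong_AE borel_measurable_times mphase fm gm)
        (use ae in \<open>auto elim: eventually_mono\<close>)
    also have "\<dots> = (\<integral>x. g x * phase (x \<bullet> \<xi>) \<partial>lborel)"
      by (rule integral_completion) measurable
    finally show "fourier_L1 f \<xi> = \<dots>" .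
  qed
  show "fourier_L1 f \<in> borel_measurable lebesgue"
    unfolding F using fourier_bound_lborel(1)[OF ig] by (intro measurable_completion) simp
  have dim: "DIM(real ^ 'd) = CARD('d)" by simp
  have "L2_normsq (fourier_L1 f) \<le> ennreal (2 * (2 * pi) ^ CARD('d)) * (\<integral>\<^sup>+x. ennreal ((cmod (g x))\<^sup>2) \<partial>lborel)"
    unfolding F L2_normsq_def nn_integral_completion
    by (rule fourier_bound_lborel(2)[OF ig, unfolded dim])
  also have "(\<integral>\<^sup>+x. ennreal ((cmod (g x))\<^sup>2) \<partial>lborel) = L2_normsq f"
    unfolding L2_normsq_def
    by (subst nn_integral_completion[symmetric], intro nn_integral_cong_AE) (use ae in \<open>auto elim: eventually_mono\<close>)
  finally show "L2_normsq (fourier_L1 f) \<le> ennreal (2 * (2 * pi) ^ CARD('d)) * L2_normsq f" .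
qed

section \<open>Convergence in mean square and almost everywhere\<close>

text \<open>Fatou's lemma.\<close>

lemma L2_normsq_lim_le:
  assumes [measurable]: "\<And>m. F m \<in> borel_measurable lebesgue" "h \<in> borel_measurable lebesgue"
    and lim: "AE x in lebesgue. (\<lambda>m. F m x) \<longlonglongrightarrow> g x"
    and bd: "\<And>m. m \<ge> n \<Longrightarrow> L2_normsq (\<lambda>x. h x - F m x) \<le> B"
  shows "L2_normsq (\<lambda>x. h x - g x) \<le> B"
proof -
  have "L2_normsq (\<lambda>x. h x - g x) = (\<integral>\<^sup>+x. liminf (\<lambda>m. ennreal ((cmod (h x - F m x))\<^sup>2)) \<partial>lebesgue)"
    unfolding L2_normsq_def
  proof (rule nn_integral_cong_AE, use lim in eventually_elim)
    fix x assume "(\<lambda>m. F m x) \<longlonglongrightarrow> g x"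
    then have "(\<lambda>m. ennreal ((cmod (h x - F m x))\<^sup>2)) \<longlonglongrightarrow> ennreal ((cmod (h x - g x))\<^sup>2)"
      by (intro tendsto_intros tendsto_ennrealI)
    from lim_imp_Liminf[OF sequentially_bot this]
    show "ennreal ((cmod (h x - g x))\<^sup>2) = liminf (\<lambda>m. ennreal ((cmod (h x - F m x))\<^sup>2))" ..
  qed
  also have "\<dots> \<le> liminf (\<lambda>m. L2_normsq (\<lambda>x. h x - F m x))"
    unfolding L2_normsq_def by (rule nn_integral_liminf) measurable
  also have "\<dots> \<le> liminf (\<lambda>m::nat. B)"
    by (intro Liminf_mono) (auto simp: eventually_sequentially intro!: exI[of _ n] bd)
  finally show ?thesis by (simp add: Liminf_const)
qed

lemma telescoping_convergent:
  fixes u :: "nat \<Rightarrow> complex"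
  assumes "\<And>n. 2 ^ n * (cmod (u (Suc n) - u n))\<^sup>2 \<le> B"
  shows "convergent u"
proof -
  have "cmod (u (Suc n) - u n) \<le> sqrt B * (1 / sqrt 2) ^ n" for n
  proof -
    have "(cmod (u (Suc n) - u n))\<^sup>2 \<le> B / 2 ^ n"
      using assms[of n] by (simp add: field_simps)
    then have "cmod (u (Suc n) - u n) \<le> sqrt (B / 2 ^ n)" by (rule real_le_rsqrt)
    then show ?thesis by (simp add: divide_inverse real_sqrt_mult real_sqrt_inverse real_sqrt_power power_inverse)
  qed
  moreover have "summable (\<lambda>n. sqrt B * (1 / sqrt 2) ^ n)"
    by (intro summable_mult summable_geometric) simp
  ultimately have "summable (\<lambda>n. u (Suc n) - u n)"
    using summable_comparison_test'[where N=0 and f="\<lambda>n. u (Suc n) - u n"] by blast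
  then have "convergent (\<lambda>n. u n - u 0)"
    unfolding summable_iff_convergent sum_lessThan_telescope .
  then show ?thesis by (simp add: convergent_diff_const_right_iff)
qed

lemma two_ennreal_add: "0 \<le> a \<Longrightarrow> 0 \<le> b \<Longrightarrow> 2 * ennreal a + 2 * ennreal b = ennreal (2 * a + 2 * b)"
  by (simp add: ennreal_mult)

lemma pow8_tendsto: "(\<lambda>n. ennreal (c * (1/8) ^ n)) \<longlonglongrightarrow> 0"
proof -
  have "(\<lambda>n. ennreal (c * (1/8) ^ n)) \<longlonglongrightarrow> ennreal (c * 0)"
    by (intro tendsto_ennrealI tendsto_mult_left LIMSEQ_power_zero) simp
  then show ?thesis by simp
qed

lemma L2_tendsto_bound:
  assumes "\<And>n. L2_normsq (\<lambda>x. F n x - f x) \<le> a n" "a \<longlonglongrightarrow> 0"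
  shows "L2_tendsto F f"
  unfolding L2_tendsto_def
  by (rule tendsto_sandwich[OF always_eventually always_eventually tendsto_const assms(2)]) (simp_all add: assms(1))

text \<open>The function \<open>\<Sum>n. 2 ^ n * \<bar>H n x\<bar>\<^sup>2\<close> has a finite integral, because \<open>2 ^ n * (1/8) ^ n = (1/4) ^ n\<close>
is summable. Hence it is finite almost everywhere and bounds each of its terms. The rate
\<open>1/8\<close> leaves room both for this weight and for the summability of \<open>\<bar>H n x\<bar>\<close>.\<close>

lemma L2_fast_decay_AE:
  fixes H :: "nat \<Rightarrow> real ^ 'd \<Rightarrow> complex"
  assumes [measurable]: "\<And>n. H n \<in> borel_measurable lebesgue"
    and c: "c \<ge> 0" and fast: "\<And>n. L2_normsq (H n) \<le> ennreal (c * (1/8) ^ n)"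
  shows "AE x in lebesgue. \<exists>B. \<forall>n. 2 ^ n * (cmod (H n x))\<^sup>2 \<le> B"
proof -
  have "(\<integral>\<^sup>+x. (\<Sum>n. 2 ^ n * ennreal ((cmod (H n x))\<^sup>2)) \<partial>lebesgue)
     = (\<Sum>n. 2 ^ n * L2_normsq (H n))"
    unfolding L2_normsq_def by (subst nn_integral_suminf) (auto simp: nn_integral_cmult)
  also have "\<dots> \<le> (\<Sum>n. ennreal (c * (1/4) ^ n))"
  proof (intro suminf_le summableI)
    fix n
    have "2 ^ n * L2_normsq (H n) \<le> ennreal (2 ^ n) * ennreal (c * (1/8) ^ n)"
      using mult_left_mono[OF fast[of n], of "2 ^ n"] by (simp flip: ennreal_power)
    also have "\<dots> = ennreal (2 ^ n * (c * (1/8) ^ n))"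
      by (rule ennreal_mult[symmetric]) (use c in auto)
    also have "2 ^ n * (c * (1/8) ^ n) = c * (1/4) ^ n"
    proof -
      have "(2::real) ^ n * (1/8) ^ n = (1/4) ^ n" by (simp flip: power_mult_distrib)
      then show ?thesis by (metis mult.left_commute)
    qed
    finally show "2 ^ n * L2_normsq (H n) \<le> ennreal (c * (1/4) ^ n)" .
  qed
  also have "\<dots> = ennreal (\<Sum>n. c * (1/4) ^ n)"
    using c by (intro suminf_ennreal2) (auto intro!: summable_mult summable_geometric)
  also have "\<dots> < \<infinity>" by simp
  finally have "AE x in lebesgue. (\<Sum>n. 2 ^ n * ennreal ((cmod (H n x))\<^sup>2)) \<noteq> \<infinity>"
    by (intro nn_integral_PInf_AE) auto
  then show ?thesis
  proof eventually_elim
    fix x assume fin: "(\<Sum>n. 2 ^ n * ennreal ((cmod (H n x))\<^sup>2)) \<noteq> \<infinity>"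
    define B where "B = enn2real (\<Sum>n. 2 ^ n * ennreal ((cmod (H n x))\<^sup>2))"
    have B: "(\<Sum>n. 2 ^ n * ennreal ((cmod (H n x))\<^sup>2)) = ennreal B" "B \<ge> 0"
      using fin unfolding B_def by (auto simp: top.not_eq_extremum)
    have "2 ^ n * (cmod (H n x))\<^sup>2 \<le> B" for n
    proof -
      have "ennreal (2 ^ n * (cmod (H n x))\<^sup>2) = (\<Sum>k\<in>{n}. 2 ^ k * ennreal ((cmod (H k x))\<^sup>2))"
        by (simp add: ennreal_mult flip: ennreal_power)
      also have "\<dots> \<le> (\<Sum>k. 2 ^ k * ennreal ((cmod (H k x))\<^sup>2))"
        by (rule sum_le_suminf) auto
      finally show ?thesis using B by simp
    qed
    then show "\<exists>B. \<forall>n. 2 ^ n * (cmod (H n x))\<^sup>2 \<le> B" by blast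
  qed
qed

text \<open>Riesz and Fischer's theorem for sequences that are already fast, so that no subsequence is needed.
The limit is the pointwise \<open>lim\<close> at every point, including those where the sequence diverges;
it therefore inherits every pointwise symmetry of the sequence exactly, which later makes the
masks periodic at all points and not just almost everywhere.\<close>

lemma L2_fast_cauchy:
  fixes F :: "nat \<Rightarrow> real ^ 'd \<Rightarrow> complex"
  assumes F[measurable]: "\<And>n. F n \<in> borel_measurable lebesgue"
    and c: "c \<ge> 0" and fast: "\<And>n. L2_normsq (\<lambda>x. F (Suc n) x - F n x) \<le> ennreal (c * (1/8) ^ n)"
  defines "g \<equiv> (\<lambda>x. lim (\<lambda>n. F n x))"
  shows L2_fast_cauchy_AE: "AE x in lebesgue. (\<lambda>n. F n x) \<longlonglongrightarrow> g x"
    and L2_fast_cauchy_measurable: "g \<in> borel_measurable lebesgue"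
    and L2_fast_cauchy_tendsto: "L2_tendsto F g"
proof -
  have "AE x in lebesgue. \<exists>B. \<forall>n. 2 ^ n * (cmod (F (Suc n) x - F n x))\<^sup>2 \<le> B"
    by (rule L2_fast_decay_AE[OF _ c fast]) measurable
  then show AE: "AE x in lebesgue. (\<lambda>n. F n x) \<longlonglongrightarrow> g x"
  proof eventually_elim
    fix x assume "\<exists>B. \<forall>n. 2 ^ n * (cmod (F (Suc n) x - F n x))\<^sup>2 \<le> B"
    then have "convergent (\<lambda>n. F n x)" using telescoping_convergent[of "\<lambda>n. F n x"] by blast
    then show "(\<lambda>n. F n x) \<longlonglongrightarrow> g x" unfolding g_def by (simp add: convergent_LIMSEQ_iff)
  qed
  show g[measurable]: "g \<in> borel_measurable lebesgue" unfolding g_def by measurable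
  \<comment> \<open>The constant 4 reproduces itself: \<open>2 + 2 * 4 / 8 = 3 \<le> 4\<close>.\<close>
  have D: "L2_normsq (\<lambda>x. F n x - F (n + k) x) \<le> ennreal (4 * (c * (1/8) ^ n))" for n k
  proof (induction k arbitrary: n)
    case 0
    then show ?case by (simp add: L2_normsq_def)
  next
    case (Suc k)
    have "L2_normsq (\<lambda>x. F n x - F (n + Suc k) x) \<le> 2 * L2_normsq (\<lambda>x. F n x - F (Suc n) x) + 2 * L2_normsq (\<lambda>x. F (Suc n) x - F (Suc n + k) x)"
      using L2_normsq_diff_triangle[of "F n" "F (Suc n)" "F (Suc n + k)"] by simp
    also have "\<dots> \<le> 2 * ennreal (c * (1/8) ^ n) + 2 * ennreal (4 * (c * (1/8) ^ Suc n))"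
      using fast[of n] Suc[of "Suc n"] by (intro add_mono mult_left_mono) (auto simp: L2_normsq_minus_commute[of "F n"])
    also have "\<dots> = ennreal (2 * (c * (1/8) ^ n) + 2 * (4 * (c * (1/8) ^ Suc n)))"
      using c by (intro two_ennreal_add) auto
    also have "\<dots> \<le> ennreal (4 * (c * (1/8) ^ n))"
      using c by (intro ennreal_leI) simp
    finally show ?case .
  qed
  have "L2_normsq (\<lambda>x. F n x - g x) \<le> ennreal (4 * (c * (1/8) ^ n))" for n
  proof (rule L2_normsq_lim_le[OF F F AE, where n=n])
    fix m assume "n \<le> m"
    then show "L2_normsq (\<lambda>x. F n x - F m x) \<le> ennreal (4 * (c * (1/8) ^ n))"
      using D[of n "m - n"] by simp
  qed
  then have b: "L2_normsq (\<lambda>x. F n x - g x) \<le> ennreal (4 * c * (1/8) ^ n)" for n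
    by (simp only: mult.assoc)
  show "L2_tendsto F g"
    by (rule L2_tendsto_bound[OF b pow8_tendsto])
qed

lemma L2_fast_tendsto_AE:
  fixes F :: "nat \<Rightarrow> real ^ 'd \<Rightarrow> complex"
  assumes [measurable]: "\<And>n. F n \<in> borel_measurable lebesgue" "f \<in> borel_measurable lebesgue"
    and c: "c \<ge> 0" and fast: "\<And>n. L2_normsq (\<lambda>x. f x - F n x) \<le> ennreal (c * (1/8) ^ n)"
  shows "AE x in lebesgue. (\<lambda>n. F n x) \<longlonglongrightarrow> f x"
proof -
  have "AE x in lebesgue. \<exists>B. \<forall>n. 2 ^ n * (cmod (f x - F n x))\<^sup>2 \<le> B"
    by (rule L2_fast_decay_AE[OF _ c fast]) measurable
  then show ?thesis
  proof eventually_elim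
    fix x assume "\<exists>B. \<forall>n. 2 ^ n * (cmod (f x - F n x))\<^sup>2 \<le> B"
    then obtain B where B: "2 ^ n * (cmod (f x - F n x))\<^sup>2 \<le> B" for n by blast
    have "(\<lambda>n. (cmod (f x - F n x))\<^sup>2) \<longlonglongrightarrow> 0"
    proof (rule tendsto_sandwich[OF _ _ tendsto_const])
      show "(\<lambda>n. B * (1/2) ^ n) \<longlonglongrightarrow> 0"
        using tendsto_mult_left[OF LIMSEQ_power_zero[of "1/2::real"], of B] by simp
      show "\<forall>\<^sub>F n in sequentially. (cmod (f x - F n x))\<^sup>2 \<le> B * (1/2) ^ n"
        using B by (intro always_eventually allI) (simp add: field_simps power_one_over)
    qed simp
    then have "(\<lambda>n. sqrt ((cmod (f x - F n x))\<^sup>2)) \<longlonglongrightarrow> sqrt 0"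
      by (rule tendsto_real_sqrt)
    then have "(\<lambda>n. f x - F n x) \<longlonglongrightarrow> 0"
      by (simp add: tendsto_norm_zero_iff)
    from tendsto_diff[OF tendsto_const[of "f x"] this] show "(\<lambda>n. F n x) \<longlonglongrightarrow> f x" by simp
  qed
qed

lemma L2_tendsto_in_L2:
  assumes F: "\<And>n. F n \<in> L2" and g: "g \<in> borel_measurable lebesgue" and lim: "L2_tendsto F g"
  shows "g \<in> L2"
proof -
  have "eventually (\<lambda>n. L2_normsq (\<lambda>x. F n x - g x) < 1) sequentially"
    using lim unfolding L2_tendsto_def by (rule order_tendstoD) simp
  then obtain n where n: "L2_normsq (\<lambda>x. F n x - g x) < 1"
    by (auto simp: eventually_sequentially)
  then have "(\<lambda>x. F n x - g x) \<in> L2"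
    using F g by (auto simp: L2_iff intro: less_trans borel_measurable_diff)
  from L2_diff[OF F[of n] this] show ?thesis by simp
qed

lemma L2_cutoff_tendsto:
  assumes f: "f \<in> L2"
  shows "L2_tendsto (\<lambda>n x. indicator (ball 0 (real n)) x * f x) f"
proof -
  note [measurable] = L2_measurable[OF f]
  have [measurable]: "ball 0 r \<in> sets (lebesgue :: (real ^ 'a) measure)" for r by simp
  have "(\<lambda>n. L2_normsq (\<lambda>x. indicator (ball 0 (real n)) x * f x - f x)) \<longlonglongrightarrow> (\<integral>\<^sup>+x. 0 \<partial>(lebesgue :: (real^'a) measure))"
    unfolding L2_normsq_def
  proof (rule nn_integral_dominated_convergence[where w="\<lambda>x. ennreal ((cmod (f x))\<^sup>2)"])
    show "(\<integral>\<^sup>+x. ennreal ((cmod (f x))\<^sup>2) \<partial>lebesgue) < \<infinity>"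
      using f by (simp add: L2_iff L2_normsq_def)
    show "AE x in lebesgue. (\<lambda>n. ennreal ((cmod (indicator (ball 0 (real n)) x * f x - f x))\<^sup>2)) \<longlonglongrightarrow> 0"
    proof (rule AE_I2)
      fix x :: "real ^ 'a"
      obtain N where N: "norm x < real N" using reals_Archimedean2 by blast
      have "eventually (\<lambda>n. ennreal ((cmod (indicator (ball 0 (real n)) x * f x - f x))\<^sup>2) = 0) sequentially"
        unfolding eventually_sequentially using N by (intro exI[of _ N]) auto
      then show "(\<lambda>n. ennreal ((cmod (indicator (ball 0 (real n)) x * f x - f x))\<^sup>2)) \<longlonglongrightarrow> 0"
        by (simp add: tendsto_eventually)
    qed
    show "AE x in lebesgue. ennreal ((cmod (indicator (ball 0 (real n)) x * f x - f x))\<^sup>2) \<le> ennreal ((cmod (f x))\<^sup>2)" for n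
      by (rule AE_I2) (auto simp: indicator_def)
  qed measurable
  then show ?thesis by (simp add: L2_tendsto_def)
qed

lemma L2_cutoff_L1:
  assumes f: "f \<in> L2"
  shows "(\<lambda>x. indicator (ball 0 r) x * f x) \<in> L1"
proof -
  note [measurable] = L2_measurable[OF f]
  have [measurable]: "ball 0 r \<in> sets (lebesgue :: (real ^ 'a) measure)" for r by simp
  have "integrable lebesgue (\<lambda>x. indicator (ball 0 r) x * f x)"
  proof (rule Bochner_Integration.integrable_bound)
    show "integrable lebesgue (\<lambda>x. indicator (ball 0 r) x + (cmod (f x))\<^sup>2)"
      using f lmeasurable_ball[of 0 r]
      by (intro Bochner_Integration.integrable_add integrable_real_indicator) (auto simp: L2_def fmeasurable_def)
    have "t \<le> 1 + t\<^sup>2" for t :: real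
      using zero_le_power2[of "t - 1/2"] by (simp add: power2_eq_square algebra_simps)
    then show "AE x in lebesgue. norm (indicator (ball 0 r) x * f x) \<le> norm (indicator (ball 0 r) x + (cmod (f x))\<^sup>2)"
      by (auto simp: indicator_def)
  qed measurable
  then show ?thesis by (simp add: L1_def)
qed

lemma L2_approx_L1:
  assumes f: "f \<in> L2"
  obtains F where "\<And>n. F n \<in> L1 \<inter> L2" "\<And>n. L2_normsq (\<lambda>x. F n x - f x) \<le> ennreal ((1/8) ^ n)"
proof -
  define G where "G = (\<lambda>(n::nat) x. indicator (ball 0 (real n)) x * f x)"
  have "\<exists>m. L2_normsq (\<lambda>x. G m x - f x) \<le> ennreal ((1/8) ^ n)" for n
  proof -
    have "eventually (\<lambda>m. L2_normsq (\<lambda>x. G m x - f x) < ennreal ((1/8) ^ n)) sequentially"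
      using L2_cutoff_tendsto[OF f] unfolding L2_tendsto_def G_def by (rule order_tendstoD) simp
    then show ?thesis by (auto simp: eventually_sequentially intro: less_imp_le)
  qed
  then obtain m where "\<And>n. L2_normsq (\<lambda>x. G (m n) x - f x) \<le> ennreal ((1/8) ^ n)" by metis
  moreover have "G k \<in> L1 \<inter> L2" for k
    unfolding G_def using f by (auto intro!: L2_cutoff_L1 L2_cutoff)
  ultimately show ?thesis by (intro that[of "\<lambda>n. G (m n)"])
qed

section \<open>The Fourier transform of square-integrable functions\<close>

lemma fourier_L1_diff:
  assumes "f \<in> L1" "g \<in> L1"
  shows "fourier_L1 (\<lambda>x. f x - g x) = (\<lambda>\<xi>. fourier_L1 f \<xi> - fourier_L1 g \<xi>)"
proof
  fix \<xi> :: "real ^ 'a"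
  have "integrable lebesgue (\<lambda>x. h x * phase (x \<bullet> \<xi>))" if "h \<in> L1" for h :: "real ^ 'a \<Rightarrow> complex"
  proof (rule Bochner_Integration.integrable_bound)
    show "integrable lebesgue h" using that by (simp add: L1_def)
    then have h: "h \<in> borel_measurable lebesgue" by auto
    have "(\<lambda>x. phase (x \<bullet> \<xi>)) \<in> borel_measurable borel" by measurable
    then have "(\<lambda>x. phase (x \<bullet> \<xi>)) \<in> borel_measurable lebesgue"
      by (intro measurable_completion) simp
    with h show "(\<lambda>x. h x * phase (x \<bullet> \<xi>)) \<in> borel_measurable lebesgue"
      by (rule borel_measurable_times)
    show "AE x in lebesgue. norm (h x * phase (x \<bullet> \<xi>)) \<le> norm (h x)"
      by (simp only: norm_mult norm_phase mult_1_right order_refl AE_I2)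
  qed
  from this[OF assms(1)] this[OF assms(2)]
  show "fourier_L1 (\<lambda>x. f x - g x) \<xi> = fourier_L1 f \<xi> - fourier_L1 g \<xi>"
    unfolding fourier_L1_def left_diff_distrib by (rule Bochner_Integration.integral_diff)
qed

lemma L1_diff: "f \<in> L1 \<Longrightarrow> g \<in> L1 \<Longrightarrow> (\<lambda>x. f x - g x) \<in> L1"
  by (simp add: L1_def)

text \<open>The constant of \<open>fourier_L1_bound\<close>. The argument only carries the dimension.\<close>

definition plancherel_const :: "'d itself \<Rightarrow> real" where
  "plancherel_const _ = 2 * (2 * pi) ^ CARD('d)"

lemma plancherel_const_nonneg: "plancherel_const d \<ge> 0"
  by (simp add: plancherel_const_def)

lemma L2_normsq_fourier_diff:
  fixes f g :: "real ^ 'd \<Rightarrow> complex"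
  assumes "f \<in> L1" "g \<in> L1"
  shows "L2_normsq (\<lambda>\<xi>. fourier_L1 f \<xi> - fourier_L1 g \<xi>) \<le> ennreal (plancherel_const TYPE('d)) * L2_normsq (\<lambda>x. f x - g x)"
  using L2_normsq_fourier_L1_le[OF L1_diff[OF assms]] by (simp only: fourier_L1_diff[OF assms] plancherel_const_def)

lemma fourier_L1_in_L2: "f \<in> L1 \<inter> L2 \<Longrightarrow> fourier_L1 f \<in> L2"
  using L2_normsq_fourier_L1_le[of f] fourier_L1_measurable[of f]
  by (auto simp: L2_iff ennreal_mult_less_top intro: le_less_trans)

text \<open>One approximating sequence whose transforms converge suffices: any other sequence has the same
limit transform, since the transform is bounded on differences.\<close>

lemma is_fourier_L2I:
  fixes f g :: "real ^ 'd \<Rightarrow> complex"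
  assumes F: "\<And>n. F n \<in> L1 \<inter> L2" and f: "f \<in> L2" and Ff: "L2_tendsto F f"
    and g: "g \<in> borel_measurable lebesgue" and Fg: "L2_tendsto (\<lambda>n. fourier_L1 (F n)) g"
  shows "is_fourier_L2 f g"
  unfolding is_fourier_L2_def
proof (intro conjI allI impI)
  show "g \<in> L2" using L2_tendsto_in_L2[OF fourier_L1_in_L2[OF F] g Fg] .
  fix G assume G: "(\<forall>n. G n \<in> L1 \<inter> L2) \<and> L2_tendsto G f"
  let ?C = "ennreal (plancherel_const TYPE('d))"
  show "L2_tendsto (\<lambda>n. fourier_L1 (G n)) g"
  proof (rule L2_tendsto_bound)
    fix n
    have "L2_normsq (\<lambda>\<xi>. fourier_L1 (G n) \<xi> - g \<xi>)
      \<le> 2 * L2_normsq (\<lambda>\<xi>. fourier_L1 (G n) \<xi> - fourier_L1 (F n) \<xi>) + 2 * L2_normsq (\<lambda>\<xi>. fourier_L1 (F n) \<xi> - g \<xi>)"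
      using F G g by (intro L2_normsq_diff_triangle fourier_L1_measurable) auto
    also have "L2_normsq (\<lambda>\<xi>. fourier_L1 (G n) \<xi> - fourier_L1 (F n) \<xi>) \<le> ?C * L2_normsq (\<lambda>x. G n x - F n x)"
      using F G by (intro L2_normsq_fourier_diff) auto
    also have "L2_normsq (\<lambda>x. G n x - F n x) \<le> 2 * L2_normsq (\<lambda>x. G n x - f x) + 2 * L2_normsq (\<lambda>x. f x - F n x)"
      using F G f by (intro L2_normsq_diff_triangle) (auto simp: L2_measurable)
    also have "L2_normsq (\<lambda>x. f x - F n x) = L2_normsq (\<lambda>x. F n x - f x)" by (rule L2_normsq_minus_commute)
    finally show "L2_normsq (\<lambda>\<xi>. fourier_L1 (G n) \<xi> - g \<xi>)
      \<le> 2 * (?C * (2 * L2_normsq (\<lambda>x. G n x - f x) + 2 * L2_normsq (\<lambda>x. F n x - f x))) + 2 * L2_normsq (\<lambda>\<xi>. fourier_L1 (F n) \<xi> - g \<xi>)"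
      by (simp add: add_mono mult_left_mono)
  next
    have "(\<lambda>n. 2 * (?C * (2 * L2_normsq (\<lambda>x. G n x - f x) + 2 * L2_normsq (\<lambda>x. F n x - f x))) + 2 * L2_normsq (\<lambda>\<xi>. fourier_L1 (F n) \<xi> - g \<xi>))
      \<longlonglongrightarrow> 2 * (?C * (2 * 0 + 2 * 0)) + 2 * 0"
      using G Ff Fg unfolding L2_tendsto_def by (intro tendsto_add ennreal_tendsto_cmult) auto
    then show "(\<lambda>n. 2 * (?C * (2 * L2_normsq (\<lambda>x. G n x - f x) + 2 * L2_normsq (\<lambda>x. F n x - f x))) + 2 * L2_normsq (\<lambda>\<xi>. fourier_L1 (F n) \<xi> - g \<xi>))
      \<longlonglongrightarrow> 0" by simp
  qed
qed

text \<open>Cut-offs of \<open>f\<close> that converge at the rate \<open>(1/8) ^ n\<close> have transforms that converge at the same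
rate.\<close>

lemma is_fourier_L2_exists:
  fixes f :: "real ^ 'd \<Rightarrow> complex"
  assumes f: "f \<in> L2"
  shows "\<exists>g. is_fourier_L2 f g"
proof -
  obtain F where F: "\<And>n. F n \<in> L1 \<inter> L2" and Fn: "\<And>n. L2_normsq (\<lambda>x. F n x - f x) \<le> ennreal ((1/8) ^ n)"
    using L2_approx_L1[OF f] by blast
  let ?c = "plancherel_const TYPE('d)"
  have F': "F n \<in> L1" "F n \<in> L2" "F n \<in> borel_measurable lebesgue" for n using F by (auto simp: L2_measurable)
  have fast: "L2_normsq (\<lambda>\<xi>. fourier_L1 (F (Suc n)) \<xi> - fourier_L1 (F n) \<xi>) \<le> ennreal ((?c * 4) * (1/8) ^ n)" for n
  proof -
    have "L2_normsq (\<lambda>\<xi>. fourier_L1 (F (Suc n)) \<xi> - fourier_L1 (F n) \<xi>) \<le> ennreal ?c * L2_normsq (\<lambda>x. F (Suc n) x - F n x)"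
      by (intro L2_normsq_fourier_diff F')
    also have "L2_normsq (\<lambda>x. F (Suc n) x - F n x) \<le> 2 * L2_normsq (\<lambda>x. F (Suc n) x - f x) + 2 * L2_normsq (\<lambda>x. f x - F n x)"
      by (intro L2_normsq_diff_triangle F' L2_measurable[OF f])
    also have "\<dots> \<le> 2 * ennreal ((1/8) ^ Suc n) + 2 * ennreal ((1/8) ^ n)"
      using Fn[of n] Fn[of "Suc n"] by (intro add_mono mult_left_mono) (auto simp: L2_normsq_minus_commute[of f])
    also have "\<dots> = ennreal (2 * (1/8) ^ Suc n + 2 * (1/8) ^ n)" by (intro two_ennreal_add) auto
    also have "\<dots> \<le> ennreal (4 * (1/8) ^ n)" by (intro ennreal_leI) simp
    finally have "L2_normsq (\<lambda>\<xi>. fourier_L1 (F (Suc n)) \<xi> - fourier_L1 (F n) \<xi>) \<le> ennreal ?c * ennreal (4 * (1/8) ^ n)"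
      by (simp add: mult_left_mono)
    also have "\<dots> = ennreal ((?c * 4) * (1/8) ^ n)"
      by (subst ennreal_mult[symmetric]) (simp_all add: plancherel_const_nonneg mult.assoc)
    finally show ?thesis .
  qed
  have c: "?c * 4 \<ge> 0" using plancherel_const_nonneg by simp
  note fc = L2_fast_cauchy[OF fourier_L1_measurable[OF F'(1)] c fast]
  have "L2_tendsto F f"
    using L2_tendsto_bound[OF Fn] pow8_tendsto[of 1] by simp
  from is_fourier_L2I[OF F f this fc(2,3)] show ?thesis by blast
qed

lemma fourier_L2: "f \<in> L2 \<Longrightarrow> is_fourier_L2 f (fourier_L2 f)"
  unfolding fourier_L2_def by (rule someI_ex[OF is_fourier_L2_exists])

lemma is_fourier_L2_obtain:
  assumes "is_fourier_L2 f g" "f \<in> L2"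
  obtains F where "\<And>n. F n \<in> L1 \<inter> L2" "L2_tendsto F f" "L2_tendsto (\<lambda>n. fourier_L1 (F n)) g" "g \<in> L2"
proof -
  obtain F where F: "\<And>n. F n \<in> L1 \<inter> L2" and Fn: "\<And>n. L2_normsq (\<lambda>x. F n x - f x) \<le> ennreal ((1/8) ^ n)"
    using L2_approx_L1[OF assms(2)] by blast
  have "L2_tendsto F f"
    using L2_tendsto_bound[OF Fn] pow8_tendsto[of 1] by simp
  with F assms(1) show ?thesis by (intro that[of F]) (auto simp: is_fourier_L2_def)
qed

lemma is_fourier_L2_diff_scale:
  fixes f1 f2 :: "real ^ 'd \<Rightarrow> complex"
  assumes 1: "is_fourier_L2 f1 g1" "f1 \<in> L2" and 2: "is_fourier_L2 f2 g2" "f2 \<in> L2"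
  shows "is_fourier_L2 (\<lambda>x. f1 x - c * f2 x) (\<lambda>\<xi>. g1 \<xi> - c * g2 \<xi>)"
proof -
  obtain F1 where F1: "\<And>n. F1 n \<in> L1 \<inter> L2" "L2_tendsto F1 f1" "L2_tendsto (\<lambda>n. fourier_L1 (F1 n)) g1" "g1 \<in> L2"
    using is_fourier_L2_obtain[OF 1] by blast
  obtain F2 where F2: "\<And>n. F2 n \<in> L1 \<inter> L2" "L2_tendsto F2 f2" "L2_tendsto (\<lambda>n. fourier_L1 (F2 n)) g2" "g2 \<in> L2"
    using is_fourier_L2_obtain[OF 2] by blast
  have comb: "L2_tendsto (\<lambda>n x. u n x - c * v n x) (\<lambda>x. u' x - c * v' x)"
    if u: "L2_tendsto u u'" and v: "L2_tendsto v v'"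
      and m[measurable]: "\<And>n. u n \<in> borel_measurable lebesgue" "\<And>n. v n \<in> borel_measurable lebesgue" "u' \<in> borel_measurable lebesgue" "v' \<in> borel_measurable lebesgue"
    for u v :: "nat \<Rightarrow> real ^ 'd \<Rightarrow> complex" and u' v'
  proof (rule L2_tendsto_bound)
    fix n
    have "L2_normsq (\<lambda>x. u n x - c * v n x - (u' x - c * v' x)) = L2_normsq (\<lambda>x. (u n x - u' x) + (- c) * (v n x - v' x))"
      by (simp add: algebra_simps)
    also have "\<dots> \<le> 2 * L2_normsq (\<lambda>x. u n x - u' x) + 2 * L2_normsq (\<lambda>x. (- c) * (v n x - v' x))"
      by (rule L2_normsq_add_le) measurable
    also have "L2_normsq (\<lambda>x. (- c) * (v n x - v' x)) = ennreal ((cmod c)\<^sup>2) * L2_normsq (\<lambda>x. v n x - v' x)"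
      by (subst L2_normsq_scale) auto
    finally show "L2_normsq (\<lambda>x. u n x - c * v n x - (u' x - c * v' x)) \<le> 2 * L2_normsq (\<lambda>x. u n x - u' x) + 2 * (ennreal ((cmod c)\<^sup>2) * L2_normsq (\<lambda>x. v n x - v' x))" .
  next
    have "(\<lambda>n. 2 * L2_normsq (\<lambda>x. u n x - u' x) + 2 * (ennreal ((cmod c)\<^sup>2) * L2_normsq (\<lambda>x. v n x - v' x))) \<longlonglongrightarrow> 2 * 0 + 2 * (ennreal ((cmod c)\<^sup>2) * 0)"
      using u v unfolding L2_tendsto_def by (intro tendsto_add ennreal_tendsto_cmult) auto
    then show "(\<lambda>n. 2 * L2_normsq (\<lambda>x. u n x - u' x) + 2 * (ennreal ((cmod c)\<^sup>2) * L2_normsq (\<lambda>x. v n x - v' x))) \<longlonglongrightarrow> 0" by simp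
  qed
  have cF2: "(\<lambda>x. c * F2 n x) \<in> L1" for n using F2 by (auto simp: L1_def)
  have f: "fourier_L1 (\<lambda>x. F1 n x - c * F2 n x) = (\<lambda>\<xi>. fourier_L1 (F1 n) \<xi> - c * fourier_L1 (F2 n) \<xi>)" for n
    using F1 cF2 by (subst fourier_L1_diff) (auto simp: fourier_L1_def mult.assoc)
  show ?thesis
  proof (rule is_fourier_L2I[where F="\<lambda>n x. F1 n x - c * F2 n x"])
    show "(\<lambda>x. F1 n x - c * F2 n x) \<in> L1 \<inter> L2" for n
      using F1 F2 cF2 by (auto intro!: L1_diff L2_diff L2_scale)
    show "(\<lambda>x. f1 x - c * f2 x) \<in> L2" by (intro L2_diff L2_scale 1 2)
    show "L2_tendsto (\<lambda>n x. F1 n x - c * F2 n x) (\<lambda>x. f1 x - c * f2 x)"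
      using F1 F2 1 2 by (intro comb) (auto simp: L2_measurable)
    show "L2_tendsto (\<lambda>n. fourier_L1 (\<lambda>x. F1 n x - c * F2 n x)) (\<lambda>\<xi>. g1 \<xi> - c * g2 \<xi>)"
      unfolding f using F1 F2 1 2 by (intro comb fourier_L1_measurable) (auto simp: L2_measurable)
    show "(\<lambda>\<xi>. g1 \<xi> - c * g2 \<xi>) \<in> borel_measurable lebesgue"
      using F1 F2 by (intro L2_measurable L2_diff L2_scale)
  qed
qed

lemma is_fourier_L2_diff_sum:
  assumes "finite S" "is_fourier_L2 f g" "f \<in> L2" "\<And>i. i \<in> S \<Longrightarrow> is_fourier_L2 (u i) (v i)" "\<And>i. i \<in> S \<Longrightarrow> u i \<in> L2"
  shows "is_fourier_L2 (\<lambda>x. f x - (\<Sum>i\<in>S. c i * u i x)) (\<lambda>\<xi>. g \<xi> - (\<Sum>i\<in>S. c i * v i \<xi>))"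
  using assms(1,4,5)
proof (induction S)
  case empty
  then show ?case using assms by simp
next
  case (insert j S)
  have L: "(\<lambda>x. f x - (\<Sum>i\<in>S. c i * u i x)) \<in> L2"
    using insert assms by (intro L2_diff L2_sum L2_scale) auto
  have "is_fourier_L2 (\<lambda>x. (f x - (\<Sum>i\<in>S. c i * u i x)) - c j * u j x) (\<lambda>\<xi>. (g \<xi> - (\<Sum>i\<in>S. c i * v i \<xi>)) - c j * v j \<xi>)"
    using insert L by (intro is_fourier_L2_diff_scale) auto
  then show ?case using insert by (simp add: algebra_simps)
qed

lemma is_fourier_L2_bound:
  fixes f g :: "real ^ 'd \<Rightarrow> complex"
  assumes "is_fourier_L2 f g" and f: "f \<in> L2"
  shows "L2_normsq g \<le> ennreal (4 * plancherel_const TYPE('d)) * L2_normsq f"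
proof -
  let ?C = "ennreal (plancherel_const TYPE('d))"
  obtain F where F: "\<And>n. F n \<in> L1 \<inter> L2" "L2_tendsto F f" "L2_tendsto (\<lambda>n. fourier_L1 (F n)) g" "g \<in> L2"
    using is_fourier_L2_obtain[OF assms] by blast
  have F': "F n \<in> L1" "F n \<in> L2" "F n \<in> borel_measurable lebesgue" for n using F by (auto simp: L2_measurable)
  have le: "L2_normsq g \<le> 2 * L2_normsq (\<lambda>\<xi>. fourier_L1 (F n) \<xi> - g \<xi>) + 2 * (?C * (2 * L2_normsq (\<lambda>x. F n x - f x) + 2 * L2_normsq f))" for n
  proof -
    have "L2_normsq g = L2_normsq (\<lambda>\<xi>. (g \<xi> - fourier_L1 (F n) \<xi>) + fourier_L1 (F n) \<xi>)" by simp
    also have "\<dots> \<le> 2 * L2_normsq (\<lambda>\<xi>. g \<xi> - fourier_L1 (F n) \<xi>) + 2 * L2_normsq (fourier_L1 (F n))"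
      using F F' by (intro L2_normsq_add_le borel_measurable_diff fourier_L1_measurable L2_measurable)
    also have "L2_normsq (fourier_L1 (F n)) \<le> ?C * L2_normsq (F n)"
      using L2_normsq_fourier_L1_le[OF F'(1)] by (simp only: plancherel_const_def)
    also have "L2_normsq (F n) = L2_normsq (\<lambda>x. (F n x - f x) + f x)" by simp
    also have "\<dots> \<le> 2 * L2_normsq (\<lambda>x. F n x - f x) + 2 * L2_normsq f"
      using F F' f by (intro L2_normsq_add_le borel_measurable_diff L2_measurable)
    finally show ?thesis by (simp add: L2_normsq_minus_commute[of g] add_mono mult_left_mono)
  qed
  have "(\<lambda>n. 2 * L2_normsq (\<lambda>\<xi>. fourier_L1 (F n) \<xi> - g \<xi>) + 2 * (?C * (2 * L2_normsq (\<lambda>x. F n x - f x) + 2 * L2_normsq f)))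
    \<longlonglongrightarrow> 2 * 0 + 2 * (?C * (2 * 0 + 2 * L2_normsq f))"
    using F unfolding L2_tendsto_def by (intro tendsto_add ennreal_tendsto_cmult tendsto_const) auto
  from LIMSEQ_le_const[OF this] have "L2_normsq g \<le> 2 * 0 + 2 * (?C * (2 * 0 + 2 * L2_normsq f))"
    using le by blast
  also have "\<dots> = ennreal (4 * plancherel_const TYPE('d)) * L2_normsq f"
    by (simp add: ennreal_mult' plancherel_const_nonneg mult.assoc mult.left_commute)
  finally show ?thesis .
qed

text \<open>For the integral transform this is the substitution \<open>y = M x - k\<close>. Since the modulation is unimodular
and the dilations are isometries, the identity survives the passage to limits in \<open>L2\<close>.\<close>

lemma is_fourier_L2_dilate_shift:
  fixes M :: "real ^ 'd ^ 'd"
  assumes "is_fourier_L2 f g" and f: "f \<in> L2" and M: "invertible M"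
  defines "N \<equiv> matrix_inv (transpose M)"
  shows "is_fourier_L2 (dilate_shift M k f) (\<lambda>\<eta>. phase (k \<bullet> (N *v \<eta>)) * dilate_shift N 0 g \<eta>)"
proof -
  obtain F where F: "\<And>n. F n \<in> L1 \<inter> L2" "L2_tendsto F f" "L2_tendsto (\<lambda>n. fourier_L1 (F n)) g" "g \<in> L2"
    using is_fourier_L2_obtain[OF assms(1,2)] by blast
  have F': "F n \<in> L1" "F n \<in> L2" "F n \<in> borel_measurable lebesgue" for n using F by (auto simp: L2_measurable)
  have Mt: "invertible (transpose M)" using M by (simp add: transpose_invertible)
  then have N: "invertible N" unfolding N_def by (rule invertible_matrix_inv)
  have MN: "transpose M ** N = mat 1" unfolding N_def by (rule matrix_inv_right[OF Mt])
  then have "det M * det N = 1"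
    by (metis det_I det_mul det_transpose)
  then have dN: "\<bar>det N\<bar> * \<bar>det M\<bar> = 1" by (metis abs_mult abs_one mult.commute)
  let ?p = "\<lambda>\<eta>. phase (k \<bullet> (N *v \<eta>))"
  have pm: "?p \<in> borel_measurable lebesgue"
  proof -
    have "?p \<in> borel_measurable borel"
      by (intro borel_measurable_continuous_onI continuous_intros)
    then show ?thesis by (intro measurable_completion) simp
  qed
  have iso: "L2_normsq (\<lambda>\<eta>. ?p \<eta> * u \<eta> - ?p \<eta> * v \<eta>) = L2_normsq (\<lambda>\<eta>. u \<eta> - v \<eta>)" for u v :: "real ^ 'd \<Rightarrow> complex"
    unfolding L2_normsq_def right_diff_distrib[symmetric] norm_mult norm_phase by simp
  have dsdiff: "(\<lambda>x. dilate_shift U a u x - dilate_shift U a v x) = dilate_shift U a (\<lambda>x. u x - v x)" for U :: "real ^ 'd ^ 'd" and a u v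
    by (rule ext) (simp add: dilate_shift_def algebra_simps)
  have ft: "fourier_L1 (dilate_shift M k h) = (\<lambda>\<eta>. ?p \<eta> * dilate_shift N 0 (fourier_L1 h) \<eta>)"
    if h: "h \<in> borel_measurable lebesgue" for h
  proof
    fix \<eta> :: "real ^ 'd"
    let ?e = "\<lambda>x. phase x"
    define G where "G = (\<lambda>y. h y * ?e ((y + k) \<bullet> (N *v \<eta>)))"
    have "(\<lambda>y. ?e ((y + k) \<bullet> (N *v \<eta>))) \<in> borel_measurable borel"
      by (intro borel_measurable_continuous_onI continuous_intros)
    then have "(\<lambda>y. ?e ((y + k) \<bullet> (N *v \<eta>))) \<in> borel_measurable lebesgue"
      by (intro measurable_completion) simp
    then have Gm: "G \<in> borel_measurable lebesgue" unfolding G_def by (intro borel_measurable_times h)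
    have Gx: "G (M *v x - k) = h (M *v x - k) * ?e (x \<bullet> \<eta>)" for x
    proof -
      have "(M *v x) \<bullet> (N *v \<eta>) = x \<bullet> (transpose M *v (N *v \<eta>))"
        by (metis dot_lmul_matrix vector_transpose_matrix inner_commute transpose_transpose)
      also have "\<dots> = x \<bullet> \<eta>" by (simp add: matrix_vector_mul_assoc MN)
      finally show ?thesis by (simp add: G_def)
    qed
    have Geq: "(\<integral>y. G y \<partial>lebesgue) = ?p \<eta> * fourier_L1 h (N *v \<eta>)"
    proof -
      have "G = (\<lambda>y. ?p \<eta> * (h y * ?e (y \<bullet> (N *v \<eta>))))"
        unfolding G_def by (auto simp: inner_add_left algebra_simps exp_diff exp_minus exp_add field_simps)
      then show ?thesis unfolding fourier_L1_def by simp
    qed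
    have "fourier_L1 (dilate_shift M k h) \<eta> = complex_of_real (sqrt \<bar>det M\<bar>) * (\<integral>x. G (M *v x - k) \<partial>lebesgue)"
      unfolding fourier_L1_def dilate_shift_def Gx mult.assoc by simp
    also have "(\<integral>x. G (M *v x - k) \<partial>lebesgue) = complex_of_real \<bar>det N\<bar> * (\<integral>y. G y \<partial>lebesgue)"
      unfolding integral_matrix_affine[OF M Gm, of k] scaleR_conv_of_real mult.assoc[symmetric] of_real_mult[symmetric] dN
      by simp
    also have "complex_of_real (sqrt \<bar>det M\<bar>) * (complex_of_real \<bar>det N\<bar> * (\<integral>y. G y \<partial>lebesgue))
       = complex_of_real (sqrt \<bar>det M\<bar> * \<bar>det N\<bar>) * (\<integral>y. G y \<partial>lebesgue)"
      by simp
    also have "sqrt \<bar>det M\<bar> * \<bar>det N\<bar> = sqrt \<bar>det N\<bar>"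
    proof -
      have "sqrt \<bar>det M\<bar> * \<bar>det N\<bar> = sqrt (\<bar>det N\<bar> * \<bar>det M\<bar>) * sqrt \<bar>det N\<bar>"
        by (simp add: real_sqrt_mult)
      then show ?thesis by (simp add: dN)
    qed
    finally show "fourier_L1 (dilate_shift M k h) \<eta> = ?p \<eta> * dilate_shift N 0 (fourier_L1 h) \<eta>"
      unfolding Geq dilate_shift_def by simp
  qed
  show ?thesis
  proof (rule is_fourier_L2I[where F="\<lambda>n. dilate_shift M k (F n)"])
    show "dilate_shift M k (F n) \<in> L1 \<inter> L2" for n
      using L2_dilate_shift[OF M F'(2)] integrable_matrix_affine[OF M, of "F n" k] F'(1)[of n]
      by (auto simp: L1_def dilate_shift_def[abs_def])
    show "dilate_shift M k f \<in> L2" by (rule L2_dilate_shift[OF M f])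
    show "L2_tendsto (\<lambda>n. dilate_shift M k (F n)) (dilate_shift M k f)"
      using F(2) unfolding L2_tendsto_def dsdiff
      by (subst L2_normsq_dilate_shift[OF M borel_measurable_diff[OF F'(3) L2_measurable[OF f]]])
    show "(\<lambda>\<eta>. ?p \<eta> * dilate_shift N 0 g \<eta>) \<in> borel_measurable lebesgue"
      by (intro borel_measurable_times pm dilate_shift_measurable N L2_measurable F)
    show "L2_tendsto (\<lambda>n. fourier_L1 (dilate_shift M k (F n))) (\<lambda>\<eta>. ?p \<eta> * dilate_shift N 0 g \<eta>)"
      using F(3) unfolding L2_tendsto_def ft[OF F'(3)] iso dsdiff
      by (subst L2_normsq_dilate_shift[OF N borel_measurable_diff[OF fourier_L1_measurable[OF F'(1)] L2_measurable[OF F(4)]]])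
  qed
qed

section \<open>Characters of the torus\<close>

lemma int_vecs_diff: "k \<in> int_vecs \<Longrightarrow> l \<in> int_vecs \<Longrightarrow> k - l \<in> int_vecs"
  by (simp add: int_vecs_def)

lemma int_vecs_add: "k \<in> int_vecs \<Longrightarrow> l \<in> int_vecs \<Longrightarrow> k + l \<in> int_vecs"
  by (simp add: int_vecs_def)

lemma int_vecs_uminus: "k \<in> int_vecs \<Longrightarrow> - k \<in> int_vecs"
  by (simp add: int_vecs_def)

lemma int_vecs_zero: "0 \<in> int_vecs"
  by (simp add: int_vecs_def)

definition torus_cell :: "(real ^ 'd) set" where
  "torus_cell = {\<xi>. \<forall>i. - pi \<le> \<xi> $ i \<and> \<xi> $ i < pi}"

lemma integral_exp_period:
  assumes n: "n \<in> \<int>"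
  shows "integrable lborel (\<lambda>t. indicator {-pi..<pi} t *\<^sub>R phase (n * t))"
    and "(\<integral>t. indicator {-pi..<pi} t *\<^sub>R phase (n * t) \<partial>lborel) = (if n = 0 then complex_of_real (2 * pi) else 0)"
proof -
  let ?f = "\<lambda>t. phase (n * t)"
  have cont: "continuous_on {-pi..pi} ?f" by (intro continuous_intros)
  have [measurable]: "?f \<in> borel_measurable borel"
    by (intro borel_measurable_continuous_onI continuous_intros)
  have ae: "AE t in lborel. indicator {-pi..pi} t *\<^sub>R ?f t = indicator {-pi..<pi} t *\<^sub>R ?f t"
    using AE_lborel_singleton[of pi] by eventually_elim (auto simp: indicator_def)
  have int: "integrable lborel (\<lambda>t. indicator {-pi..pi} t *\<^sub>R ?f t)"
    using borel_integrable_atLeastAtMost'[OF cont] by (simp add: set_integrable_def)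
  then show "integrable lborel (\<lambda>t. indicator {-pi..<pi} t *\<^sub>R ?f t)"
    by (subst integrable_cong_AE[of _ _ "\<lambda>t. indicator {-pi..pi} t *\<^sub>R ?f t"]) (use ae in \<open>auto elim: eventually_mono\<close>)
  have "(\<integral>t. indicator {-pi..<pi} t *\<^sub>R ?f t \<partial>lborel) = (\<integral>t. indicator {-pi..pi} t *\<^sub>R ?f t \<partial>lborel)"
    by (rule Bochner_Integration.integral_cong_AE) (measurable, use ae in \<open>auto elim: eventually_mono\<close>)
  also have "\<dots> = (if n = 0 then complex_of_real (2 * pi) else 0)"
  proof (cases "n = 0")
    case True
    then show ?thesis by (simp add: scaleR_conv_of_real)
  next
    case False
    let ?F = "\<lambda>t. phase (n * t) / (- \<i> * complex_of_real n)"
    have "(\<integral>t. indicator {-pi..pi} t *\<^sub>R ?f t \<partial>lborel) = ?F pi - ?F (- pi)"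
    proof (rule integral_FTC_Icc)
      fix t
      have "((\<lambda>t. exp (- \<i> * complex_of_real n * complex_of_real t) / (- \<i> * complex_of_real n)) has_vector_derivative
        (exp (- \<i> * complex_of_real n * complex_of_real t) * (- \<i> * complex_of_real n)) / (- \<i> * complex_of_real n)) (at t within {-pi..pi})"
        by (rule has_vector_derivative_real_field) (auto intro!: derivative_eq_intros)
      then show "(?F has_vector_derivative ?f t) (at t within {-pi..pi})"
        using False by (simp add: mult.assoc)
    qed (use cont in auto)
    also have "\<dots> = 0"
    proof -
      have "sin (n * pi) = 0" using n by (simp add: sin_times_pi_eq_0)
      then have "phase (n * pi) = phase (n * - pi)"
        by (simp add: exp_eq_polar complex_eq_iff Re_exp Im_exp)
      then show ?thesis by simp
    qed
    finally show ?thesis using False by simp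
  qed
  finally show "(\<integral>t. indicator {-pi..<pi} t *\<^sub>R ?f t \<partial>lborel) = (if n = 0 then complex_of_real (2 * pi) else 0)" .
qed

lemma torus_cell_sets: "torus_cell \<in> sets (borel :: (real ^ 'd) measure)"
proof -
  have "(torus_cell :: (real ^ 'd) set) = (\<Inter>i. {\<xi>. - pi \<le> \<xi> $ i \<and> \<xi> $ i < pi})"
    by (auto simp: torus_cell_def)
  also have "\<dots> \<in> sets borel"
  proof (intro sets.countable_INT')
    fix i :: 'd
    have [measurable]: "(\<lambda>\<xi>::real ^ 'd. \<xi> $ i) \<in> borel_measurable borel"
      by (intro borel_measurable_continuous_onI continuous_intros)
    show "range (\<lambda>i. {\<xi>::real^'d. - pi \<le> \<xi> $ i \<and> \<xi> $ i < pi}) \<subseteq> sets borel"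
    proof clarify
      fix i :: 'd
      have [measurable]: "(\<lambda>\<xi>::real ^ 'd. \<xi> $ i) \<in> borel_measurable borel"
        by (intro borel_measurable_continuous_onI continuous_intros)
      show "{\<xi>::real^'d. - pi \<le> \<xi> $ i \<and> \<xi> $ i < pi} \<in> sets borel" by measurable
    qed
  qed auto
  finally show ?thesis .
qed

lemma continuous_lebesgue_measurable:
  fixes f :: "'a::euclidean_space \<Rightarrow> 'b::topological_space"
  assumes "continuous_on UNIV f"
  shows "f \<in> borel_measurable lebesgue"
  using borel_measurable_continuous_onI[OF assms] by (intro measurable_completion) simp

lemma integral_torus_character:
  assumes k: "k \<in> (int_vecs :: (real ^ 'd) set)"
  shows "integrable lebesgue (\<lambda>\<xi>. indicator torus_cell \<xi> * phase (k \<bullet> \<xi>))"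
    and "(\<integral>\<xi>. indicator torus_cell \<xi> * phase (k \<bullet> \<xi>) \<partial>lebesgue) = (if k = 0 then complex_of_real ((2 * pi) ^ CARD('d)) else 0)"
proof -
  let ?g = "\<lambda>b t. indicator {-pi..<pi} t *\<^sub>R phase ((k \<bullet> b) * t)"
  have kb: "k \<bullet> b \<in> \<int>" if "b \<in> Basis" for b
    using k that by (auto simp: Basis_cart int_vecs_def inner_axis)
  have eq: "indicator torus_cell \<xi> * phase (k \<bullet> \<xi>) = (\<Prod>b\<in>Basis. ?g b (\<xi> \<bullet> b))" for \<xi>
  proof -
    have "(indicator torus_cell \<xi> :: complex) = (\<Prod>b\<in>Basis. complex_of_real (indicator {-pi..<pi} (\<xi> \<bullet> b)))"
    proof (cases "\<xi> \<in> torus_cell")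
      case True
      then have "(\<Prod>b\<in>Basis. complex_of_real (indicator {-pi..<pi} (\<xi> \<bullet> b))) = 1"
        by (intro prod.neutral) (auto simp: torus_cell_def Basis_cart inner_axis)
      with True show ?thesis by simp
    next
      case False
      then obtain i where "\<not> (- pi \<le> \<xi> $ i \<and> \<xi> $ i < pi)" by (auto simp: torus_cell_def)
      then have "\<exists>b\<in>Basis. complex_of_real (indicator {-pi..<pi} (\<xi> \<bullet> b)) = 0"
        by (intro bexI[of _ "axis i 1"]) (auto simp: Basis_cart inner_axis indicator_def)
      with False show ?thesis by (simp add: prod_zero)
    qed
    moreover have "phase (k \<bullet> \<xi>) = (\<Prod>b\<in>Basis. phase ((k \<bullet> b) * (\<xi> \<bullet> b)))"
      by (simp add: exp_sum[symmetric] euclidean_inner[of k \<xi>] sum_distrib_left sum_negf)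
    ultimately show ?thesis by (simp add: prod.distrib scaleR_conv_of_real)
  qed
  have int: "integrable lborel (\<lambda>\<xi>. indicator torus_cell \<xi> * phase (k \<bullet> \<xi>))"
    unfolding eq by (rule integrable_lborel_prod) (rule integral_exp_period(1)[OF kb])
  then show "integrable lebesgue (\<lambda>\<xi>. indicator torus_cell \<xi> * phase (k \<bullet> \<xi>))"
    using integrable_completion[of "\<lambda>\<xi>. indicator torus_cell \<xi> * phase (k \<bullet> \<xi>)" lborel] by auto
  have "(\<integral>\<xi>. indicator torus_cell \<xi> * phase (k \<bullet> \<xi>) \<partial>lebesgue)
     = (\<integral>\<xi>. indicator torus_cell \<xi> * phase (k \<bullet> \<xi>) \<partial>lborel)"
    by (rule integral_completion) (use int in auto)
  also have "\<dots> = (\<Prod>b\<in>(Basis :: (real ^ 'd) set). \<integral>t. ?g b t \<partial>lborel)"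
    unfolding eq by (rule integral_lborel_prod) (rule integral_exp_period(1)[OF kb])
  also have "\<dots> = (\<Prod>b\<in>(Basis :: (real ^ 'd) set). if k \<bullet> b = 0 then complex_of_real (2 * pi) else 0)"
    by (intro prod.cong refl integral_exp_period(2) kb)
  also have "\<dots> = (if k = 0 then complex_of_real ((2 * pi) ^ CARD('d)) else 0)"
  proof (cases "k = 0")
    case False
    then obtain b where "b \<in> Basis" "k \<bullet> b \<noteq> 0" using euclidean_all_zero_iff by blast
    then show ?thesis using False by (auto intro!: prod_zero)
  qed simp
  finally show "(\<integral>\<xi>. indicator torus_cell \<xi> * phase (k \<bullet> \<xi>) \<partial>lebesgue) = (if k = 0 then complex_of_real ((2 * pi) ^ CARD('d)) else 0)" .
qed

text \<open>Characters cut off to one period cell and normalized. As elements of \<open>L2\<close> on the whole space they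
are covered by the results on orthonormal families.\<close>

lemma torus_characters_orthonormal:
  "orthonormal_L2 (int_vecs :: (real ^ 'd) set)
    (\<lambda>k \<xi>. complex_of_real (1 / sqrt ((2 * pi) ^ CARD('d))) * (indicator torus_cell \<xi> * phase (k \<bullet> \<xi>)))"
proof -
  let ?v = "(2 * pi) ^ CARD('d)"
  let ?e = "\<lambda>(k::real^'d) \<xi>. indicator torus_cell \<xi> * phase (k \<bullet> \<xi>)"
  have v: "?v > 0" by simp
  have e_prod: "?e k \<xi> * cnj (?e l \<xi>) = ?e (k - l) \<xi>" for k l \<xi>
    by (auto simp: indicator_def exp_cnj exp_diff exp_minus inner_diff_left algebra_simps divide_inverse simp flip: exp_add)
  have [measurable]: "indicator torus_cell \<in> borel_measurable (lebesgue :: (real ^ 'd) measure)"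
    using torus_cell_sets by (intro borel_measurable_indicator sets_completionI_sets) simp
  have meas: "?e k \<in> borel_measurable lebesgue" for k
    by (rule borel_measurable_times) (measurable, intro continuous_lebesgue_measurable continuous_intros)
  have L2: "?e k \<in> L2" if k: "k \<in> int_vecs" for k
  proof -
    have "(cmod (?e k \<xi>))\<^sup>2 = Re (?e 0 \<xi>)" for \<xi>
      by (simp add: norm_mult norm_phase[simplified] indicator_def)
    moreover have "integrable lebesgue (\<lambda>\<xi>. Re (?e 0 \<xi>))"
      by (intro integrable_Re integral_torus_character int_vecs_zero)
    ultimately show ?thesis using meas by (simp add: L2_def)
  qed
  have ip: "L2_inner (?e k) (?e l) = (if k = l then complex_of_real ?v else 0)" if "k \<in> int_vecs" "l \<in> int_vecs" for k l
    unfolding L2_inner_def e_prod by (subst integral_torus_character(2)[OF int_vecs_diff[OF that]]) simp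
  have "complex_of_real (1 / sqrt ?v) * (complex_of_real (1 / sqrt ?v) * complex_of_real ?v) = complex_of_real (1 / sqrt ?v * (1 / sqrt ?v * ?v))"
    by (simp only: of_real_mult)
  also have "1 / sqrt ?v * (1 / sqrt ?v * ?v) = (1::real)" using v by (simp add: field_simps flip: power2_eq_square)
  finally have one: "complex_of_real (1 / sqrt ?v) * (complex_of_real (1 / sqrt ?v) * complex_of_real ?v) = 1" by simp
  show ?thesis
    unfolding orthonormal_L2_def
  proof (intro conjI ballI)
    fix k l :: "real ^ 'd" assume k: "k \<in> int_vecs" and l: "l \<in> int_vecs"
    show "(\<lambda>\<xi>. complex_of_real (1 / sqrt ?v) * ?e k \<xi>) \<in> L2" by (rule L2_scale[OF L2[OF k]])
    show "L2_inner (\<lambda>\<xi>. complex_of_real (1 / sqrt ?v) * ?e k \<xi>) (\<lambda>\<xi>. complex_of_real (1 / sqrt ?v) * ?e l \<xi>) = (if k = l then 1 else 0)"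
      unfolding L2_inner_scale_left L2_inner_scale_right complex_cnj_complex_of_real ip[OF k l]
      by (cases "k = l") (simp_all only: one if_True if_False refl mult_zero_right)
  qed
qed

lemma torus_trig_poly_normsq:
  fixes F :: "(real ^ 'd) set"
  assumes F: "finite F" "F \<subseteq> int_vecs"
  shows "L2_normsq (\<lambda>\<xi>. indicator torus_cell \<xi> * (\<Sum>k\<in>F. c k * phase (k \<bullet> \<xi>)))
     = ennreal ((2 * pi) ^ CARD('d) * (\<Sum>k\<in>F. (cmod (c k))\<^sup>2))"
proof -
  let ?v = "(2 * pi) ^ CARD('d)"
  let ?a = "complex_of_real (1 / sqrt ?v)"
  let ?b = "complex_of_real (sqrt ?v)"
  let ?e = "\<lambda>(k::real^'d) \<xi>. ?a * (indicator torus_cell \<xi> * phase (k \<bullet> \<xi>))"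
  have ON: "orthonormal_L2 F ?e" using torus_characters_orthonormal F(2) by (rule orthonormal_L2_subset)
  have ab: "?b * ?a = 1" by (simp flip: of_real_mult)
  have "L2_sqnorm (\<lambda>\<xi>. 0 - (\<Sum>k\<in>F. (- (?b * c k)) * ?e k \<xi>))
     = L2_sqnorm (\<lambda>\<xi>::real^'d. 0) - (\<Sum>k\<in>F. (cmod (L2_inner (\<lambda>\<xi>. 0) (?e k)))\<^sup>2) + (\<Sum>k\<in>F. (cmod (- (?b * c k) - L2_inner (\<lambda>\<xi>. 0) (?e k)))\<^sup>2)"
    by (rule L2_sqnorm_diff_sum[OF ON F(1) L2_zero])
  also have "\<dots> = (\<Sum>k\<in>F. ?v * (cmod (c k))\<^sup>2)"
    by (simp add: L2_sqnorm_def L2_inner_def norm_mult power_mult_distrib)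
  also have "(\<lambda>\<xi>. 0 - (\<Sum>k\<in>F. (- (?b * c k)) * ?e k \<xi>)) = (\<lambda>\<xi>. indicator torus_cell \<xi> * (\<Sum>k\<in>F. c k * phase (k \<bullet> \<xi>)))"
  proof
    fix \<xi>
    have gen: "(- (b * d)) * (a * (t * u)) = - ((b * a) * (t * (d * u)))" for a b d t u :: complex
      by (simp add: mult_ac)
    have "(- (?b * c k)) * ?e k \<xi> = - ((?b * ?a) * (indicator torus_cell \<xi> * (c k * phase (k \<bullet> \<xi>))))" for k
      by (rule gen)
    then show "0 - (\<Sum>k\<in>F. (- (?b * c k)) * ?e k \<xi>) = indicator torus_cell \<xi> * (\<Sum>k\<in>F. c k * phase (k \<bullet> \<xi>))"
      unfolding ab by (simp add: sum_negf sum_distrib_left mult.left_commute)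
  qed
  finally have "L2_sqnorm (\<lambda>\<xi>. indicator torus_cell \<xi> * (\<Sum>k\<in>F. c k * phase (k \<bullet> \<xi>))) = (\<Sum>k\<in>F. ?v * (cmod (c k))\<^sup>2)" .
  moreover have "(\<lambda>\<xi>. 0 - (\<Sum>k\<in>F. (- (?b * c k)) * ?e k \<xi>)) \<in> L2"
    by (rule L2_diff[OF L2_zero L2_sum], rule L2_scale) (use ON in \<open>simp only: orthonormal_L2_def\<close>)
  ultimately show ?thesis
    unfolding \<open>(\<lambda>\<xi>. 0 - (\<Sum>k\<in>F. (- (?b * c k)) * ?e k \<xi>)) = _\<close> by (simp add: L2_normsq_eq sum_distrib_left)
qed

section \<open>Trigonometric series and refinement masks\<close>

text \<open>A finite exhaustion of the integer lattice, the index set of the partial sums below.\<close>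

definition int_box :: "nat \<Rightarrow> (real ^ 'd) set" where
  "int_box m = {k \<in> int_vecs. \<forall>i. \<bar>k $ i\<bar> \<le> real m}"

lemma finite_int_box: "finite (int_box m :: (real ^ 'd) set)"
proof -
  have "int_box m \<subseteq> (\<lambda>f::'d \<Rightarrow> int. \<chi> i. real_of_int (f i)) ` (PiE UNIV (\<lambda>_. {- int m..int m}))"
  proof
    fix k :: "real ^ 'd" assume k: "k \<in> int_box m"
    then have fl: "real_of_int \<lfloor>k $ i\<rfloor> = k $ i" for i by (auto simp: int_box_def int_vecs_def elim!: Ints_cases)
    moreover have "\<lfloor>k $ i\<rfloor> \<in> {- int m..int m}" for i
    proof -
      have "\<bar>real_of_int \<lfloor>k $ i\<rfloor>\<bar> \<le> real m" unfolding fl using k by (simp add: int_box_def)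
      then have "\<bar>\<lfloor>k $ i\<rfloor>\<bar> \<le> int m" by linarith
      then show ?thesis by auto
    qed
    ultimately show "k \<in> (\<lambda>f::'d \<Rightarrow> int. \<chi> i. real_of_int (f i)) ` (PiE UNIV (\<lambda>_. {- int m..int m}))"
      by (intro image_eqI[of _ _ "\<lambda>i. \<lfloor>k $ i\<rfloor>"]) (auto simp: vec_eq_iff fl)
  qed
  then show ?thesis by (rule finite_subset) (intro finite_imageI finite_PiE, auto)
qed

lemma int_box_subset: "int_box m \<subseteq> int_vecs"
  by (auto simp: int_box_def)

lemma int_box_mono: "m \<le> n \<Longrightarrow> int_box m \<subseteq> int_box n"
  by (auto simp: int_box_def intro: order_trans[OF _ of_nat_mono])

lemma int_vecs_eq_UN: "(int_vecs :: (real ^ 'd) set) = (\<Union>m. int_box m)"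
proof
  show "(int_vecs :: (real ^ 'd) set) \<subseteq> (\<Union>m. int_box m)"
  proof
    fix k :: "real ^ 'd" assume k: "k \<in> int_vecs"
    obtain m where "norm k \<le> real m" using real_arch_simple by blast
    then have "\<bar>k $ i\<bar> \<le> real m" for i using component_le_norm_cart[of k i] by linarith
    with k show "k \<in> (\<Union>m. int_box m)" by (auto simp: int_box_def)
  qed
qed (auto simp: int_box_def)

lemma countable_int_vecs: "countable (int_vecs :: (real ^ 'd) set)"
  unfolding int_vecs_eq_UN by (intro countable_UN) (auto intro: countable_finite finite_int_box)

text \<open>The remainders of a convergent sum tend to 0 along the exhaustion, so boxes can be selected with
remainders below any prescribed sequence. Summing the sizes found makes the selection increasing.\<close>

lemma has_sum_int_box_fast:
  fixes c :: "nat \<Rightarrow> real ^ 'd \<Rightarrow> real"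
  assumes sum: "((\<lambda>(j, k). c j k) has_sum s) ({..<r} \<times> int_vecs)"
  obtains m where "mono m" "\<And>n. s - (\<Sum>(j, k)\<in>{..<r} \<times> int_box (m n). c j k) \<le> (1/8) ^ n"
proof -
  have "\<exists>m. \<forall>m'\<ge>m. s - (\<Sum>(j, k)\<in>{..<r} \<times> int_box m'. c j k) \<le> (1/8) ^ n" for n
  proof -
    obtain X where X: "finite X" "X \<subseteq> {..<r} \<times> int_vecs"
      and Y: "\<And>Y. finite Y \<Longrightarrow> X \<subseteq> Y \<Longrightarrow> Y \<subseteq> {..<r} \<times> int_vecs \<Longrightarrow> dist (sum (\<lambda>(j, k). c j k) Y) s < (1/8) ^ n"
      using sum unfolding has_sum_def tendsto_iff eventually_finite_subsets_at_top by (metis zero_less_power zero_less_divide_1_iff zero_less_numeral)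
    have "\<exists>m. X \<subseteq> {..<r} \<times> int_box m"
      using X
    proof (induction X)
      case (insert x X)
      then obtain m where m: "X \<subseteq> {..<r} \<times> int_box m" by auto
      from insert obtain m' where m': "snd x \<in> int_box m'" by (auto simp: int_vecs_eq_UN)
      have "X \<subseteq> {..<r} \<times> int_box (max m m')" "x \<in> {..<r} \<times> int_box (max m m')"
        using m m' insert.prems int_box_mono[of m "max m m'"] int_box_mono[of m' "max m m'"] by (auto simp: mem_Times_iff)
      then show ?case by blast
    qed auto
    then obtain m where m: "X \<subseteq> {..<r} \<times> int_box m" by blast
    show ?thesis
    proof (intro exI allI impI)
      fix m' assume "m \<le> m'"
      then have "dist (sum (\<lambda>(j, k). c j k) ({..<r} \<times> int_box m')) s < (1/8) ^ n"
        using m int_box_mono[of m m'] int_box_subset[of m'] by (intro Y) (auto simp: finite_int_box)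
      then show "s - (\<Sum>(j, k)\<in>{..<r} \<times> int_box m'. c j k) \<le> (1/8) ^ n"
        by (simp add: dist_real_def)
    qed
  qed
  then obtain m where m: "\<And>n m'. m' \<ge> m n \<Longrightarrow> s - (\<Sum>(j, k)\<in>{..<r} \<times> int_box m'. c j k) \<le> (1/8) ^ n"
    by metis
  show ?thesis
  proof (rule that[of "\<lambda>n. \<Sum>i\<le>n. m i"])
    show "mono (\<lambda>n. \<Sum>i\<le>n. m i)" by (intro monoI sum_mono2) auto
    show "s - (\<Sum>(j, k)\<in>{..<r} \<times> int_box (\<Sum>i\<le>n. m i). c j k) \<le> (1/8) ^ n" for n
      by (rule m) (simp add: member_le_sum)
  qed
qed

lemma torus_cell_cover:
  fixes \<xi> :: "real ^ 'd"
  obtains l where "l \<in> int_vecs" "\<xi> - (2 * pi) *\<^sub>R l \<in> torus_cell"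
proof
  let ?l = "\<chi> i. real_of_int \<lfloor>(\<xi> $ i + pi) / (2 * pi)\<rfloor>"
  show "?l \<in> int_vecs" by (simp add: int_vecs_def)
  have "- pi \<le> x - 2 * pi * real_of_int \<lfloor>(x + pi) / (2 * pi)\<rfloor> \<and> x - 2 * pi * real_of_int \<lfloor>(x + pi) / (2 * pi)\<rfloor> < pi" for x
  proof -
    define y where "y = (x + pi) / (2 * pi)"
    have x: "x = 2 * pi * y - pi" by (simp add: y_def)
    have "2 * pi * real_of_int \<lfloor>y\<rfloor> \<le> 2 * pi * y" "2 * pi * y < 2 * pi * (real_of_int \<lfloor>y\<rfloor> + 1)"
      by (intro mult_left_mono mult_strict_left_mono; simp; linarith)+
    then show ?thesis unfolding y_def[symmetric] by (simp add: x algebra_simps)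
  qed
  then show "\<xi> - (2 * pi) *\<^sub>R ?l \<in> torus_cell" by (simp add: torus_cell_def)
qed

text \<open>The exceptional set of a periodic property is covered by countably many translates of its part in
one cell.\<close>

lemma AE_periodic:
  fixes P :: "real ^ 'd \<Rightarrow> bool"
  assumes ae: "AE \<xi> in lebesgue. \<xi> \<in> torus_cell \<longrightarrow> P \<xi>"
    and per: "\<And>\<xi> l. l \<in> int_vecs \<Longrightarrow> P (\<xi> - (2 * pi) *\<^sub>R l) \<Longrightarrow> P \<xi>"
  shows "AE \<xi> in lebesgue. P \<xi>"
proof -
  have "AE \<xi> in lebesgue. \<forall>l\<in>int_vecs. \<xi> - (2 * pi) *\<^sub>R l \<in> torus_cell \<longrightarrow> P (\<xi> - (2 * pi) *\<^sub>R l)"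
    unfolding AE_ball_countable[OF countable_int_vecs]
  proof
    fix l :: "real ^ 'd"
    from AE_matrix_affine[OF invertible_mat_1 ae, of "(2 * pi) *\<^sub>R l"]
    show "AE \<xi> in lebesgue. \<xi> - (2 * pi) *\<^sub>R l \<in> torus_cell \<longrightarrow> P (\<xi> - (2 * pi) *\<^sub>R l)" by simp
  qed
  then show ?thesis
  proof eventually_elim
    fix \<xi> assume "\<forall>l\<in>int_vecs. \<xi> - (2 * pi) *\<^sub>R l \<in> torus_cell \<longrightarrow> P (\<xi> - (2 * pi) *\<^sub>R l)"
    then show "P \<xi>" using torus_cell_cover[of \<xi>] per by metis
  qed
qed

lemma phase_periodic:
  assumes "k \<in> int_vecs" "l \<in> int_vecs"
  shows "phase (k \<bullet> (\<xi> + (2 * pi) *\<^sub>R l)) = phase (k \<bullet> \<xi>)"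
proof -
  have "k \<bullet> l \<in> \<int>"
    using assms by (auto simp: inner_vec_def int_vecs_def intro!: Ints_sum Ints_mult)
  then obtain n where n: "k \<bullet> l = real_of_int n" by (auto elim: Ints_cases)
  have "- \<i> * complex_of_real (k \<bullet> (\<xi> + (2 * pi) *\<^sub>R l)) = - \<i> * complex_of_real (k \<bullet> \<xi>) + complex_of_real (2 * real_of_int (- n) * pi) * \<i>"
    by (simp add: inner_add_right n algebra_simps)
  then show ?thesis by (simp only: exp_add exp_integer_2pi[OF Ints_of_int] mult_1_right)
qed

text \<open>The Fourier transform of the expansion of \<open>f\<close> in the functions \<open>dilate_shift M k (\<phi> j)\<close>, read at
the point \<open>transpose M *v \<xi>\<close>. There, the character attached to the shift \<open>k\<close> becomes
\<open>phase (k \<bullet> \<xi>)\<close> and the dilated transform of \<open>\<phi> j\<close> becomes a multiple of the transform at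
\<open>\<xi>\<close>. The mask \<open>a j\<close> collects the coefficients that belong to \<open>\<phi> j\<close>.\<close>

lemma refinement_mask:
  fixes M :: "real ^ 'd ^ 'd" and \<phi> :: "nat \<Rightarrow> real ^ 'd \<Rightarrow> complex"
  assumes M: "invertible M" and \<phi>: "\<And>j. j < r \<Longrightarrow> \<phi> j \<in> L2"
    and ON: "orthonormal_L2 ({..<r} \<times> int_vecs) (\<lambda>(j, k). dilate_shift M k (\<phi> j))"
    and f: "f \<in> L2"
    and sum: "((\<lambda>(j, k). (cmod (L2_inner f (dilate_shift M k (\<phi> j))))\<^sup>2) has_sum L2_sqnorm f) ({..<r} \<times> int_vecs)"
  shows "\<exists>a. (\<forall>j<r. a j \<in> L2_torus) \<and>
    (AE \<xi> in lebesgue. fourier_L2 f (transpose M *v \<xi>) = (\<Sum>j<r. a j \<xi> * fourier_L2 (\<phi> j) \<xi>))"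
proof -
  define c where "c = (\<lambda>j k. L2_inner f (dilate_shift M k (\<phi> j)))"
  define N where "N = matrix_inv (transpose M)"
  define s where "s = sqrt \<bar>det N\<bar>"
  have Mt: "invertible (transpose M)" using M by (simp add: transpose_invertible)
  have NM: "N ** transpose M = mat 1" unfolding N_def by (rule matrix_inv_left[OF Mt])
  have sum': "((\<lambda>(j, k). (cmod (c j k))\<^sup>2) has_sum L2_sqnorm f) ({..<r} \<times> int_vecs)"
    using sum by (simp add: c_def)
  obtain m where m: "mono m" and tail: "\<And>n. L2_sqnorm f - (\<Sum>(j, k)\<in>{..<r} \<times> int_box (m n). (cmod (c j k))\<^sup>2) \<le> (1/8) ^ n"
    by (rule has_sum_int_box_fast[OF sum']) auto
  define B where "B = (\<lambda>n. {..<r} \<times> (int_box (m n) :: (real ^ 'd) set))"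
  have B: "finite (B n)" "B n \<subseteq> {..<r} \<times> int_vecs" "B n \<subseteq> B (Suc n)" for n
    using int_box_subset[of "m n"] int_box_mono[OF monoD[OF m, of n "Suc n"]] by (auto simp: B_def finite_int_box)
  have ONB: "orthonormal_L2 (B n) (\<lambda>(j, k). dilate_shift M k (\<phi> j))" for n
    using ON B(2) by (rule orthonormal_L2_subset)
  define e where "e = (\<lambda>(j, k). dilate_shift M k (\<phi> j))"
  have e: "e i \<in> L2" if "i \<in> B n" for i n using ONB[of n] that by (auto simp: orthonormal_L2_def e_def)
  have sum_B: "(\<Sum>i\<in>B n. (cmod (L2_inner f (e i)))\<^sup>2) = (\<Sum>(j, k)\<in>B n. (cmod (c j k))\<^sup>2)" for n
    by (intro sum.cong) (auto simp: c_def e_def)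
  have ONe: "orthonormal_L2 (B n) e" for n using ONB by (simp add: e_def)
  have bess: "(\<Sum>(j, k)\<in>B n. (cmod (c j k))\<^sup>2) \<le> L2_sqnorm f" for n
    using bessel_L2[OF ONe B(1) f] by (simp add: sum_B)
  \<comment> \<open>The coefficients entering between two consecutive boxes are part of the tail.\<close>
  have step: "(\<Sum>k\<in>int_box (m (Suc n)) - int_box (m n). (cmod (c j k))\<^sup>2) \<le> (1/8) ^ n" if j: "j < r" for n j
  proof -
    have "(\<Sum>k\<in>int_box (m (Suc n)) - int_box (m n). (cmod (c j k))\<^sup>2)
       = (\<Sum>(j, k)\<in>{j} \<times> (int_box (m (Suc n)) - int_box (m n)). (cmod (c j k))\<^sup>2)"
      by (subst sum.cartesian_product[symmetric]) simp
    also have "\<dots> \<le> (\<Sum>(j, k)\<in>B (Suc n) - B n. (cmod (c j k))\<^sup>2)"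
      using j B by (intro sum_mono2) (auto simp: B_def finite_int_box)
    also have "\<dots> = (\<Sum>(j, k)\<in>B (Suc n). (cmod (c j k))\<^sup>2) - (\<Sum>(j, k)\<in>B n. (cmod (c j k))\<^sup>2)"
      using B by (intro sum_diff) auto
    also have "\<dots> \<le> (1/8) ^ n" using bess[of "Suc n"] tail[of n] by (simp add: B_def)
    finally show ?thesis .
  qed
  have tailB: "L2_sqnorm f - (\<Sum>(j, k)\<in>B n. (cmod (c j k))\<^sup>2) \<le> (1/8) ^ n" for n
    using tail[of n] by (simp add: B_def)
  \<comment> \<open>The partial sums of the masks. The factor \<open>s\<close> comes from dilating on the Fourier side.\<close>
  define p where "p = (\<lambda>n j \<xi>. \<Sum>k\<in>int_box (m n). complex_of_real s * c j k * phase (k \<bullet> \<xi>))"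
  define a where "a = (\<lambda>j \<xi>. lim (\<lambda>n. p n j \<xi>))"
  have pm[measurable]: "p n j \<in> borel_measurable lebesgue" for n j
    unfolding p_def by (intro continuous_lebesgue_measurable continuous_intros)
  have am[measurable]: "a j \<in> borel_measurable lebesgue" for j
    unfolding a_def by measurable
  have pper: "p n j (\<xi> + (2 * pi) *\<^sub>R l) = p n j \<xi>" if "l \<in> int_vecs" for n j \<xi> l
    unfolding p_def by (intro sum.cong refl, subst phase_periodic[OF subsetD[OF int_box_subset] that]) auto
  have [measurable]: "indicator torus_cell \<in> borel_measurable (lebesgue :: (real ^ 'd) measure)"
    using torus_cell_sets by (intro borel_measurable_indicator sets_completionI_sets) simp
  let ?q = "\<lambda>n j \<xi>. indicator torus_cell \<xi> * p n j \<xi>"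
  have q_L2: "?q n j \<in> L2" for n j
    unfolding L2_iff p_def torus_trig_poly_normsq[OF finite_int_box int_box_subset]
    using pm[of n j] by (auto simp: p_def)
  have fast: "L2_normsq (\<lambda>\<xi>. ?q (Suc n) j \<xi> - ?q n j \<xi>) \<le> ennreal (((2 * pi) ^ CARD('d) * s\<^sup>2) * (1/8) ^ n)" if j: "j < r" for n j
  proof -
    have sub: "int_box (m n) \<subseteq> (int_box (m (Suc n)) :: (real ^ 'd) set)"
      by (intro int_box_mono monoD[OF m]) simp
    have "?q (Suc n) j \<xi> - ?q n j \<xi> = indicator torus_cell \<xi> * (\<Sum>k\<in>int_box (m (Suc n)) - int_box (m n). complex_of_real s * c j k * phase (k \<bullet> \<xi>))" for \<xi>
      unfolding p_def by (subst sum_diff[OF finite_int_box sub]) (simp add: right_diff_distrib)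
    then have "L2_normsq (\<lambda>\<xi>. ?q (Suc n) j \<xi> - ?q n j \<xi>)
      = ennreal ((2 * pi) ^ CARD('d) * (\<Sum>k\<in>int_box (m (Suc n)) - int_box (m n). (cmod (complex_of_real s * c j k))\<^sup>2))"
      using int_box_subset[of "m (Suc n)"] by (simp only:) (intro torus_trig_poly_normsq, auto simp: finite_int_box)
    also have "(\<Sum>k\<in>int_box (m (Suc n)) - int_box (m n). (cmod (complex_of_real s * c j k))\<^sup>2) = s\<^sup>2 * (\<Sum>k\<in>int_box (m (Suc n)) - int_box (m n). (cmod (c j k))\<^sup>2)"
      by (simp add: norm_mult power_mult_distrib sum_distrib_left)
    also have "ennreal ((2 * pi) ^ CARD('d) * (s\<^sup>2 * (\<Sum>k\<in>int_box (m (Suc n)) - int_box (m n). (cmod (c j k))\<^sup>2))) \<le> ennreal ((2 * pi) ^ CARD('d) * (s\<^sup>2 * (1/8) ^ n))"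
      by (intro ennreal_leI mult_left_mono step j) auto
    finally show ?thesis by (simp add: mult.assoc)
  qed
  have c0: "(2 * pi) ^ CARD('d) * s\<^sup>2 \<ge> 0" by simp
  have qm: "?q n j \<in> borel_measurable lebesgue" for n j by measurable
  note fc = L2_fast_cauchy[OF qm c0 fast]
  \<comment> \<open>Off the cell both sides are 0, even where the trigonometric sums diverge.\<close>
  have lim_q: "lim (\<lambda>n. ?q n j \<xi>) = indicator torus_cell \<xi> * a j \<xi>" for j \<xi>
    unfolding a_def by (cases "\<xi> \<in> torus_cell") (auto intro: limI)
  have a_torus: "a j \<in> L2_torus" if j: "j < r" for j
  proof -
    have "(\<lambda>\<xi>. indicator torus_cell \<xi> * a j \<xi>) \<in> L2"
      using L2_tendsto_in_L2[OF q_L2 fc(2,3)[OF j]] by (simp only: lim_q)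
    then have "integrable lebesgue (\<lambda>\<xi>. (cmod (indicator torus_cell \<xi> * a j \<xi>))\<^sup>2)" by (simp add: L2_def)
    also have "(\<lambda>\<xi>. (cmod (indicator torus_cell \<xi> * a j \<xi>))\<^sup>2) = (\<lambda>\<xi>. indicator torus_cell \<xi> *\<^sub>R (cmod (a j \<xi>))\<^sup>2)"
      by (auto simp: indicator_def)
    finally have "set_integrable lebesgue torus_cell (\<lambda>\<xi>. (cmod (a j \<xi>))\<^sup>2)" by (simp add: set_integrable_def)
    moreover have "a j (\<xi> + (2 * pi) *\<^sub>R l) = a j \<xi>" if "l \<in> int_vecs" for \<xi> l
      unfolding a_def pper[OF that] ..
    ultimately show ?thesis using am[of j] by (simp add: L2_torus_def torus_cell_def)
  qed
  have p_lim: "AE \<xi> in lebesgue. (\<lambda>n. p n j \<xi>) \<longlonglongrightarrow> a j \<xi>" if j: "j < r" for j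
  proof (rule AE_periodic)
    show "AE \<xi> in lebesgue. \<xi> \<in> torus_cell \<longrightarrow> (\<lambda>n. p n j \<xi>) \<longlonglongrightarrow> a j \<xi>"
      using fc(1)[OF j] unfolding lim_q by eventually_elim (auto simp: indicator_def)
    fix \<xi> l :: "real ^ 'd" assume l: "l \<in> int_vecs" and lim: "(\<lambda>n. p n j (\<xi> - (2 * pi) *\<^sub>R l)) \<longlonglongrightarrow> a j (\<xi> - (2 * pi) *\<^sub>R l)"
    have "p n j \<xi> = p n j (\<xi> - (2 * pi) *\<^sub>R l)" for n using pper[OF l, of n j "\<xi> - (2 * pi) *\<^sub>R l"] by simp
    with lim show "(\<lambda>n. p n j \<xi>) \<longlonglongrightarrow> a j \<xi>" by (simp add: a_def)
  qed
  \<comment> \<open>The transforms of the partial sums of the expansion of \<open>f\<close>.\<close>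
  define h where "h = (\<lambda>n \<eta>. \<Sum>i\<in>B n. c (fst i) (snd i) * (phase (snd i \<bullet> (N *v \<eta>)) * dilate_shift N 0 (fourier_L2 (\<phi> (fst i))) \<eta>))"
  have fou: "is_fourier_L2 (\<lambda>x. f x - (\<Sum>i\<in>B n. c (fst i) (snd i) * e i x)) (\<lambda>\<eta>. fourier_L2 f \<eta> - h n \<eta>)" for n
    unfolding h_def
  proof (rule is_fourier_L2_diff_sum[OF B(1) fourier_L2[OF f] f])
    fix i assume i: "i \<in> B n"
    then show "e i \<in> L2" by (rule e)
    have "\<phi> (fst i) \<in> L2" using i \<phi> by (auto simp: B_def)
    from is_fourier_L2_dilate_shift[OF fourier_L2[OF this] this M]
    show "is_fourier_L2 (e i) (\<lambda>\<eta>. phase (snd i \<bullet> (N *v \<eta>)) * dilate_shift N 0 (fourier_L2 (\<phi> (fst i))) \<eta>)"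
      by (simp add: e_def case_prod_unfold N_def)
  qed
  let ?C = "4 * plancherel_const TYPE('d)"
  have C0: "?C \<ge> 0" using plancherel_const_nonneg by simp
  have hfast: "L2_normsq (\<lambda>\<eta>. fourier_L2 f \<eta> - h n \<eta>) \<le> ennreal (?C * (1/8) ^ n)" for n
  proof -
    have L: "(\<lambda>x. f x - (\<Sum>i\<in>B n. c (fst i) (snd i) * e i x)) \<in> L2"
      by (intro L2_diff f L2_sum L2_scale e)
    have "L2_sqnorm (\<lambda>x. f x - (\<Sum>i\<in>B n. c (fst i) (snd i) * e i x)) = L2_sqnorm f - (\<Sum>(j, k)\<in>B n. (cmod (c j k))\<^sup>2)"
      using L2_sqnorm_diff_sum[OF ONe B(1) f, of "\<lambda>i. c (fst i) (snd i)" n]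
      by (simp add: sum_B) (simp add: c_def e_def case_prod_unfold)
    then have "L2_normsq (\<lambda>x. f x - (\<Sum>i\<in>B n. c (fst i) (snd i) * e i x)) \<le> ennreal ((1/8) ^ n)"
      using tailB[of n] unfolding L2_normsq_eq[OF L] by (intro ennreal_leI) simp
    then have "ennreal ?C * L2_normsq (\<lambda>x. f x - (\<Sum>i\<in>B n. c (fst i) (snd i) * e i x)) \<le> ennreal ?C * ennreal ((1/8) ^ n)"
      by (rule mult_left_mono) simp
    also have "\<dots> = ennreal (?C * (1/8) ^ n)" by (rule ennreal_mult[symmetric]) (use C0 in auto)
    finally show ?thesis using is_fourier_L2_bound[OF fou L] by (rule order_trans[rotated])
  qed
  have fm: "fourier_L2 f \<in> borel_measurable lebesgue"
    using fourier_L2[OF f] by (auto simp: is_fourier_L2_def L2_measurable)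
  have hm: "h n \<in> borel_measurable lebesgue" for n
  proof -
    have "(\<lambda>\<eta>. fourier_L2 f \<eta> - h n \<eta>) \<in> borel_measurable lebesgue"
      using fou[of n] by (auto simp: is_fourier_L2_def L2_measurable)
    from borel_measurable_diff[OF fm this] show ?thesis by simp
  qed
  have "AE \<eta> in lebesgue. (\<lambda>n. h n \<eta>) \<longlonglongrightarrow> fourier_L2 f \<eta>"
    by (rule L2_fast_tendsto_AE[OF hm fm C0 hfast])
  then have h_lim: "AE \<xi> in lebesgue. (\<lambda>n. h n (transpose M *v \<xi>)) \<longlonglongrightarrow> fourier_L2 f (transpose M *v \<xi>)"
    using AE_matrix_affine[OF Mt, of "\<lambda>\<eta>. (\<lambda>n. h n \<eta>) \<longlonglongrightarrow> fourier_L2 f \<eta>" 0] by simp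
  have hp: "h n (transpose M *v \<xi>) = (\<Sum>j<r. p n j \<xi> * fourier_L2 (\<phi> j) \<xi>)" for n \<xi>
  proof -
    have NMx: "N *v (transpose M *v \<xi>) = \<xi>" by (simp only: matrix_vector_mul_assoc NM matrix_vector_mul_lid)
    have "h n (transpose M *v \<xi>) = (\<Sum>j<r. \<Sum>k\<in>int_box (m n). c j k * (phase (k \<bullet> \<xi>) * (complex_of_real s * fourier_L2 (\<phi> j) \<xi>)))"
      unfolding h_def B_def dilate_shift_def NMx s_def[symmetric] by (simp add: sum.cartesian_product case_prod_unfold)
    also have "\<dots> = (\<Sum>j<r. p n j \<xi> * fourier_L2 (\<phi> j) \<xi>)"
      unfolding p_def sum_distrib_right by (intro sum.cong refl) (simp add: mult_ac)
    finally show ?thesis .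
  qed
  have "AE \<xi> in lebesgue. \<forall>j\<in>{..<r}. (\<lambda>n. p n j \<xi>) \<longlonglongrightarrow> a j \<xi>"
    using p_lim by (subst AE_ball_countable) auto
  with h_lim have "AE \<xi> in lebesgue. fourier_L2 f (transpose M *v \<xi>) = (\<Sum>j<r. a j \<xi> * fourier_L2 (\<phi> j) \<xi>)"
  proof eventually_elim
    fix \<xi> assume 1: "(\<lambda>n. h n (transpose M *v \<xi>)) \<longlonglongrightarrow> fourier_L2 f (transpose M *v \<xi>)"
      and 2: "\<forall>j\<in>{..<r}. (\<lambda>n. p n j \<xi>) \<longlonglongrightarrow> a j \<xi>"
    have "(\<lambda>n. \<Sum>j<r. p n j \<xi> * fourier_L2 (\<phi> j) \<xi>) \<longlonglongrightarrow> (\<Sum>j<r. a j \<xi> * fourier_L2 (\<phi> j) \<xi>)"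
      using 2 by (intro tendsto_sum tendsto_mult tendsto_const) auto
    with 1 show "fourier_L2 f (transpose M *v \<xi>) = (\<Sum>j<r. a j \<xi> * fourier_L2 (\<phi> j) \<xi>)"
      unfolding hp by (rule LIMSEQ_unique)
  qed
  with a_torus show ?thesis by blast
qed

section \<open>Changing the level of a wavelet system\<close>

lemma matrix_powi_0: "matrix_powi M 0 = mat 1"
  by (simp add: matrix_powi_def)

lemma matrix_powi_1: "matrix_powi M 1 = M"
  by (simp add: matrix_powi_def)

lemma matrix_powi_plus_1:
  assumes M: "invertible M"
  shows "matrix_powi M (j + 1) = M ** matrix_powi M j"
proof (cases "0 \<le> j")
  case True
  then have "nat (j + 1) = Suc (nat j)" by simp
  with True show ?thesis by (simp add: matrix_powi_def)
next
  case False
  then have "nat (- j) = Suc (nat (- (j + 1)))" by simp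
  then have "matrix_powi M j = matrix_inv M ** matrix_powi M (j + 1)"
    using False by (cases "j = -1") (auto simp: matrix_powi_def)
  then show ?thesis by (simp add: matrix_mul_assoc matrix_inv_right[OF M])
qed

lemma matrix_powi_add:
  assumes M: "invertible M"
  shows "matrix_powi M (i + j) = matrix_powi M i ** matrix_powi M j"
proof (induction i rule: int_induct[where k=0])
  case base
  then show ?case by (simp add: matrix_powi_0)
next
  case (step1 i)
  have "matrix_powi M (i + 1 + j) = M ** matrix_powi M (i + j)"
    using matrix_powi_plus_1[OF M, of "i + j"] by (simp add: ac_simps)
  then show ?case by (simp add: step1 matrix_powi_plus_1[OF M] matrix_mul_assoc)
next
  case (step2 i)
  have "M ** matrix_powi M (i - 1 + j) = matrix_powi M (i + j)"
    using matrix_powi_plus_1[OF M, of "i - 1 + j"] by (simp add: ac_simps)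
  also have "\<dots> = M ** (matrix_powi M (i - 1) ** matrix_powi M j)"
    using matrix_powi_plus_1[OF M, of "i - 1"] by (simp add: step2 matrix_mul_assoc)
  finally have "matrix_inv M ** (M ** matrix_powi M (i - 1 + j)) = matrix_inv M ** (M ** (matrix_powi M (i - 1) ** matrix_powi M j))"
    by simp
  then show ?case by (simp only: matrix_mul_assoc matrix_inv_left[OF M] matrix_mul_lid)
qed

lemma invertible_matrix_powi: "invertible M \<Longrightarrow> invertible (matrix_powi M j)"
  using matrix_powi_add[of M j "- j"] matrix_powi_add[of M "- j" j] unfolding invertible_def
  by (auto simp: matrix_powi_0)

text \<open>Dilation by \<open>matrix_powi M (J' - J)\<close> maps the level \<open>J\<close> system onto the level \<open>J'\<close> system, up to
the renumbering \<open>j \<mapsto> j + (J' - J)\<close> of the scales.\<close>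

lemma WS_nonhom_change_level:
  assumes M: "invertible M"
    and B: "orthonormal_basis_L2 (WS_nonhom_index r s J) (WS_nonhom M J \<phi> \<psi>)"
  shows "orthonormal_basis_L2 (WS_nonhom_index r s J') (WS_nonhom M J' \<phi> \<psi>)"
proof -
  define n where "n = J' - J"
  define U where "U = matrix_powi M n"
  define h :: "(nat \<times> (real ^ 'a)) + (int \<times> nat \<times> (real ^ 'a)) \<Rightarrow> (nat \<times> (real ^ 'a)) + (int \<times> nat \<times> (real ^ 'a))"
    where "h = map_sum id (\<lambda>(j, l, k). (j - n, l, k))"
  define h' :: "(nat \<times> (real ^ 'a)) + (int \<times> nat \<times> (real ^ 'a)) \<Rightarrow> (nat \<times> (real ^ 'a)) + (int \<times> nat \<times> (real ^ 'a))"
    where "h' = map_sum id (\<lambda>(j, l, k). (j + n, l, k))"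
  have U: "invertible U" unfolding U_def by (rule invertible_matrix_powi[OF M])
  have bij: "bij_betw h (WS_nonhom_index r s J') (WS_nonhom_index r s J)"
    by (rule bij_betwI[where g=h']) (auto simp: h_def h'_def WS_nonhom_index_def n_def)
  have "orthonormal_basis_L2 (WS_nonhom_index r s J') (\<lambda>i. dilate_shift U 0 (WS_nonhom M J \<phi> \<psi> (h i)))"
    by (rule orthonormal_basis_L2_reindex[OF orthonormal_basis_L2_dilate[OF B U] bij])
  moreover have "dilate_shift U 0 (WS_nonhom M J \<phi> \<psi> (h i)) = WS_nonhom M J' \<phi> \<psi> i" for i
  proof (cases i)
    case (Inl a)
    then show ?thesis using matrix_powi_add[OF M, of J n]
      by (cases a) (simp add: h_def dilate_shift_dilate_shift U_def n_def)
  next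
    case (Inr a)
    obtain j l k where a: "a = (j, l, k)" by (cases a)
    show ?thesis using matrix_powi_add[OF M, of "j - n" n]
      by (simp add: Inr a h_def dilate_shift_dilate_shift U_def)
  qed
  ultimately show ?thesis by simp
qed

section \<open>Orbit counting by Parseval's identity\<close>

lemma has_sum_finite_sum:
  fixes f :: "'i \<Rightarrow> 'a \<Rightarrow> real"
  assumes "\<And>i. i \<in> F \<Longrightarrow> (f i has_sum x i) A"
  shows "((\<lambda>a. \<Sum>i\<in>F. f i a) has_sum (\<Sum>i\<in>F. x i)) A"
  using assms by (induction F rule: infinite_finite_induct) (auto intro!: has_sum_add)

lemma parseval_L2_on_support:
  assumes B: "orthonormal_basis_L2 I e" and f: "f \<in> L2"
    and h: "inj_on h A" "h ` A \<subseteq> I" and z: "\<And>i. i \<in> I - h ` A \<Longrightarrow> L2_inner f (e i) = 0"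
  shows "((\<lambda>a. (cmod (L2_inner f (e (h a))))\<^sup>2) has_sum L2_sqnorm f) A"
proof -
  have "((\<lambda>i. (cmod (L2_inner f (e i)))\<^sup>2) has_sum L2_sqnorm f) (h ` A)"
    using parseval_L2[OF B f] by (subst has_sum_cong_neutral[where T=I and f="\<lambda>i. (cmod (L2_inner f (e i)))\<^sup>2"]) (use h z in auto)
  then show ?thesis by (simp add: has_sum_reindex[OF h(1)] comp_def)
qed

text \<open>The families \<open>g\<close> and \<open>w\<close> represent the orbits of two orthonormal systems with the same closed span
under the integer translations \<open>T\<^sub>n\<close>. The numbers \<open>\<bar>\<langle>g a, T\<^sub>n (w u)\<rangle>\<bar>\<^sup>2\<close> sum up to 1 over \<open>n\<close> and
\<open>u\<close> for fixed \<open>a\<close>. Since translations are unitary, they also sum up to 1 over \<open>n\<close> and \<open>a\<close> for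
fixed \<open>u\<close>. The total is therefore the number of orbits of either kind.\<close>

lemma double_parseval_card:
  fixes g :: "'a \<Rightarrow> real ^ 'd \<Rightarrow> complex" and w :: "'u \<Rightarrow> real ^ 'd \<Rightarrow> complex"
  assumes fin: "finite A" "finite U"
    and L2: "\<And>a. a \<in> A \<Longrightarrow> g a \<in> L2" "\<And>u. u \<in> U \<Longrightarrow> w u \<in> L2"
    and 1: "\<And>a. a \<in> A \<Longrightarrow> ((\<lambda>(n, u). (cmod (L2_inner (g a) (dilate_shift (mat 1) n (w u))))\<^sup>2) has_sum 1) (int_vecs \<times> U)"
    and 2: "\<And>u. u \<in> U \<Longrightarrow> ((\<lambda>(n, a). (cmod (L2_inner (w u) (dilate_shift (mat 1) n (g a))))\<^sup>2) has_sum 1) (int_vecs \<times> A)"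
  shows "card A = card U"
proof -
  define t where "t = (\<lambda>n a u. (cmod (L2_inner (g a) (dilate_shift (mat 1) n (w u))))\<^sup>2)"
  \<comment> \<open>Moving a translation from one factor of an inner product to the other inverts it.\<close>
  have sym: "(cmod (L2_inner (w u) (dilate_shift (mat 1) n (g a))))\<^sup>2 = t (- n) a u" if "a \<in> A" "u \<in> U" for n a u
  proof -
    have "w u = dilate_shift (mat 1) n (dilate_shift (mat 1) (- n) (w u))"
      by (rule ext) (simp add: dilate_shift_def)
    then have "L2_inner (w u) (dilate_shift (mat 1) n (g a)) = L2_inner (dilate_shift (mat 1) (- n) (w u)) (g a)"
      using L2_inner_dilate_shift[OF invertible_mat_1, of "dilate_shift (mat 1) (- n) (w u)" "g a" n] that
      by (metis L2 L2_measurable dilate_shift_measurable invertible_mat_1)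
    also have "cmod \<dots> = cmod (L2_inner (g a) (dilate_shift (mat 1) (- n) (w u)))"
      by (metis L2_inner_cnj complex_mod_cnj)
    finally show ?thesis unfolding t_def by simp
  qed
  have "((\<lambda>p. \<Sum>a\<in>A. case p of (n, u) \<Rightarrow> t n a u) has_sum (\<Sum>a\<in>A. 1)) (int_vecs \<times> U)"
    using 1 by (intro has_sum_finite_sum) (simp_all add: t_def)
  then have "((\<lambda>n. \<Sum>u\<in>U. \<Sum>a\<in>A. t n a u) has_sum (\<Sum>a\<in>A. 1)) int_vecs"
    by (rule has_sum_Sigma'[where b="\<lambda>n. \<Sum>u\<in>U. \<Sum>a\<in>A. t n a u" and B="\<lambda>_. U"]) (rule has_sum_finiteI[OF fin(2)], simp)
  moreover have "((\<lambda>p. \<Sum>u\<in>U. case p of (n, a) \<Rightarrow> (cmod (L2_inner (w u) (dilate_shift (mat 1) n (g a))))\<^sup>2) has_sum (\<Sum>u\<in>U. 1)) (int_vecs \<times> A)"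
    using 2 by (intro has_sum_finite_sum) simp_all
  then have "((\<lambda>n. \<Sum>a\<in>A. \<Sum>u\<in>U. (cmod (L2_inner (w u) (dilate_shift (mat 1) n (g a))))\<^sup>2) has_sum (\<Sum>u\<in>U. 1)) int_vecs"
    by (rule has_sum_Sigma'[where b="\<lambda>n. \<Sum>a\<in>A. \<Sum>u\<in>U. (cmod (L2_inner (w u) (dilate_shift (mat 1) n (g a))))\<^sup>2" and B="\<lambda>_. A"]) (rule has_sum_finiteI[OF fin(1)], simp)
  then have "((\<lambda>n. \<Sum>a\<in>A. \<Sum>u\<in>U. t (- n) a u) has_sum (\<Sum>u\<in>U. 1)) int_vecs"
    by (simp add: sym cong: sum.cong)
  then have "((\<lambda>n. \<Sum>a\<in>A. \<Sum>u\<in>U. t n a u) has_sum (\<Sum>u\<in>U. 1)) int_vecs"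
    by (subst has_sum_reindex_bij_betw[OF bij_betwI[where f=uminus and g=uminus], symmetric, of _ int_vecs])
      (auto simp: int_vecs_uminus)
  then have "((\<lambda>n. \<Sum>u\<in>U. \<Sum>a\<in>A. t n a u) has_sum (\<Sum>u\<in>U. 1)) int_vecs"
    by (subst sum.swap)
  ultimately have "(\<Sum>a\<in>A. 1::real) = (\<Sum>u\<in>U. 1)"
    by (rule has_sum_unique)
  then show ?thesis by simp
qed

section \<open>The index of the dilated lattice\<close>

definition unit_cell :: "(real ^ 'd) set" where
  "unit_cell = {x. \<forall>i. 0 \<le> x $ i \<and> x $ i < 1}"

text \<open>The lattice points in the image of the unit cell. By \<open>coset_decomposition\<close> they represent the
cosets of \<open>M \<int>\<^sup>d\<close> in \<open>\<int>\<^sup>d\<close>.\<close>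

definition coset_reps :: "real ^ 'd ^ 'd \<Rightarrow> (real ^ 'd) set" where
  "coset_reps M = {k \<in> int_vecs. \<exists>x\<in>unit_cell. k = M *v x}"

lemma int_vecs_matrix: "integer_matrix M \<Longrightarrow> n \<in> int_vecs \<Longrightarrow> M *v n \<in> int_vecs"
  by (auto simp: integer_matrix_def int_vecs_def matrix_vector_mult_def intro!: Ints_sum Ints_mult)

lemma unit_cell_decomposition:
  fixes y :: "real ^ 'd"
  obtains n where "n \<in> int_vecs" "y - n \<in> unit_cell"
proof
  let ?n = "\<chi> i. real_of_int \<lfloor>y $ i\<rfloor>"
  show "?n \<in> int_vecs" by (simp add: int_vecs_def)
  show "y - ?n \<in> unit_cell" by (auto simp: unit_cell_def) linarith
qed

lemma unit_cell_unique:
  assumes "n \<in> int_vecs" "n' \<in> int_vecs" "y - n \<in> unit_cell" "y - n' \<in> unit_cell"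
  shows "n = n'"
proof -
  have "n $ i = n' $ i" for i
  proof -
    obtain a b where ab: "n $ i = real_of_int a" "n' $ i = real_of_int b"
      using assms(1,2) by (auto simp: int_vecs_def elim!: Ints_cases) (meson Ints_cases)
    have "0 \<le> y $ i - n $ i" "y $ i - n $ i < 1" "0 \<le> y $ i - n' $ i" "y $ i - n' $ i < 1"
      using assms(3,4) by (auto simp: unit_cell_def)
    then have "a = b" unfolding ab by linarith
    then show ?thesis by (simp add: ab)
  qed
  then show ?thesis by (simp add: vec_eq_iff)
qed

lemma finite_bounded_int_vecs:
  assumes "bounded S"
  shows "finite (S \<inter> (int_vecs :: (real ^ 'd) set))"
proof -
  obtain m where m: "\<And>x. x \<in> S \<Longrightarrow> norm x \<le> real m"
    using assms unfolding bounded_iff by (meson order_trans real_arch_simple)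
  have "S \<inter> int_vecs \<subseteq> int_box m"
    using m component_le_norm_cart order_trans by (fastforce simp: int_box_def)
  then show ?thesis using finite_int_box finite_subset by blast
qed

lemma bounded_unit_cell: "bounded (unit_cell :: (real ^ 'd) set)"
proof -
  have "unit_cell \<subseteq> cbox 0 (\<chi> i. (1::real))"
    by (auto simp: unit_cell_def mem_box_cart less_imp_le)
  then show ?thesis using bounded_subset bounded_cbox by blast
qed

lemma finite_coset_reps: "finite (coset_reps M)"
proof -
  have "bounded ((*v) M ` unit_cell)"
    by (intro bounded_linear_image bounded_unit_cell) simp
  then have "finite ((*v) M ` unit_cell \<inter> int_vecs)" by (rule finite_bounded_int_vecs)
  then show ?thesis by (rule rev_finite_subset) (auto simp: coset_reps_def)
qed

text \<open>Split the inverse image of a lattice point under \<open>M\<close> into its integral and its fractional part.\<close>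

lemma coset_decomposition:
  fixes M :: "real ^ 'd ^ 'd"
  assumes M: "invertible M" and int: "integer_matrix M"
  shows "bij_betw (\<lambda>(n, k). k + M *v n) (int_vecs \<times> coset_reps M) int_vecs"
proof (rule bij_betw_imageI)
  have MM: "M *v (matrix_inv M *v x) = x" "matrix_inv M *v (M *v x) = x" for x
    by (simp_all add: matrix_vector_mul_assoc matrix_inv_right[OF M] matrix_inv_left[OF M])
  show "inj_on (\<lambda>(n, k). k + M *v n) (int_vecs \<times> coset_reps M)"
  proof (rule inj_onI, clarify)
    fix n k n' k' assume n: "n \<in> int_vecs" "n' \<in> int_vecs" and k: "k \<in> coset_reps M" "k' \<in> coset_reps M"
      and eq: "k + M *v n = k' + M *v n'"
    from k obtain x x' where x: "x \<in> unit_cell" "k = M *v x" "x' \<in> unit_cell" "k' = M *v x'"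
      by (auto simp: coset_reps_def)
    have "M *v (x + n) = M *v (x' + n')" using eq x by (simp add: matrix_vector_right_distrib)
    then have e: "x + n = x' + n'" by (metis MM(2))
    have "(x + n) - n \<in> unit_cell" using x by simp
    moreover have "(x + n) - n' \<in> unit_cell" unfolding e using x by simp
    ultimately have "n = n'" using unit_cell_unique n by blast
    with eq show "n = n' \<and> k = k'" by simp
  qed
  show "(\<lambda>(n, k). k + M *v n) ` (int_vecs \<times> coset_reps M) = int_vecs"
  proof (intro equalityI subsetI)
    fix k :: "real ^ 'd" assume k: "k \<in> int_vecs"
    obtain n where n: "n \<in> int_vecs" "matrix_inv M *v k - n \<in> unit_cell" by (rule unit_cell_decomposition)
    have "k - M *v n = M *v (matrix_inv M *v k - n)" by (simp add: matrix_vector_mult_diff_distrib MM)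
    moreover have "k - M *v n \<in> int_vecs" by (intro int_vecs_diff k int_vecs_matrix[OF int] n(1))
    ultimately have "k - M *v n \<in> coset_reps M"
      using n(2) unfolding coset_reps_def by blast
    with n(1) show "k \<in> (\<lambda>(n, k). k + M *v n) ` (int_vecs \<times> coset_reps M)"
      by (intro image_eqI[of _ _ "(n, k - M *v n)"]) auto
  qed (auto simp: coset_reps_def intro!: int_vecs_add int_vecs_matrix[OF int])
qed

lemma unit_cell_sets: "unit_cell \<in> sets (borel :: (real ^ 'd) measure)"
proof -
  have "(unit_cell :: (real ^ 'd) set) = (\<lambda>x. (2 * pi) *\<^sub>R x - (\<chi> i. pi)) -` torus_cell \<inter> space borel"
  proof -
    have "0 \<le> t \<longleftrightarrow> - pi \<le> 2 * pi * t - pi" "t < 1 \<longleftrightarrow> 2 * pi * t - pi < pi" for t :: real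
      by (auto simp: zero_le_mult_iff linorder_not_le[THEN iffD2, OF pi_gt_zero])
    then have "x \<in> unit_cell \<longleftrightarrow> (\<forall>i. - pi \<le> 2 * pi * x $ i - pi \<and> 2 * pi * x $ i - pi < pi)" for x :: "real ^ 'd"
      unfolding unit_cell_def mem_Collect_eq by (simp only:)
    then show ?thesis by (auto simp: torus_cell_def)
  qed
  also have "\<dots> \<in> sets borel"
    by (rule measurable_sets[OF _ torus_cell_sets]) (intro borel_measurable_continuous_onI continuous_intros)
  finally show ?thesis .
qed

lemma emeasure_unit_cell: "emeasure lebesgue (unit_cell :: (real ^ 'd) set) = 1"
proof -
  let ?o = "\<chi> i. (1::real)"
  have sub: "box 0 ?o \<subseteq> (unit_cell :: (real ^ 'd) set)" "(unit_cell :: (real ^ 'd) set) \<subseteq> cbox 0 ?o"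
    by (auto simp: unit_cell_def mem_box_cart less_imp_le)
  have o: "0 \<bullet> b \<le> ?o \<bullet> b" "(?o - 0) \<bullet> b = 1" if "b \<in> Basis" for b :: "real ^ 'd"
    using that by (auto simp: Basis_cart inner_axis)
  have "emeasure lborel (box 0 ?o :: (real ^ 'd) set) = 1" "emeasure lborel (cbox 0 ?o :: (real ^ 'd) set) = 1"
    using emeasure_lborel_box[OF o(1)] emeasure_lborel_cbox[OF o(1)] o(2) by simp_all
  then have "1 \<le> emeasure lborel (unit_cell :: (real ^ 'd) set)" "emeasure lborel (unit_cell :: (real ^ 'd) set) \<le> 1"
    using emeasure_mono[OF sub(1), of lborel] emeasure_mono[OF sub(2), of lborel] unit_cell_sets by simp_all
  then have "emeasure lborel (unit_cell :: (real ^ 'd) set) = 1" by (rule antisym[rotated])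
  then have "(\<integral>\<^sup>+x. indicator (unit_cell :: (real ^ 'd) set) x \<partial>lborel) = 1" by (simp add: unit_cell_sets)
  then have "(\<integral>\<^sup>+x. indicator (unit_cell :: (real ^ 'd) set) x \<partial>lebesgue) = 1" by (simp only: nn_integral_completion)
  moreover have "unit_cell \<in> sets (lebesgue :: (real ^ 'd) measure)"
    by (intro sets_completionI_sets) (simp add: unit_cell_sets)
  ultimately show ?thesis by (simp only: nn_integral_indicator)
qed

text \<open>The parallelepiped \<open>P\<close>, the image of the unit cell under \<open>M\<close>, has volume \<open>\<bar>det M\<bar>\<close> and
is a fundamental domain of \<open>M \<int>\<^sup>d\<close>. Cut \<open>P\<close> along the integer translates of the unit cell. The
pieces whose index lies in one fixed coset, translated by elements of \<open>M \<int>\<^sup>d\<close>, fill a single unit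
cell, so every coset contributes volume 1.\<close>

lemma card_coset_reps:
  fixes M :: "real ^ 'd ^ 'd"
  assumes M: "invertible M" and int: "integer_matrix M"
  shows "real (card (coset_reps M)) = \<bar>det M\<bar>"
proof -
  have MM: "M *v (matrix_inv M *v x) = x" "matrix_inv M *v (M *v x) = x" for x
    by (simp_all add: matrix_vector_mul_assoc matrix_inv_right[OF M] matrix_inv_left[OF M])
  define P where "P = {y. matrix_inv M *v y \<in> unit_cell}"
  let ?Q = "unit_cell :: (real ^ 'd) set"
  have Q: "?Q \<in> sets lebesgue" using unit_cell_sets by (intro sets_completionI_sets) simp
  have "(\<lambda>y. matrix_inv M *v y - 0) -` ?Q \<inter> space lebesgue \<in> sets lebesgue"
    by (rule measurable_sets[OF measurable_matrix_affine[OF invertible_matrix_inv[OF M]] Q])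
  then have P: "P \<in> sets lebesgue" by (simp add: P_def vimage_def)
  have "emeasure lebesgue P = ennreal \<bar>det M\<bar> * (\<integral>\<^sup>+x. indicator P (M *v x - 0) \<partial>lebesgue)"
    using nn_integral_matrix_affine[OF M, of "indicator P" 0] P by simp
  also have "(\<integral>\<^sup>+x. indicator P (M *v x - 0) \<partial>lebesgue) = (\<integral>\<^sup>+x. indicator ?Q x \<partial>lebesgue)"
    by (intro nn_integral_cong) (auto simp: indicator_def P_def MM)
  also have "\<dots> = 1" by (simp only: nn_integral_indicator[OF Q] emeasure_unit_cell)
  finally have eP: "emeasure lebesgue P = ennreal \<bar>det M\<bar>" by simp
  \<comment> \<open>\<open>D k n\<close> is the piece of \<open>P\<close> in the unit cell with index \<open>k + M n\<close>. Its translate \<open>D' k n\<close> is the part of the unit cell with index \<open>k\<close> that lies in the translate of \<open>P\<close> by \<open>- M n\<close>.\<close>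
  define D where "D = (\<lambda>k n. {y \<in> P. y - (k + M *v n) \<in> ?Q})"
  define D' where "D' = (\<lambda>k n. {y. y - k \<in> ?Q \<and> y + M *v n \<in> P})"
  have Dm: "D k n \<in> sets lebesgue" for k n
    unfolding D_def using P lebesgue_sets_translate[OF Q, of "k + M *v n"] by (simp add: Collect_conj_eq)
  have D'm: "D' k n \<in> sets lebesgue" for k n
    unfolding D'_def using lebesgue_sets_translate[OF Q, of k] lebesgue_sets_translate[OF P, of "- (M *v n)"] by (simp add: Collect_conj_eq)
  have DD': "emeasure lebesgue (D k n) = emeasure lebesgue (D' k n)" for k n
  proof -
    have "D k n = {y. y - M *v n \<in> D' k n}" by (auto simp: D_def D'_def algebra_simps)
    then show ?thesis using emeasure_lebesgue_translate[OF D'm] by simp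
  qed
  note bij = coset_decomposition[OF M int]
  have inj: "k = k' \<and> n = n'" if "k \<in> coset_reps M" "k' \<in> coset_reps M" "n \<in> int_vecs" "n' \<in> int_vecs" "k + M *v n = k' + M *v n'" for k k' n n'
    using bij_betw_imp_inj_on[OF bij] that unfolding inj_on_def by fastforce
  have repr: "k + M *v n \<in> int_vecs" if "k \<in> coset_reps M" "n \<in> int_vecs" for k n
    using that by (auto simp: coset_reps_def intro!: int_vecs_add int_vecs_matrix[OF int])
  have disj: "k = k' \<and> n = n'" if "y \<in> D k n" "y \<in> D k' n'" "k \<in> coset_reps M" "k' \<in> coset_reps M" "n \<in> int_vecs" "n' \<in> int_vecs" for k k' n n' y
  proof -
    have "k + M *v n = k' + M *v n'"
      using that by (intro unit_cell_unique[of _ _ y] repr) (auto simp: D_def)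
    then show ?thesis using inj that by blast
  qed
  have P_eq: "P = (\<Union>k\<in>coset_reps M. \<Union>n\<in>int_vecs. D k n)"
  proof (intro equalityI subsetI)
    fix y assume y: "y \<in> P"
    obtain q where q: "q \<in> int_vecs" "y - q \<in> ?Q" by (rule unit_cell_decomposition)
    then have "q \<in> (\<lambda>(n, k). k + M *v n) ` (int_vecs \<times> coset_reps M)"
      using bij by (simp add: bij_betw_def)
    then obtain n k where "n \<in> int_vecs" "k \<in> coset_reps M" "q = k + M *v n" by auto
    with q y show "y \<in> (\<Union>k\<in>coset_reps M. \<Union>n\<in>int_vecs. D k n)" by (auto simp: D_def)
  qed (auto simp: D_def)
  have col: "emeasure lebesgue (\<Union>n\<in>int_vecs. D k n) = 1" if k: "k \<in> coset_reps M" for k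
  proof -
    have "emeasure lebesgue (\<Union>n\<in>int_vecs. D k n) = (\<integral>\<^sup>+n. emeasure lebesgue (D k n) \<partial>count_space int_vecs)"
      using disj k by (intro emeasure_UN_countable countable_int_vecs Dm) (auto simp: disjoint_family_on_def)
    also have "\<dots> = (\<integral>\<^sup>+n. emeasure lebesgue (D' k n) \<partial>count_space int_vecs)"
      by (simp add: DD')
    also have "\<dots> = emeasure lebesgue (\<Union>n\<in>int_vecs. D' k n)"
    proof (rule emeasure_UN_countable[symmetric, OF D'm countable_int_vecs])
      have "n = n'" if "y + M *v n \<in> P" "y + M *v n' \<in> P" "n \<in> int_vecs" "n' \<in> int_vecs" for y n n'
      proof -
        have "matrix_inv M *v y + n \<in> ?Q" "matrix_inv M *v y + n' \<in> ?Q"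
          using that by (simp_all add: P_def matrix_vector_right_distrib MM)
        then have "- n = - n'" using that
          by (intro unit_cell_unique[of _ _ "matrix_inv M *v y"] int_vecs_uminus) auto
        then show ?thesis by simp
      qed
      then show "disjoint_family_on (D' k) int_vecs" unfolding disjoint_family_on_def D'_def by blast
    qed
    also have "(\<Union>n\<in>int_vecs. D' k n) = {y. y - k \<in> ?Q}"
    proof (intro equalityI subsetI)
      fix y assume y: "y \<in> {y. y - k \<in> ?Q}"
      obtain n where n: "n \<in> int_vecs" "matrix_inv M *v y - n \<in> ?Q" by (rule unit_cell_decomposition)
      then have "y + M *v (- n) \<in> P" unfolding P_def mem_Collect_eq matrix_vector_right_distrib MM by simp
      with y n show "y \<in> (\<Union>n\<in>int_vecs. D' k n)" unfolding D'_def using int_vecs_uminus by blast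
    qed (auto simp: D'_def)
    also have "emeasure lebesgue {y. y - k \<in> ?Q} = 1"
      by (simp only: emeasure_lebesgue_translate[OF Q] emeasure_unit_cell)
    finally show ?thesis .
  qed
  have "emeasure lebesgue P = (\<Sum>k\<in>coset_reps M. emeasure lebesgue (\<Union>n\<in>int_vecs. D k n))"
    unfolding P_eq
  proof (rule sum_emeasure[symmetric])
    show "(\<lambda>k. \<Union>n\<in>int_vecs. D k n) ` coset_reps M \<subseteq> sets lebesgue"
      using Dm countable_int_vecs by (auto intro!: sets.countable_UN')
    show "disjoint_family_on (\<lambda>k. \<Union>n\<in>int_vecs. D k n) (coset_reps M)"
      using disj unfolding disjoint_family_on_def by blast
  qed (rule finite_coset_reps)
  also have "\<dots> = ennreal (real (card (coset_reps M)))"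
    by (simp add: col ennreal_of_nat_eq_real_of_nat)
  finally have "ennreal \<bar>det M\<bar> = ennreal (real (card (coset_reps M)))" using eP by simp
  then show ?thesis by simp
qed

section \<open>Comparing levels zero and one\<close>

context
  fixes M :: "real ^ 'd ^ 'd" and \<phi> \<psi> :: "nat \<Rightarrow> real ^ 'd \<Rightarrow> complex" and r s :: nat
  assumes M: "invertible M" and \<phi>: "\<And>l. l < r \<Longrightarrow> \<phi> l \<in> L2" and \<psi>: "\<And>l. l < s \<Longrightarrow> \<psi> l \<in> L2"
    and B0: "orthonormal_basis_L2 (WS_nonhom_index r s 0) (WS_nonhom M 0 \<phi> \<psi>)"
    and B1: "orthonormal_basis_L2 (WS_nonhom_index r s 1) (WS_nonhom M 1 \<phi> \<psi>)"
begin

text \<open>A function orthogonal to all wavelets of scales \<open>j \<ge> 1\<close> has only \<open>\<phi>\<close>-coefficients at level one.\<close>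

lemma parseval_level_one:
  assumes f: "f \<in> L2"
    and z: "\<And>j l k. 1 \<le> j \<Longrightarrow> l < s \<Longrightarrow> k \<in> int_vecs \<Longrightarrow> L2_inner f (dilate_shift (matrix_powi M j) k (\<psi> l)) = 0"
  shows "((\<lambda>(l, k). (cmod (L2_inner f (dilate_shift M k (\<phi> l))))\<^sup>2) has_sum L2_sqnorm f) ({..<r} \<times> int_vecs)"
proof -
  have "((\<lambda>p. (cmod (L2_inner f (WS_nonhom M 1 \<phi> \<psi> (Inl p))))\<^sup>2) has_sum L2_sqnorm f) ({..<r} \<times> int_vecs)"
  proof (rule parseval_L2_on_support[OF B1 f])
    fix i assume "i \<in> WS_nonhom_index r s 1 - Inl ` ({..<r} \<times> (int_vecs :: (real ^ 'd) set))"
    then obtain j l k where "i = Inr (j, l, k)" "1 \<le> j" "l < s" "k \<in> int_vecs"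
      by (auto simp: WS_nonhom_index_def)
    then show "L2_inner f (WS_nonhom M 1 \<phi> \<psi> i) = 0" using z by simp
  qed (auto simp: WS_nonhom_index_def)
  moreover have "(\<lambda>p. (cmod (L2_inner f (WS_nonhom M 1 \<phi> \<psi> (Inl p))))\<^sup>2) = (\<lambda>(l, k). (cmod (L2_inner f (dilate_shift M k (\<phi> l))))\<^sup>2)"
    by (rule ext) (auto simp: matrix_powi_1 split: prod.split)
  ultimately show ?thesis by simp
qed

text \<open>At level zero such a function also has coefficients against the wavelets of scale \<open>j = 0\<close>, which
are the integer translates of the \<open>\<psi> l\<close>.\<close>

lemma parseval_level_zero:
  assumes f: "f \<in> L2"
    and z: "\<And>j l k. 1 \<le> j \<Longrightarrow> l < s \<Longrightarrow> k \<in> int_vecs \<Longrightarrow> L2_inner f (dilate_shift (matrix_powi M j) k (\<psi> l)) = 0"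
  shows "((\<lambda>(n, a). (cmod (L2_inner f (dilate_shift (mat 1) n (case_sum \<phi> \<psi> a))))\<^sup>2) has_sum L2_sqnorm f) (int_vecs \<times> ({..<r} <+> {..<s}))"
proof -
  define h :: "(real ^ 'd) \<times> (nat + nat) \<Rightarrow> (nat \<times> (real ^ 'd)) + (int \<times> nat \<times> (real ^ 'd))"
    where "h = (\<lambda>(n, a). case a of Inl l \<Rightarrow> Inl (l, n) | Inr l \<Rightarrow> Inr (0, l, n))"
  have hW: "WS_nonhom M 0 \<phi> \<psi> (h (n, a)) = dilate_shift (mat 1) n (case_sum \<phi> \<psi> a)" for n a
    by (cases a) (auto simp: h_def matrix_powi_0)
  have "((\<lambda>p. (cmod (L2_inner f (WS_nonhom M 0 \<phi> \<psi> (h p))))\<^sup>2) has_sum L2_sqnorm f) (int_vecs \<times> ({..<r} <+> {..<s}))"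
  proof (rule parseval_L2_on_support[OF B0 f])
    show "inj_on h (int_vecs \<times> ({..<r} <+> {..<s}))" by (auto simp: inj_on_def h_def)
    show "h ` (int_vecs \<times> ({..<r} <+> {..<s})) \<subseteq> WS_nonhom_index r s 0" by (auto simp: h_def WS_nonhom_index_def)
    fix i assume i: "i \<in> WS_nonhom_index r s 0 - h ` (int_vecs \<times> ({..<r} <+> {..<s}))"
    show "L2_inner f (WS_nonhom M 0 \<phi> \<psi> i) = 0"
    proof (cases i)
      case (Inl p)
      then obtain l k where "i = Inl (l, k)" by (cases p) auto
      moreover then have "i = h (k, Inl l)" by (simp add: h_def)
      ultimately show ?thesis using i by (force simp: WS_nonhom_index_def)
    next
      case (Inr p)
      then obtain j l k where p: "i = Inr (j, l, k)" by (cases p) auto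
      have "j \<noteq> 0"
      proof
        assume "j = 0"
        then have "i = h (k, Inr l)" using p by (simp add: h_def)
        with i p show False by (force simp: WS_nonhom_index_def)
      qed
      with i p have "1 \<le> j" "l < s" "k \<in> int_vecs" by (auto simp: WS_nonhom_index_def)
      then show ?thesis using z p by simp
    qed
  qed
  moreover have "(\<lambda>p. (cmod (L2_inner f (WS_nonhom M 0 \<phi> \<psi> (h p))))\<^sup>2) = (\<lambda>(n, a). (cmod (L2_inner f (dilate_shift (mat 1) n (case_sum \<phi> \<psi> a))))\<^sup>2)"
    by (rule ext) (auto simp: hW split: prod.split)
  ultimately show ?thesis by simp
qed

lemma level_zero_orthogonal:
  assumes a: "a \<in> {..<r} <+> {..<s}" and j: "1 \<le> j" and l: "l < s" and k: "k \<in> int_vecs"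
  shows "L2_inner (case_sum \<phi> \<psi> a) (dilate_shift (matrix_powi M j) k (\<psi> l)) = 0"
proof -
  define i :: "(nat \<times> (real ^ 'd)) + (int \<times> nat \<times> (real ^ 'd))"
    where "i = (case a of Inl l \<Rightarrow> Inl (l, 0) | Inr l \<Rightarrow> Inr (0, l, 0))"
  have i: "i \<in> WS_nonhom_index r s 0" "i \<noteq> Inr (j, l, k)" "Inr (j, l, k) \<in> WS_nonhom_index r s 0"
    using a j l k by (auto simp: i_def WS_nonhom_index_def int_vecs_zero)
  have "WS_nonhom M 0 \<phi> \<psi> i = case_sum \<phi> \<psi> a"
    by (cases a) (auto simp: i_def matrix_powi_0 dilate_shift_id)
  moreover have "L2_inner (WS_nonhom M 0 \<phi> \<psi> i) (WS_nonhom M 0 \<phi> \<psi> (Inr (j, l, k))) = 0"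
    using orthonormal_basis_L2_inner[OF B0 i(1,3)] i(2) by simp
  ultimately show ?thesis by simp
qed

lemma level_zero_normalized:
  assumes a: "a \<in> {..<r} <+> {..<s}"
  shows "case_sum \<phi> \<psi> a \<in> L2" "L2_sqnorm (case_sum \<phi> \<psi> a) = 1"
proof -
  define i :: "(nat \<times> (real ^ 'd)) + (int \<times> nat \<times> (real ^ 'd))"
    where "i = (case a of Inl l \<Rightarrow> Inl (l, 0) | Inr l \<Rightarrow> Inr (0, l, 0))"
  have i: "i \<in> WS_nonhom_index r s 0"
    using a by (auto simp: i_def WS_nonhom_index_def int_vecs_zero)
  have "WS_nonhom M 0 \<phi> \<psi> i = case_sum \<phi> \<psi> a"
    by (cases a) (auto simp: i_def matrix_powi_0 dilate_shift_id)
  then have "L2_inner (case_sum \<phi> \<psi> a) (case_sum \<phi> \<psi> a) = 1"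
    using orthonormal_basis_L2_inner[OF B0 i i] by simp
  then show "L2_sqnorm (case_sum \<phi> \<psi> a) = 1" unfolding L2_inner_self by simp
  show "case_sum \<phi> \<psi> a \<in> L2" using a \<phi> \<psi> by (auto simp:)
qed

lemma level_one_orthonormal: "orthonormal_L2 ({..<r} \<times> int_vecs) (\<lambda>(l, k). dilate_shift M k (\<phi> l))"
proof -
  have "L2_inner (WS_nonhom M 1 \<phi> \<psi> (Inl p)) (WS_nonhom M 1 \<phi> \<psi> (Inl q)) = (if p = q then 1 else 0)"
    "WS_nonhom M 1 \<phi> \<psi> (Inl p) \<in> L2"
    if "p \<in> {..<r} \<times> int_vecs" "q \<in> {..<r} \<times> int_vecs" for p q
  proof -
    have "Inl p \<in> WS_nonhom_index r s 1" "Inl q \<in> WS_nonhom_index r s 1"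
      using that by (auto simp: WS_nonhom_index_def)
    then show "L2_inner (WS_nonhom M 1 \<phi> \<psi> (Inl p)) (WS_nonhom M 1 \<phi> \<psi> (Inl q)) = (if p = q then 1 else 0)"
      "WS_nonhom M 1 \<phi> \<psi> (Inl p) \<in> L2"
      using orthonormal_basis_L2_inner[OF B1] orthonormal_basis_L2_in_L2[OF B1] by simp_all
  qed
  then show ?thesis unfolding orthonormal_L2_def by (auto simp: matrix_powi_1)
qed

lemma refinement_masks:
  assumes a: "a \<in> {..<r} <+> {..<s}"
  shows "\<exists>m. (\<forall>j<r. m j \<in> L2_torus) \<and>
    (AE \<xi> in lebesgue. fourier_L2 (case_sum \<phi> \<psi> a) (transpose M *v \<xi>) = (\<Sum>j<r. m j \<xi> * fourier_L2 (\<phi> j) \<xi>))"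
  using refinement_mask[OF M \<phi> level_one_orthonormal level_zero_normalized(1)[OF a]
      parseval_level_one[OF level_zero_normalized(1)[OF a] level_zero_orthogonal[OF a]]] by simp

text \<open>The orbits of the level one system under integer translations are represented by the functions
\<open>dilate_shift M \<rho> (\<phi> l)\<close> with \<open>\<rho>\<close> in \<open>coset_reps M\<close>.\<close>

lemma generator_count:
  assumes int: "integer_matrix M"
  shows "real s = real r * (\<bar>det M\<bar> - 1)"
proof -
  let ?A = "{..<r} <+> {..<s}" and ?U = "{..<r} \<times> coset_reps M"
  define w where "w = (\<lambda>(l, \<rho>). dilate_shift M \<rho> (\<phi> l))"
  have w_shift: "dilate_shift (mat 1) n (w (l, \<rho>)) = dilate_shift M (\<rho> + M *v n) (\<phi> l)" for n l \<rho>
    by (simp add: w_def dilate_shift_translate)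
  have U: "(l, \<rho>) \<in> {..<r} \<times> int_vecs" if "(l, \<rho>) \<in> ?U" for l \<rho>
    using that by (auto simp: coset_reps_def)
  have w: "w u \<in> L2" "L2_sqnorm (w u) = 1" if u: "u \<in> ?U" for u
  proof -
    obtain l \<rho> where [simp]: "u = (l, \<rho>)" by (cases u)
    show "w u \<in> L2" using u \<phi> by (auto simp: w_def intro!: L2_dilate_shift M)
    have "L2_inner (w u) (w u) = 1"
      using level_one_orthonormal U u unfolding orthonormal_L2_def w_def by auto
    then show "L2_sqnorm (w u) = 1" unfolding L2_inner_self by simp
  qed
  have bij: "bij_betw (\<lambda>(n, l, \<rho>). (l, \<rho> + M *v n)) (int_vecs \<times> ?U) ({..<r} \<times> int_vecs)"
  proof -
    note b = coset_decomposition[OF M int]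
    have "(l, \<rho> + M *v n) \<in> {..<r} \<times> int_vecs" if "n \<in> int_vecs" "(l, \<rho>) \<in> ?U" for n l \<rho>
      using that b by (auto simp: coset_reps_def intro!: int_vecs_add int_vecs_matrix[OF int])
    moreover have "\<exists>n \<rho>. n \<in> int_vecs \<and> \<rho> \<in> coset_reps M \<and> k = \<rho> + M *v n" if "k \<in> int_vecs" for k
      using that b unfolding bij_betw_def by (force simp: image_iff)
    ultimately have "(\<lambda>(n, l, \<rho>). (l, \<rho> + M *v n)) ` (int_vecs \<times> ?U) = {..<r} \<times> int_vecs"
      by (force simp: image_iff)
    moreover have "inj_on (\<lambda>(n, l, \<rho>). (l, \<rho> + M *v n)) (int_vecs \<times> ?U)"
      using bij_betw_imp_inj_on[OF b] by (auto simp: inj_on_def)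
    ultimately show ?thesis by (simp add: bij_betw_def)
  qed
  have "card ?A = card ?U"
  proof (rule double_parseval_card[where g="case_sum \<phi> \<psi>" and w=w])
    show "finite ?A" "finite ?U" by (auto simp: finite_coset_reps)
    show "case_sum \<phi> \<psi> a \<in> L2" if "a \<in> ?A" for a by (rule level_zero_normalized(1)[OF that])
    show "w u \<in> L2" if "u \<in> ?U" for u by (rule w(1)[OF that])
  next
    fix a assume a: "a \<in> ?A"
    note g = level_zero_normalized[OF a]
    have "((\<lambda>(l, k). (cmod (L2_inner (case_sum \<phi> \<psi> a) (dilate_shift M k (\<phi> l))))\<^sup>2) has_sum 1) ({..<r} \<times> int_vecs)"
      using parseval_level_one[OF g(1) level_zero_orthogonal[OF a]] unfolding g(2) .
    then have "((\<lambda>p. case (case p of (n, l, \<rho>) \<Rightarrow> (l, \<rho> + M *v n)) of (l, k) \<Rightarrow> (cmod (L2_inner (case_sum \<phi> \<psi> a) (dilate_shift M k (\<phi> l))))\<^sup>2) has_sum 1) (int_vecs \<times> ?U)"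
      by (subst has_sum_reindex_bij_betw[OF bij])
    then show "((\<lambda>(n, u). (cmod (L2_inner (case_sum \<phi> \<psi> a) (dilate_shift (mat 1) n (w u))))\<^sup>2) has_sum 1) (int_vecs \<times> ?U)"
      by (rule has_sum_cong[THEN iffD1, rotated]) (auto simp: w_shift)
  next
    fix u assume u: "u \<in> ?U"
    obtain l' \<rho> where u': "u = (l', \<rho>)" by (cases u)
    have "L2_inner (w u) (dilate_shift (matrix_powi M j) k (\<psi> l)) = 0" if "1 \<le> j" "l < s" "k \<in> int_vecs" for j l k
    proof -
      have "Inl (l', \<rho>) \<in> WS_nonhom_index r s 1" "Inr (j, l, k) \<in> WS_nonhom_index r s 1"
        using u that U[of l' \<rho>] by (auto simp: WS_nonhom_index_def u')
      then have "L2_inner (WS_nonhom M 1 \<phi> \<psi> (Inl (l', \<rho>))) (WS_nonhom M 1 \<phi> \<psi> (Inr (j, l, k))) = 0"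
        using orthonormal_basis_L2_inner[OF B1] by (simp del: WS_nonhom.simps)
      then show ?thesis by (simp add: w_def u' matrix_powi_1)
    qed
    from parseval_level_zero[OF w(1)[OF u] this]
    show "((\<lambda>(n, a). (cmod (L2_inner (w u) (dilate_shift (mat 1) n (case_sum \<phi> \<psi> a))))\<^sup>2) has_sum 1) (int_vecs \<times> ?A)"
      unfolding w(2)[OF u] .
  qed
  then have "r + s = r * card (coset_reps M)"
    by (simp add: card_Plus card_cartesian_product)
  then have "real r + real s = real r * \<bar>det M\<bar>"
    unfolding card_coset_reps[OF M int, symmetric] by (metis of_nat_add of_nat_mult)
  then show ?thesis by (simp add: algebra_simps)
qed

end

section \<open>Powers of the inverse of an expansive matrix\<close>

text \<open>From the moment when \<open>e\<close> stays below \<open>\<epsilon> * (1 - \<rho>) / 2\<close>, the sequence is dominated by a geometric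
sequence plus the fixed point \<open>\<epsilon> / 2\<close> of the perturbed recursion.\<close>

lemma perturbed_geometric_tendsto_0:
  fixes x e :: "nat \<Rightarrow> real"
  assumes \<rho>: "0 \<le> \<rho>" "\<rho> < 1" and x: "\<And>m. 0 \<le> x m" and e: "e \<longlonglongrightarrow> 0"
    and step: "\<And>m. x (Suc m) \<le> \<rho> * x m + e m"
  shows "x \<longlonglongrightarrow> 0"
proof (rule LIMSEQ_I)
  fix \<epsilon> :: real assume \<epsilon>: "0 < \<epsilon>"
  define \<eta> where "\<eta> = \<epsilon> * (1 - \<rho>) / 2"
  have "\<eta> > 0" using \<epsilon> \<rho> by (simp add: \<eta>_def)
  with e have "eventually (\<lambda>m. e m < \<eta>) sequentially" by (rule order_tendstoD)
  then obtain N where N: "\<And>m. m \<ge> N \<Longrightarrow> e m < \<eta>" by (auto simp: eventually_sequentially)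
  have bd: "x (N + k) \<le> \<rho> ^ k * x N + \<epsilon> / 2" for k
  proof (induction k)
    case 0
    then show ?case using \<epsilon> by simp
  next
    case (Suc k)
    have "x (N + Suc k) \<le> \<rho> * x (N + k) + \<eta>" using step[of "N + k"] N[of "N + k"] by simp
    also have "\<dots> \<le> \<rho> * (\<rho> ^ k * x N + \<epsilon> / 2) + \<eta>" using Suc \<rho> by (simp add: mult_left_mono)
    also have "\<dots> = \<rho> ^ Suc k * x N + \<epsilon> / 2" by (simp add: \<eta>_def field_simps)
    finally show ?case .
  qed
  have "(\<lambda>k. \<rho> ^ k * x N) \<longlonglongrightarrow> 0" using tendsto_mult_right[OF LIMSEQ_power_zero[of \<rho>], of "x N"] \<rho> by simp
  then have "eventually (\<lambda>k. \<rho> ^ k * x N < \<epsilon> / 2) sequentially" using \<epsilon> by (intro order_tendstoD) auto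
  then obtain K where K: "\<And>k. k \<ge> K \<Longrightarrow> \<rho> ^ k * x N < \<epsilon> / 2" by (auto simp: eventually_sequentially)
  show "\<exists>no. \<forall>n\<ge>no. norm (x n - 0) < \<epsilon>"
  proof (intro exI[of _ "N + K"] allI impI)
    fix n assume "N + K \<le> n"
    then obtain k where "n = N + k" "k \<ge> K" by (metis add.assoc le_Suc_ex le_add1)
    then show "norm (x n - 0) < \<epsilon>" using bd[of k] K[of k] x[of n] by simp
  qed
qed

text \<open>The vector \<open>p(A) v\<close>.\<close>

definition poly_apply :: "complex poly \<Rightarrow> complex ^ 'n ^ 'n \<Rightarrow> complex ^ 'n \<Rightarrow> complex ^ 'n" where
  "poly_apply p A v = (\<Sum>i\<le>degree p. coeff p i *s (((*v) A ^^ i) v))"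

lemma poly_apply_bound:
  assumes "degree p \<le> n"
  shows "poly_apply p A v = (\<Sum>i\<le>n. coeff p i *s (((*v) A ^^ i) v))"
  unfolding poly_apply_def using assms by (intro sum.mono_neutral_left) (auto simp: coeff_eq_0)

lemma poly_apply_linear_factor:
  "poly_apply ([:- c, 1:] * q) A v = poly_apply q A (A *v v - c *s v)"
proof -
  let ?T = "(*v) A" and ?n = "degree q"
  have lin: "(?T ^^ i) (A *v v - c *s v) = (?T ^^ Suc i) v - c *s (?T ^^ i) v" for i
  proof (induction i)
    case (Suc i)
    then show ?case by (simp add: matrix_vector_mult_diff_distrib vector_scalar_commute)
  qed simp
  have "degree ([:- c, 1:] * q) \<le> Suc ?n"
    using degree_mult_le[of "[:- c, 1:]" q] by simp
  then have "poly_apply ([:- c, 1:] * q) A v = (\<Sum>i\<le>Suc ?n. coeff ([:- c, 1:] * q) i *s ((?T ^^ i) v))"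
    by (rule poly_apply_bound)
  also have "\<dots> = (\<Sum>i\<le>Suc ?n. coeff (pCons 0 q) i *s ((?T ^^ i) v) - c *s (coeff q i *s ((?T ^^ i) v)))"
    by (intro sum.cong refl) (simp add: vector_sub_rdistrib algebra_simps vec_eq_iff)
  also have "\<dots> = (\<Sum>i\<le>Suc ?n. coeff (pCons 0 q) i *s ((?T ^^ i) v)) - (\<Sum>i\<le>Suc ?n. c *s (coeff q i *s ((?T ^^ i) v)))"
    by (rule sum_subtractf)
  also have "(\<Sum>i\<le>Suc ?n. coeff (pCons 0 q) i *s ((?T ^^ i) v)) = (\<Sum>i\<le>?n. coeff q i *s ((?T ^^ Suc i) v))"
    by (subst sum.atMost_Suc_shift) simp
  also have "(\<Sum>i\<le>Suc ?n. c *s (coeff q i *s ((?T ^^ i) v))) = (\<Sum>i\<le>?n. c *s (coeff q i *s ((?T ^^ i) v)))"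
    by (simp add: coeff_eq_0)
  also have "(\<Sum>i\<le>?n. coeff q i *s ((?T ^^ Suc i) v)) - (\<Sum>i\<le>?n. c *s (coeff q i *s ((?T ^^ i) v)))
     = poly_apply q A (A *v v - c *s v)"
    unfolding poly_apply_def lin sum_subtractf[symmetric]
    by (intro sum.cong refl) (simp add: vec_eq_iff algebra_simps)
  finally show ?thesis .
qed

lemma complex_smult_cart: "complex_of_real a *s (v :: complex ^ 'n) = a *\<^sub>R v"
  unfolding vec_eq_iff vector_smult_component vector_scaleR_component by (simp add: scaleR_conv_of_real)

text \<open>The vectors \<open>v, A v, A\<^sup>2 v, \<dots>\<close> cannot all be linearly independent. Coefficients of a
dependency form the polynomial.\<close>

lemma annihilating_poly_exists:
  fixes A :: "complex ^ 'n ^ 'n"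
  obtains p where "p \<noteq> 0" "poly_apply p A v = 0"
proof -
  let ?u = "\<lambda>i. ((*v) A ^^ i) v" and ?n = "DIM(complex ^ 'n)"
  have "\<exists>a :: nat \<Rightarrow> real. (\<exists>i\<le>?n. a i \<noteq> 0) \<and> (\<Sum>i\<le>?n. a i *\<^sub>R ?u i) = 0"
  proof (cases "inj_on ?u {..?n}")
    case True
    have "card (?u ` {..?n}) > ?n" using card_image[OF True] by simp
    then have "dependent (?u ` {..?n})" by (intro dependent_biggerset) auto
    then obtain b where b: "\<exists>x\<in>?u ` {..?n}. b x \<noteq> 0" "(\<Sum>x\<in>?u ` {..?n}. b x *\<^sub>R x) = 0"
      by (subst (asm) dependent_finite) auto
    from b(2) have "(\<Sum>i\<le>?n. b (?u i) *\<^sub>R ?u i) = 0" unfolding sum.reindex[OF True] comp_def .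
    with b(1) show ?thesis by (intro exI[of _ "\<lambda>i. b (?u i)"]) auto
  next
    case False
    then obtain i j where ij: "i \<le> ?n" "j \<le> ?n" "i \<noteq> j" "?u i = ?u j" by (auto simp: inj_on_def)
    let ?a = "\<lambda>k. if k = i then 1 else if k = j then -1 else (0::real)"
    have "(\<Sum>k\<le>?n. ?a k *\<^sub>R ?u k) = (\<Sum>k\<le>?n. (if k = i then ?u i else 0) - (if k = j then ?u j else 0))"
      using ij by (intro sum.cong) auto
    also have "\<dots> = 0" using ij by (simp add: sum_subtractf)
    finally show ?thesis using ij by (intro exI[of _ ?a]) auto
  qed
  then obtain a :: "nat \<Rightarrow> real" and i where a: "i \<le> ?n" "a i \<noteq> 0" "(\<Sum>i\<le>?n. a i *\<^sub>R ?u i) = 0" by blast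
  define p where "p = (\<Sum>i\<le>?n. monom (complex_of_real (a i)) i)"
  have cp: "coeff p k = (if k \<le> ?n then complex_of_real (a k) else 0)" for k
    by (simp add: p_def coeff_sum if_distrib cong: if_cong)
  have "p \<noteq> 0" using cp[of i] a by auto
  moreover have "degree p \<le> ?n" by (rule degree_le) (simp add: cp)
  then have "poly_apply p A v = (\<Sum>i\<le>?n. a i *\<^sub>R ?u i)"
    by (subst poly_apply_bound) (auto simp: cp complex_smult_cart intro!: sum.cong)
  ultimately show ?thesis using that a by simp
qed

text \<open>Induction on the degree of a polynomial annihilating \<open>v\<close>. Split off a root \<open>c\<close> and put
\<open>w = A v - c v\<close>, which is annihilated by a polynomial of smaller degree, so \<open>A\<^sup>m w\<close> tends to 0. If
\<open>\<bar>c\<bar> < 1\<close>, the recursion \<open>A\<^sup>m\<^sup>+\<^sup>1 v = c A\<^sup>m v + A\<^sup>m w\<close> forces \<open>A\<^sup>m v\<close> to 0. Otherwise \<open>c\<close> is no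
eigenvalue, and \<open>A\<^sup>m v\<close> is recovered from \<open>A\<^sup>m w\<close> by the continuous inverse of \<open>A - c\<close>.\<close>

lemma matrix_powers_tendsto_0:
  fixes A :: "complex ^ 'n ^ 'n"
  assumes ev: "\<And>c v. v \<noteq> 0 \<Longrightarrow> A *v v = c *s v \<Longrightarrow> cmod c < 1"
  shows "(\<lambda>m. ((*v) A ^^ m) v) \<longlonglongrightarrow> 0"
proof -
  let ?T = "(*v) A"
  have T0: "(?T ^^ m) 0 = 0" for m by (induction m) auto
  have main: "(\<lambda>m. (?T ^^ m) v) \<longlonglongrightarrow> 0" if "p \<noteq> 0" "poly_apply p A v = 0" for p v
    using that
  proof (induction "degree p" arbitrary: p v rule: less_induct)
    case less
    show ?case
    proof (cases "degree p = 0")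
      case True
      then obtain a where "p = [:a:]" by (rule degree_eq_zeroE)
      with less.prems have "v = 0" by (simp add: poly_apply_def vec_eq_iff)
      then show ?thesis by (simp add: T0)
    next
      case False
      then have "\<not> constant (poly p)" by (simp add: constant_degree)
      then obtain c where "poly p c = 0" using fundamental_theorem_of_algebra by blast
      then obtain q where q: "p = [:- c, 1:] * q" by (auto simp: poly_eq_0_iff_dvd)
      have q0: "q \<noteq> 0" using less.prems q by auto
      have "degree p = Suc (degree q)"
        unfolding q using q0 by (subst degree_mult_eq) auto
      then have dq: "degree q < degree p" by simp
      define w where "w = A *v v - c *s v"
      have "poly_apply q A w = 0" using less.prems(2) unfolding q poly_apply_linear_factor w_def .
      then have w: "(\<lambda>m. (?T ^^ m) w) \<longlonglongrightarrow> 0" using less.hyps[OF dq q0] by blast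
      have step: "(?T ^^ m) w = A *v ((?T ^^ m) v) - c *s (?T ^^ m) v" for m
      proof (induction m)
        case (Suc m)
        then show ?case by (simp add: matrix_vector_mult_diff_distrib vector_scalar_commute)
      qed (simp add: w_def)
      show ?thesis
      proof (cases "cmod c < 1")
        case True
        have "(\<lambda>m. norm ((?T ^^ m) v)) \<longlonglongrightarrow> 0"
        proof (rule perturbed_geometric_tendsto_0[of "cmod c"])
          show "(\<lambda>m. norm ((?T ^^ m) w)) \<longlonglongrightarrow> 0" using w by (rule tendsto_norm_zero)
          fix m
          have "(?T ^^ Suc m) v = c *s (?T ^^ m) v + (?T ^^ m) w" by (simp add: step)
          also have "norm \<dots> \<le> norm (c *s (?T ^^ m) v) + norm ((?T ^^ m) w)" by (rule norm_triangle_ineq)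
          also have "norm (c *s (?T ^^ m) v) = cmod c * norm ((?T ^^ m) v)"
            by (simp add: norm_vec_def norm_mult L2_set_right_distrib)
          finally show "norm ((?T ^^ Suc m) v) \<le> cmod c * norm ((?T ^^ m) v) + norm ((?T ^^ m) w)" .
        qed (use True in auto)
        then show ?thesis by (rule tendsto_norm_zero_cancel)
      next
        case False
        let ?f = "\<lambda>x. A *v x - c *s x"
        have lin: "linear ?f"
        proof (rule linearI)
          show "?f (x + y) = ?f x + ?f y" for x y
            by (simp add: matrix_vector_right_distrib vec_eq_iff algebra_simps)
          show "?f (a *\<^sub>R x) = a *\<^sub>R ?f x" for a x
            unfolding complex_smult_cart[symmetric] vector_scalar_commute by (simp add: vec_eq_iff algebra_simps)
        qed
        have "x = 0" if "?f x = 0" for x using ev[of x c] that False by auto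
        then have "inj ?f" unfolding linear_injective_0[OF lin] by blast
        then have "\<exists>S. linear S \<and> S \<circ> ?f = id" by (rule linear_injective_left_inverse[OF lin])
        then obtain S where S': "linear S \<and> S \<circ> ?f = id" ..
        note S = conjunct1[OF S'] conjunct2[OF S']
        have Sf: "S (?f x) = x" for x using fun_cong[OF S(2), of x] by simp
        have "(\<lambda>m. S ((?T ^^ m) w)) \<longlonglongrightarrow> S 0"
          using bounded_linear.tendsto[OF _ w, of S] S(1) by (simp add: linear_conv_bounded_linear)
        then show ?thesis unfolding step Sf using linear_0[OF S(1)] by simp
      qed
    qed
  qed
  obtain p where "p \<noteq> 0" "poly_apply p A v = 0" by (rule annihilating_poly_exists)
  then show ?thesis by (rule main)
qed

text \<open>The eigenvalues of the inverse are the reciprocals of those of \<open>M\<close>, hence lie inside the unit disc.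
Powers of the complexified inverse act on real vectors as those of the real one.\<close>

lemma expansive_inverse_powers_tendsto_0:
  fixes M :: "real ^ 'd ^ 'd"
  assumes M: "invertible M" and ex: "expansive M"
  shows "(\<lambda>m. matrix_powi M (- int m) *v x) \<longlonglongrightarrow> 0"
proof -
  define cm where "cm = (\<lambda>B :: real ^ 'd ^ 'd. (\<chi> i j. complex_of_real (B $ i $ j)) :: complex ^ 'd ^ 'd)"
  define cv where "cv = (\<lambda>y :: real ^ 'd. (\<chi> i. complex_of_real (y $ i)) :: complex ^ 'd)"
  let ?N = "matrix_inv M"
  have cmv: "cm B *v cv y = cv (B *v y)" for B y
    by (simp add: cm_def cv_def vec_eq_iff matrix_vector_mult_def)
  have "cm M ** cm ?N = cm (M ** ?N)"
    by (simp add: cm_def vec_eq_iff matrix_matrix_mult_def)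
  also have "\<dots> = mat 1" by (simp add: matrix_inv_right[OF M] cm_def mat_def vec_eq_iff)
  finally have MN: "cm M ** cm ?N = mat 1" .
  have ev: "cmod c < 1" if v: "v \<noteq> 0" and Av: "cm ?N *v v = c *s v" for c v
  proof -
    have "v = cm M *v (cm ?N *v v)" by (simp add: matrix_vector_mul_assoc MN)
    also have "\<dots> = c *s (cm M *v v)" by (simp add: Av vector_scalar_commute)
    finally have eq: "v = c *s (cm M *v v)" .
    have c: "c \<noteq> 0"
    proof
      assume "c = 0"
      with eq have "v = 0" by (simp add: vec_eq_iff)
      with v show False by simp
    qed
    have "(1 / c) *s v = (1 / c) *s (c *s (cm M *v v))" using eq by simp
    also have "\<dots> = cm M *v v" using c by (simp add: vec_eq_iff)
    finally have "cm M *v v = (1 / c) *s v" by simp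
    then have "cmod (1 / c) > 1" using ex v unfolding expansive_def cm_def by blast
    then show ?thesis using c by (simp add: norm_divide field_simps)
  qed
  have pow: "matrix_powi M (- int m) *v x = ((*v) ?N ^^ m) x" for m
  proof (cases m)
    case 0
    then show ?thesis by (simp add: matrix_powi_0)
  next
    case (Suc n)
    have "(((**) ?N) ^^ k) (mat 1) *v x = ((*v) ?N ^^ k) x" for k
      by (induction k) (simp_all add: matrix_vector_mul_assoc[symmetric])
    moreover have "matrix_powi M (- int m) = (((**) ?N) ^^ m) (mat 1)"
      using Suc unfolding matrix_powi_def by (simp del: of_nat_Suc funpow.simps)
    ultimately show ?thesis by simp
  qed
  have "((*v) (cm ?N) ^^ m) (cv x) = cv (((*v) ?N ^^ m) x)" for m
    by (induction m) (simp_all add: cmv)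
  then have "(\<lambda>m. cv (matrix_powi M (- int m) *v x)) \<longlonglongrightarrow> 0"
    using matrix_powers_tendsto_0[where A="cm ?N" and v="cv x", OF ev] by (simp add: pow)
  then have "(\<lambda>m. cv (matrix_powi M (- int m) *v x) $ i) \<longlonglongrightarrow> 0 $ i" for i by (rule tendsto_vec_nth)
  then have "(\<lambda>m. Re (cv (matrix_powi M (- int m) *v x) $ i)) \<longlonglongrightarrow> Re (0 $ i)" for i by (rule tendsto_Re)
  then show ?thesis by (intro vec_tendstoI) (simp add: cv_def)
qed

lemma expansive_shrinks_ball:
  fixes M :: "real ^ 'd ^ 'd"
  assumes M: "invertible M" and ex: "expansive M" and \<delta>: "\<delta> > 0"
  obtains m where "\<And>x. norm x < R \<Longrightarrow> norm (matrix_powi M (- int m) *v x) < \<delta>"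
proof -
  define S where "S = (\<lambda>m. \<Sum>i\<in>UNIV. norm (matrix_powi M (- int m) *v axis i 1))"
  have "S \<longlonglongrightarrow> (\<Sum>i\<in>(UNIV :: 'd set). norm (0 :: real ^ 'd))"
    unfolding S_def by (intro tendsto_sum tendsto_norm expansive_inverse_powers_tendsto_0 M ex)
  then have "(\<lambda>m. \<bar>R\<bar> * S m) \<longlonglongrightarrow> \<bar>R\<bar> * 0" by (intro tendsto_mult_left) simp
  then have "eventually (\<lambda>m. \<bar>R\<bar> * S m < \<delta>) sequentially" using \<delta> by (intro order_tendstoD) auto
  then obtain m where m: "\<bar>R\<bar> * S m < \<delta>" by (auto simp: eventually_sequentially)
  show ?thesis
  proof (rule that[of m])
    fix x :: "real ^ 'd" assume x: "norm x < R"
    let ?A = "matrix_powi M (- int m)"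
    have "?A *v x = ?A *v (\<Sum>i\<in>UNIV. x $ i *\<^sub>R axis i 1)"
      using basis_expansion[of x] by (simp add: scalar_mult_eq_scaleR)
    also have "\<dots> = (\<Sum>i\<in>UNIV. x $ i *\<^sub>R (?A *v axis i 1))"
      by (simp add: linear_sum[OF matrix_vector_mul_linear] linear_cmul[OF matrix_vector_mul_linear])
    finally have "norm (?A *v x) \<le> (\<Sum>i\<in>UNIV. norm (x $ i *\<^sub>R (?A *v axis i 1)))" using norm_sum by metis
    also have "\<dots> \<le> (\<Sum>i\<in>UNIV. \<bar>R\<bar> * norm (?A *v axis i 1))"
    proof (intro sum_mono)
      fix i
      have "\<bar>x $ i\<bar> \<le> \<bar>R\<bar>" using component_le_norm_cart[of x i] x by linarith
      then show "norm (x $ i *\<^sub>R (?A *v axis i 1)) \<le> \<bar>R\<bar> * norm (?A *v axis i 1)"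
        by (simp add: mult_right_mono)
    qed
    also have "\<dots> = \<bar>R\<bar> * S m" by (simp add: S_def sum_distrib_left)
    finally show "norm (?A *v x) < \<delta>" using m by linarith
  qed
qed

section \<open>Vanishing of the coarse coefficients\<close>

text \<open>The neighbourhood of the integer lattice. The centres are written \<open>- k\<close> because the argument
\<open>U *v x - k\<close> of a shifted function is near \<open>- k\<close> when \<open>U *v x\<close> is near the origin.\<close>

definition near_lattice :: "real \<Rightarrow> (real ^ 'd) set" where
  "near_lattice \<delta> = (\<Union>k\<in>int_vecs. ball (- k) \<delta>)"

lemma near_lattice_sets: "near_lattice \<delta> \<in> sets lebesgue"
  unfolding near_lattice_def by (intro sets_completionI_sets) (simp add: borel_open open_UN)

text \<open>The neighbourhoods shrink to the lattice, which is closed and a null set.\<close>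

lemma near_lattice_mass_tendsto_0:
  fixes f :: "real ^ 'd \<Rightarrow> complex"
  assumes f: "f \<in> L2"
  shows "(\<lambda>n. L2_normsq (\<lambda>y. indicator (near_lattice (1 / real (n + 2))) y * f y)) \<longlonglongrightarrow> 0"
proof -
  note [measurable] = L2_measurable[OF f] near_lattice_sets
  have "(\<lambda>n. L2_normsq (\<lambda>y. indicator (near_lattice (1 / real (n + 2))) y * f y)) \<longlonglongrightarrow> (\<integral>\<^sup>+x. 0 \<partial>(lebesgue :: (real^'d) measure))"
    unfolding L2_normsq_def
  proof (rule nn_integral_dominated_convergence[where w="\<lambda>x. ennreal ((cmod (f x))\<^sup>2)"])
    show "(\<integral>\<^sup>+x. ennreal ((cmod (f x))\<^sup>2) \<partial>lebesgue) < \<infinity>"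
      using f by (simp add: L2_iff L2_normsq_def)
    have "(int_vecs :: (real ^ 'd) set) \<in> null_sets lebesgue"
      by (intro null_sets_completionI countable_imp_null_set_lborel countable_int_vecs)
    then have "AE y in lebesgue. y \<notin> (int_vecs :: (real ^ 'd) set)" by (rule AE_not_in)
    then show "AE y in lebesgue. (\<lambda>n. ennreal ((cmod (indicator (near_lattice (1 / real (n + 2))) y * f y))\<^sup>2)) \<longlonglongrightarrow> 0"
    proof eventually_elim
      fix y :: "real ^ 'd" assume y: "y \<notin> int_vecs"
      have "finite (cball y 1 \<inter> int_vecs)" by (rule finite_bounded_int_vecs) simp
      then obtain d where d: "d > 0" "\<And>x. x \<in> cball y 1 \<inter> int_vecs \<Longrightarrow> x \<noteq> y \<Longrightarrow> d \<le> dist y x"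
        using finite_set_avoid by metis
      \<comment> \<open>Only finitely many lattice points lie within distance 1 of \<open>y\<close>, so \<open>y\<close> keeps a positive distance from all of them.\<close>
      have far: "min d 1 \<le> dist y (- k)" if k: "k \<in> int_vecs" for k
      proof (cases "- k \<in> cball y 1")
        case True
        then show ?thesis using d(2)[of "- k"] y int_vecs_uminus[OF k] by force
      qed (auto simp: min_def)
      obtain n0 where n0: "1 / real (n0 + 2) < min d 1"
      proof -
        obtain n where "inverse (real (Suc n)) < min d 1" using reals_Archimedean[of "min d 1"] d(1) by auto
        moreover have "1 / real (n + 2) \<le> inverse (real (Suc n))" by (simp add: field_simps)
        ultimately show ?thesis by (intro that[of n]) linarith
      qed
      have "y \<notin> near_lattice (1 / real (n + 2))" if "n \<ge> n0" for n
      proof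
        assume "y \<in> near_lattice (1 / real (n + 2))"
        then obtain k where k: "k \<in> int_vecs" "dist (- k) y < 1 / real (n + 2)" by (auto simp: near_lattice_def)
        moreover have "1 / real (n + 2) \<le> 1 / real (n0 + 2)" using that by (simp add: field_simps)
        ultimately have "dist y (- k) < 1 / real (n0 + 2)" by (simp only: dist_commute)
        then show False using far[OF k(1)] n0 by linarith
      qed
      then have "eventually (\<lambda>n. ennreal ((cmod (indicator (near_lattice (1 / real (n + 2))) y * f y))\<^sup>2) = 0) sequentially"
        unfolding eventually_sequentially by (intro exI[of _ n0]) auto
      then show "(\<lambda>n. ennreal ((cmod (indicator (near_lattice (1 / real (n + 2))) y * f y))\<^sup>2)) \<longlonglongrightarrow> 0"
        by (rule tendsto_eventually)
    qed
    show "AE x in lebesgue. ennreal ((cmod (indicator (near_lattice (1 / real (n + 2))) x * f x))\<^sup>2) \<le> ennreal ((cmod (f x))\<^sup>2)" for n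
      by (rule AE_I2) (auto simp: indicator_def)
  qed measurable
  then show ?thesis by simp
qed

lemma int_vecs_separated:
  assumes "k \<in> int_vecs" "l \<in> int_vecs" "k \<noteq> l"
  shows "1 \<le> dist k l"
proof -
  obtain i where i: "k $ i \<noteq> l $ i" using assms(3) by (auto simp: vec_eq_iff)
  have "k $ i - l $ i \<in> \<int>" using assms(1,2) by (simp add: int_vecs_def)
  then obtain n where n: "k $ i - l $ i = real_of_int n" by (auto elim: Ints_cases)
  with i have "n \<noteq> 0" by auto
  then have "1 \<le> \<bar>real_of_int n\<bar>" by linarith
  also have "\<dots> = \<bar>(k - l) $ i\<bar>" by (simp add: n)
  also have "\<dots> \<le> dist k l" unfolding dist_norm by (rule component_le_norm_cart)
  finally show ?thesis .
qed

text \<open>On the support of \<open>g\<close> the argument \<open>U *v x\<close> is within \<open>\<delta>\<close> of the origin, so the inner product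
with \<open>dilate_shift U k f\<close> only sees the values of \<open>f\<close> within \<open>\<delta>\<close> of \<open>- k\<close>. The Cauchy-Schwarz
inequality bounds it by the mass of \<open>f\<close> there, and for \<open>\<delta> \<le> 1 / 2\<close> these balls are disjoint.\<close>

lemma coarse_coefficients_small:
  fixes g f :: "real ^ 'd \<Rightarrow> complex"
  assumes g: "g \<in> L2" and f: "f \<in> L2" and U: "invertible U"
    and supp: "\<And>x. \<not> norm (U *v x) < \<delta> \<Longrightarrow> g x = 0"
    and \<delta>: "\<delta> \<le> 1 / 2" and F: "finite F" "F \<subseteq> int_vecs"
  shows "(\<Sum>k\<in>F. (cmod (L2_inner g (dilate_shift U k f)))\<^sup>2)
    \<le> L2_sqnorm g * L2_sqnorm (\<lambda>y. indicator (near_lattice \<delta>) y * f y)"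
proof -
  define fk where "fk = (\<lambda>k y. indicator (ball (- k) \<delta>) y * f y)"
  have fk: "fk k \<in> L2" for k unfolding fk_def by (intro L2_cutoff f) simp
  have nl: "(\<lambda>y. indicator (near_lattice \<delta>) y * f y) \<in> L2" by (intro L2_cutoff f near_lattice_sets)
  have coeff: "(cmod (L2_inner g (dilate_shift U k f)))\<^sup>2 \<le> L2_sqnorm g * L2_sqnorm (fk k)" for k
  proof -
    have "g x * cnj (dilate_shift U k f x) = g x * cnj (dilate_shift U k (fk k) x)" for x
    proof (cases "norm (U *v x) < \<delta>")
      case True
      then have "U *v x - k \<in> ball (- k) \<delta>" by (simp add: dist_norm norm_minus_commute)
      then show ?thesis by (simp add: dilate_shift_def fk_def)
    qed (simp add: supp)
    then have "L2_inner g (dilate_shift U k f) = L2_inner g (dilate_shift U k (fk k))"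
      unfolding L2_inner_def by (intro Bochner_Integration.integral_cong refl)
    also have "(cmod \<dots>)\<^sup>2 \<le> L2_sqnorm g * L2_sqnorm (dilate_shift U k (fk k))"
      by (intro L2_cauchy_schwarz g L2_dilate_shift U fk)
    also have "L2_sqnorm (dilate_shift U k (fk k)) = L2_sqnorm (fk k)"
      using L2_inner_dilate_shift[OF U L2_measurable[OF fk] L2_measurable[OF fk], of k k k] unfolding L2_inner_self
      by (simp only: of_real_eq_iff)
    finally show ?thesis .
  qed
  have "ennreal (\<Sum>k\<in>F. L2_sqnorm (fk k)) = (\<Sum>k\<in>F. L2_normsq (fk k))"
    by (simp add: L2_normsq_eq[OF fk] L2_sqnorm_nonneg sum_ennreal)
  also have "\<dots> = (\<integral>\<^sup>+y. (\<Sum>k\<in>F. ennreal ((cmod (fk k y))\<^sup>2)) \<partial>lebesgue)"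
    unfolding L2_normsq_def
    by (rule nn_integral_sum[symmetric]) (use L2_measurable[OF fk] in measurable)
  also have "\<dots> \<le> L2_normsq (\<lambda>y. indicator (near_lattice \<delta>) y * f y)"
    unfolding L2_normsq_def
  proof (rule nn_integral_mono)
    fix y
    show "(\<Sum>k\<in>F. ennreal ((cmod (fk k y))\<^sup>2)) \<le> ennreal ((cmod (indicator (near_lattice \<delta>) y * f y))\<^sup>2)"
    proof (cases "\<exists>k\<in>F. y \<in> ball (- k) \<delta>")
      case True
      then obtain k where k: "k \<in> F" "y \<in> ball (- k) \<delta>" by blast
      have other: "fk l y = 0" if "l \<in> F" "l \<noteq> k" for l
      proof (rule ccontr)
        assume "fk l y \<noteq> 0"
        then have "y \<in> ball (- l) \<delta>" by (auto simp: fk_def indicator_def)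
        with k have "dist (- k) (- l) < 2 * \<delta>" using dist_triangle2[of "- k" "- l" y] by (simp add: dist_commute)
        moreover have "1 \<le> dist (- k) (- l)"
          using that k F by (intro int_vecs_separated int_vecs_uminus) auto
        ultimately show False using \<delta> by simp
      qed
      have "(\<Sum>l\<in>F. ennreal ((cmod (fk l y))\<^sup>2)) = ennreal ((cmod (fk k y))\<^sup>2) + (\<Sum>l\<in>F - {k}. ennreal ((cmod (fk l y))\<^sup>2))"
        by (rule sum.remove[OF F(1) k(1)])
      also have "(\<Sum>l\<in>F - {k}. ennreal ((cmod (fk l y))\<^sup>2)) = 0"
        by (intro sum.neutral) (auto simp: other)
      also have "ennreal ((cmod (fk k y))\<^sup>2) \<le> ennreal ((cmod (indicator (near_lattice \<delta>) y * f y))\<^sup>2)"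
        using k F by (auto simp: fk_def near_lattice_def indicator_def)
      finally show ?thesis by simp
    next
      case False
      then have "(\<Sum>k\<in>F. ennreal ((cmod (fk k y))\<^sup>2)) = 0" by (intro sum.neutral) (auto simp: fk_def)
      then show ?thesis by simp
    qed
  qed
  also have "\<dots> = ennreal (L2_sqnorm (\<lambda>y. indicator (near_lattice \<delta>) y * f y))" by (rule L2_normsq_eq[OF nl])
  finally have "(\<Sum>k\<in>F. L2_sqnorm (fk k)) \<le> L2_sqnorm (\<lambda>y. indicator (near_lattice \<delta>) y * f y)"
    by (simp add: L2_sqnorm_nonneg)
  then have "L2_sqnorm g * (\<Sum>k\<in>F. L2_sqnorm (fk k)) \<le> L2_sqnorm g * L2_sqnorm (\<lambda>y. indicator (near_lattice \<delta>) y * f y)"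
    by (rule mult_left_mono) (rule L2_sqnorm_nonneg)
  moreover have "(\<Sum>k\<in>F. (cmod (L2_inner g (dilate_shift U k f)))\<^sup>2) \<le> (\<Sum>k\<in>F. L2_sqnorm g * L2_sqnorm (fk k))"
    by (intro sum_mono coeff)
  ultimately show ?thesis by (simp add: sum_distrib_left)
qed

section \<open>Homogeneous wavelet systems\<close>

text \<open>Two elements of scales \<open>j\<close> and \<open>j'\<close> both belong to the nonhomogeneous system of level
\<open>min j j'\<close>.\<close>

lemma homogeneous_orthonormal:
  assumes B: "\<And>J. orthonormal_basis_L2 (WS_nonhom_index r s J) (WS_nonhom M J \<phi> \<psi>)"
  shows "orthonormal_L2 (WS_hom_index s) (WS_hom M \<psi>)"
  unfolding orthonormal_L2_def
proof (intro conjI ballI)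
  fix p q :: "int \<times> nat \<times> (real ^ 'a)" assume p: "p \<in> WS_hom_index s" and q: "q \<in> WS_hom_index s"
  define J where "J = min (fst p) (fst q)"
  have eq: "WS_nonhom M J \<phi> \<psi> (Inr t) = WS_hom M \<psi> t" for t by (cases t) simp
  have "Inr p \<in> WS_nonhom_index r s J" "Inr q \<in> WS_nonhom_index r s J"
    using p q by (auto simp: J_def WS_hom_index_def WS_nonhom_index_def mem_Times_iff)
  from orthonormal_basis_L2_in_L2[OF B this(1)] orthonormal_basis_L2_inner[OF B this]
  show "WS_hom M \<psi> p \<in> L2" "L2_inner (WS_hom M \<psi> p) (WS_hom M \<psi> q) = (if p = q then 1 else 0)"
    by (simp_all add: eq)
qed

text \<open>Functions with bounded support are dense. For such a \<open>g\<close>, choose a level so coarse that the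
\<open>\<phi>\<close>-coefficients of \<open>g\<close> are negligible; what remains of its expansion at that level is a
combination of homogeneous wavelets.\<close>

lemma homogeneous_basis:
  fixes M :: "real ^ 'd ^ 'd"
  assumes M: "invertible M" and ex: "expansive M" and \<phi>: "\<And>l. l < r \<Longrightarrow> \<phi> l \<in> L2"
    and B: "\<And>J. orthonormal_basis_L2 (WS_nonhom_index r s J) (WS_nonhom M J \<phi> \<psi>)"
  shows "orthonormal_basis_L2 (WS_hom_index s) (WS_hom M \<psi>)"
proof (rule orthonormal_basis_L2_dense[OF homogeneous_orthonormal[OF B]])
  fix f :: "real ^ 'd \<Rightarrow> complex" and \<epsilon> :: real assume f: "f \<in> L2" and \<epsilon>: "\<epsilon> > 0"
  obtain n where n: "L2_normsq (\<lambda>x. indicator (ball 0 (real n)) x * f x - f x) < ennreal \<epsilon>"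
  proof -
    have "eventually (\<lambda>n. L2_normsq (\<lambda>x. indicator (ball 0 (real n)) x * f x - f x) < ennreal \<epsilon>) sequentially"
      using L2_cutoff_tendsto[OF f] unfolding L2_tendsto_def by (rule order_tendstoD) (use \<epsilon> in simp)
    then show ?thesis using that by (auto simp: eventually_sequentially)
  qed
  define g where "g = (\<lambda>x. indicator (ball 0 (real n)) x * f x)"
  have g: "g \<in> L2" unfolding g_def by (intro L2_cutoff f) simp
  have "ennreal (L2_sqnorm (\<lambda>x. f x - g x)) < ennreal \<epsilon>"
    using n L2_normsq_eq[OF L2_diff[OF f g]] L2_normsq_minus_commute[of f g] by (simp add: g_def)
  then have fg: "L2_sqnorm (\<lambda>x. f x - g x) < \<epsilon>" by (simp add: ennreal_less_iff L2_sqnorm_nonneg)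
  define c where "c = L2_sqnorm g"
  have c0: "c \<ge> 0" by (simp add: c_def L2_sqnorm_nonneg)
  \<comment> \<open>Adding 1 to \<open>c\<close> and to \<open>r\<close> keeps the denominator positive; \<open>c * r * \<eta> \<le> \<epsilon> / 2\<close> is what matters.\<close>
  define \<eta> where "\<eta> = \<epsilon> / (2 * (c + 1) * (real r + 1))"
  have \<eta>: "\<eta> > 0" using \<epsilon> c0 by (simp add: \<eta>_def)
  have "\<forall>l\<in>{..<r}. eventually (\<lambda>n. L2_normsq (\<lambda>y. indicator (near_lattice (1 / real (n + 2))) y * \<phi> l y) < ennreal \<eta>) sequentially"
    using near_lattice_mass_tendsto_0[OF \<phi>] \<eta> by (auto intro!: order_tendstoD)
  then have "eventually (\<lambda>n. \<forall>l\<in>{..<r}. L2_normsq (\<lambda>y. indicator (near_lattice (1 / real (n + 2))) y * \<phi> l y) < ennreal \<eta>) sequentially"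
    by (intro eventually_ball_finite) auto
  then obtain q where q: "\<And>l. l < r \<Longrightarrow> L2_normsq (\<lambda>y. indicator (near_lattice (1 / real (q + 2))) y * \<phi> l y) < ennreal \<eta>"
    by (auto simp: eventually_sequentially)
  define \<delta> where "\<delta> = 1 / real (q + 2)"
  have \<delta>: "\<delta> > 0" "\<delta> \<le> 1 / 2" by (auto simp: \<delta>_def field_simps)
  have small: "L2_sqnorm (\<lambda>y. indicator (near_lattice \<delta>) y * \<phi> l y) \<le> \<eta>" if "l < r" for l
    using q[OF that, folded \<delta>_def] unfolding L2_normsq_eq[OF L2_cutoff[OF \<phi>[OF that] near_lattice_sets]]
    by (simp add: ennreal_less_iff L2_sqnorm_nonneg)
  obtain m where m: "\<And>x. norm x < real n \<Longrightarrow> norm (matrix_powi M (- int m) *v x) < \<delta>"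
    using expansive_shrinks_ball[OF M ex \<delta>(1)] by blast
  define J where "J = - int m"
  let ?U = "matrix_powi M J" and ?e = "WS_nonhom M J \<phi> \<psi>"
  have supp: "g x = 0" if "\<not> norm (?U *v x) < \<delta>" for x
    using m[of x] that by (auto simp: g_def J_def indicator_def)
  obtain F where F: "finite F" "F \<subseteq> WS_nonhom_index r s J" and close: "c - (\<Sum>i\<in>F. (cmod (L2_inner g (?e i)))\<^sup>2) < \<epsilon> / 2"
  proof -
    have "((\<lambda>i. (cmod (L2_inner g (?e i)))\<^sup>2) has_sum c) (WS_nonhom_index r s J)"
      unfolding c_def by (rule parseval_L2[OF B g])
    then obtain F where "finite F" "F \<subseteq> WS_nonhom_index r s J" "dist (\<Sum>i\<in>F. (cmod (L2_inner g (?e i)))\<^sup>2) c \<le> \<epsilon> / 4"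
      using has_sum_finite_approximation[of _ _ c "\<epsilon> / 4"] \<epsilon> by (metis divide_pos_pos zero_less_numeral)
    moreover from this(3) have "c - (\<Sum>i\<in>F. (cmod (L2_inner g (?e i)))\<^sup>2) < \<epsilon> / 2"
      using \<epsilon> unfolding dist_real_def by linarith
    ultimately show ?thesis using that by blast
  qed
  define F\<phi> where "F\<phi> = {p. Inl p \<in> F}"
  define F\<psi> where "F\<psi> = {p. Inr p \<in> F}"
  have F_eq: "F = Inl ` F\<phi> \<union> Inr ` F\<psi>"
  proof (rule set_eqI)
    show "i \<in> F \<longleftrightarrow> i \<in> Inl ` F\<phi> \<union> Inr ` F\<psi>" for i
      by (cases i) (auto simp: F\<phi>_def F\<psi>_def)
  qed
  have fin: "finite F\<phi>" "finite F\<psi>"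
    using F(1) unfolding F\<phi>_def F\<psi>_def by (auto intro!: finite_vimageI[of F Inl, unfolded vimage_def] finite_vimageI[of F Inr, unfolded vimage_def])
  have sub: "F\<phi> \<subseteq> {..<r} \<times> int_vecs" "F\<psi> \<subseteq> WS_hom_index s"
    using F(2) by (auto simp: F\<phi>_def F\<psi>_def WS_nonhom_index_def WS_hom_index_def)
  have split: "(\<Sum>i\<in>F. (cmod (L2_inner g (?e i)))\<^sup>2) = (\<Sum>p\<in>F\<phi>. (cmod (L2_inner g (?e (Inl p))))\<^sup>2) + (\<Sum>p\<in>F\<psi>. (cmod (L2_inner g (WS_hom M \<psi> p)))\<^sup>2)"
  proof -
    have "?e (Inr p) = WS_hom M \<psi> p" for p by (cases p) simp
    then show ?thesis unfolding F_eq using fin by (subst sum.union_disjoint) (auto simp: sum.reindex)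
  qed
  have coarse: "(\<Sum>p\<in>F\<phi>. (cmod (L2_inner g (?e (Inl p))))\<^sup>2) \<le> \<epsilon> / 2"
  proof -
    have "(\<Sum>p\<in>F\<phi>. (cmod (L2_inner g (?e (Inl p))))\<^sup>2) \<le> (\<Sum>p\<in>{..<r} \<times> snd ` F\<phi>. (cmod (L2_inner g (?e (Inl p))))\<^sup>2)"
      using fin sub by (intro sum_mono2) force+
    also have "\<dots> = (\<Sum>l<r. \<Sum>k\<in>snd ` F\<phi>. (cmod (L2_inner g (dilate_shift ?U k (\<phi> l))))\<^sup>2)"
      unfolding sum.cartesian_product by (intro sum.cong refl) auto
    also have "\<dots> \<le> (\<Sum>l<r. c * \<eta>)"
    proof (rule sum_mono)
      fix l assume l: "l \<in> {..<r}"
      have "(\<Sum>k\<in>snd ` F\<phi>. (cmod (L2_inner g (dilate_shift ?U k (\<phi> l))))\<^sup>2)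
        \<le> L2_sqnorm g * L2_sqnorm (\<lambda>y. indicator (near_lattice \<delta>) y * \<phi> l y)"
        using l fin sub supp \<delta> by (intro coarse_coefficients_small g \<phi> invertible_matrix_powi M) auto
      also have "\<dots> \<le> c * \<eta>"
        using l small[of l] c0 unfolding c_def by (intro mult_left_mono) auto
      finally show "(\<Sum>k\<in>snd ` F\<phi>. (cmod (L2_inner g (dilate_shift ?U k (\<phi> l))))\<^sup>2) \<le> c * \<eta>" .
    qed
    also have "\<dots> = (c * real r) * \<eta>" by simp
    also have "\<dots> \<le> ((c + 1) * (real r + 1)) * \<eta>"
      using c0 \<eta> by (intro mult_right_mono mult_mono) auto
    also have "\<dots> = \<epsilon> / 2"
    proof -
      have "D * (\<epsilon> / (2 * D)) = \<epsilon> / 2" if "D > 0" for D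
        using that by simp
      from this[of "(c + 1) * (real r + 1)"] show ?thesis
        using c0 by (simp only: \<eta>_def mult.assoc[symmetric]) (simp add: mult.assoc)
    qed
    finally show ?thesis .
  qed
  have "L2_sqnorm g - (\<Sum>p\<in>F\<psi>. (cmod (L2_inner g (WS_hom M \<psi> p)))\<^sup>2) < \<epsilon>"
    using close coarse unfolding split c_def by linarith
  with g fg fin(2) sub(2) show "\<exists>g\<in>L2. L2_sqnorm (\<lambda>x. f x - g x) < \<epsilon> \<and>
    (\<exists>F. finite F \<and> F \<subseteq> WS_hom_index s \<and> L2_sqnorm g - (\<Sum>i\<in>F. (cmod (L2_inner g (WS_hom M \<psi> i)))\<^sup>2) < \<epsilon>)"
    by blast
qed

theorem theorem1:
  fixes M :: "real ^ 'd ^ 'd"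
    and \<phi> \<psi> :: "nat \<Rightarrow> real ^ 'd \<Rightarrow> complex"
    and r s :: nat and J :: int
  assumes "integer_matrix M" and "invertible M"
    and "\<forall>l<r. \<phi> l \<in> L2" and "\<forall>l<s. \<psi> l \<in> L2"
    and "orthonormal_basis_L2 (WS_nonhom_index r s J) (WS_nonhom M J \<phi> \<psi>)"
  shows "real s = real r * (\<bar>det M\<bar> - 1)
    \<and> (\<exists>a b :: nat \<Rightarrow> nat \<Rightarrow> real ^ 'd \<Rightarrow> complex.
         (\<forall>i<r. \<forall>j<r. a i j \<in> L2_torus) \<and>
         (\<forall>i<s. \<forall>j<r. b i j \<in> L2_torus) \<and>
         (AE \<xi> in lebesgue.
            (\<forall>i<r. fourier_L2 (\<phi> i) (transpose M *v \<xi>) = (\<Sum>j<r. a i j \<xi> * fourier_L2 (\<phi> j) \<xi>)) \<and>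
            (\<forall>i<s. fourier_L2 (\<psi> i) (transpose M *v \<xi>) = (\<Sum>j<r. b i j \<xi> * fourier_L2 (\<phi> j) \<xi>))))
    \<and> (expansive M \<longrightarrow> orthonormal_basis_L2 (WS_hom_index s) (WS_hom M \<psi>))"
proof -
  have \<phi>: "\<And>l. l < r \<Longrightarrow> \<phi> l \<in> L2" and \<psi>: "\<And>l. l < s \<Longrightarrow> \<psi> l \<in> L2" using assms by auto
  have B: "orthonormal_basis_L2 (WS_nonhom_index r s j) (WS_nonhom M j \<phi> \<psi>)" for j
    by (rule WS_nonhom_change_level[OF assms(2,5)])
  have count: "real s = real r * (\<bar>det M\<bar> - 1)"
    by (rule generator_count[OF assms(2) \<phi> \<psi> B B assms(1)])
  note mask = refinement_masks[OF assms(2) \<phi> \<psi> B B]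
  have "\<forall>i\<in>{..<r}. \<exists>m. (\<forall>j<r. m j \<in> L2_torus) \<and>
      (AE \<xi> in lebesgue. fourier_L2 (\<phi> i) (transpose M *v \<xi>) = (\<Sum>j<r. m j \<xi> * fourier_L2 (\<phi> j) \<xi>))"
    using mask[of "Inl _"] by auto
  then obtain a where a: "\<And>i j. i < r \<Longrightarrow> j < r \<Longrightarrow> a i j \<in> L2_torus"
    "\<And>i. i < r \<Longrightarrow> AE \<xi> in lebesgue. fourier_L2 (\<phi> i) (transpose M *v \<xi>) = (\<Sum>j<r. a i j \<xi> * fourier_L2 (\<phi> j) \<xi>)"
    unfolding bchoice_iff by auto
  have "\<forall>i\<in>{..<s}. \<exists>m. (\<forall>j<r. m j \<in> L2_torus) \<and>
      (AE \<xi> in lebesgue. fourier_L2 (\<psi> i) (transpose M *v \<xi>) = (\<Sum>j<r. m j \<xi> * fourier_L2 (\<phi> j) \<xi>))"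
    using mask[of "Inr _"] by auto
  then obtain b where b: "\<And>i j. i < s \<Longrightarrow> j < r \<Longrightarrow> b i j \<in> L2_torus"
    "\<And>i. i < s \<Longrightarrow> AE \<xi> in lebesgue. fourier_L2 (\<psi> i) (transpose M *v \<xi>) = (\<Sum>j<r. b i j \<xi> * fourier_L2 (\<phi> j) \<xi>)"
    unfolding bchoice_iff by auto
  have "AE \<xi> in lebesgue. \<forall>i\<in>{..<r}. fourier_L2 (\<phi> i) (transpose M *v \<xi>) = (\<Sum>j<r. a i j \<xi> * fourier_L2 (\<phi> j) \<xi>)"
    using a(2) by (subst AE_ball_countable) auto
  moreover have "AE \<xi> in lebesgue. \<forall>i\<in>{..<s}. fourier_L2 (\<psi> i) (transpose M *v \<xi>) = (\<Sum>j<r. b i j \<xi> * fourier_L2 (\<phi> j) \<xi>)"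
    using b(2) by (subst AE_ball_countable) auto
  ultimately have "AE \<xi> in lebesgue.
            (\<forall>i<r. fourier_L2 (\<phi> i) (transpose M *v \<xi>) = (\<Sum>j<r. a i j \<xi> * fourier_L2 (\<phi> j) \<xi>)) \<and>
            (\<forall>i<s. fourier_L2 (\<psi> i) (transpose M *v \<xi>) = (\<Sum>j<r. b i j \<xi> * fourier_L2 (\<phi> j) \<xi>))"
    by eventually_elim simp
  with a(1) b(1) have masks: "\<exists>a b :: nat \<Rightarrow> nat \<Rightarrow> real ^ 'd \<Rightarrow> complex.
         (\<forall>i<r. \<forall>j<r. a i j \<in> L2_torus) \<and>
         (\<forall>i<s. \<forall>j<r. b i j \<in> L2_torus) \<and>
         (AE \<xi> in lebesgue.
            (\<forall>i<r. fourier_L2 (\<phi> i) (transpose M *v \<xi>) = (\<Sum>j<r. a i j \<xi> * fourier_L2 (\<phi> j) \<xi>)) \<and>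
            (\<forall>i<s. fourier_L2 (\<psi> i) (transpose M *v \<xi>) = (\<Sum>j<r. b i j \<xi> * fourier_L2 (\<phi> j) \<xi>)))"
    by (intro exI[of _ a] exI[of _ b]) auto
  have "orthonormal_basis_L2 (WS_hom_index s) (WS_hom M \<psi>)" if "expansive M"
    by (rule homogeneous_basis[OF assms(2) that \<phi> B])
  with count masks show ?thesis by blast
qed

end
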